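(* The local 3-reflective $C^\infty$-smooth real planar projective billiards are exactly the real right-spherical billiards. That is, let $(\alpha,\beta,\gamma)$ be a $C^\infty$-smooth local projective billiard in $\mathbb{R}^2$ (three germs of $C^\infty$-smooth line-framed planar curves) whose base points form a 3-periodic orbit. Then $(\alpha,\beta,\gamma)$ is 3-reflective if and only if there exist three non-collinear points $P,Q,R\in\mathbb{RP}^2$ such that $\alpha,\beta,\gamma$ are germs, at their respective base points, of $\omega(PQ,R)$, $\omega(QR,P)$, $\omega(RP,Q)$.
   Context: $\mathbb{P}(T\mathbb{R}^2)$ is the set of pairs $(A,L)$ with $A\in\mathbb{R}^2$ and $L$ a line through $A$ (identified with a 1-dimensional subspace of $T_A\mathbb{R}^2$); $\pi(A,L)=A$. A line-framed planar curve is a regularly embedded connected curve $\alpha\subset\mathbb{P}(T\mathbb{R}^2)$ such that $\pi$ sends $\alpha$ diffeomorphically onto a regularly embedded curve $a\subset\mathbb{R}^2$ (its classical boundary), and for every $(A,L)\in\alpha$ the line $L$ is transversal to $T_Aa$. A local projective billiard is a collection of germs of line-framed curves $\alpha_1,\dots,\alpha_k$, with classical boundaries $a_1,\dots,a_k$; it is $C^\infty$-smooth if all $\alpha_j$ are. Symmetry of lines: for distinct lines $L,T$ through a point $A$, two lines $\ell,\ell'$ through $A$ are symmetric with respect to $(L,T)$ if $\ell=\ell'=L$, or $\ell=\ell'=T$, or $L,T,\ell,\ell'$ are distinct and form a harmonic quadruple, i.e. their cross-ratio $(L,T;\ell,\ell')$ equals $-1$ (the cross-ratio of four concurrent lines is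 that of their intersection points with a line not through the common point; $(X_1,X_2;X_3,X_4)=h(X_1)$ where $h$ is the projective transformation with $h(X_2)=1,h(X_3)=0,h(X_4)=\infty$). A $k$-periodic orbit of a local projective billiard is a $k$-tuple $(A_1,L_1),\dots,(A_k,L_k)$, $(A_j,L_j)\in\alpha_j$, such that for every $j=1,\dots,k$ (indices cyclic, $A_0=A_k$, $A_{k+1}=A_1$) one has $A_j\ne A_{j\pm1}$, and the lines $A_{j-1}A_j$, $A_jA_{j+1}$ are not tangent to $a_j$ at $A_j$ and are symmetric with respect to $(L_j,T_{A_j}a_j)$. The billiard is $k$-reflective if its base points form a $k$-periodic orbit and every pair in $\alpha_1\times\alpha_2$ close to the pair of base points extends to a $k$-periodic orbit close to the base orbit. Right-spherical billiard: for a line $\ell$ and a point $P\notin\ell$ in the projective plane, $\omega(\ell,P)=\{(A,AP): A\in\ell\}$, where $AP$ is the line through $A$ and $P$. For non-collinear points $P,Q,R$, the right-spherical billiard is $(\omega(PQ,R),\omega(QR,P),\omega(RP,Q))$; the plane $\mathbb{R}^2$ is regarded as an affine chart of $\mathbb{RP}^2$. *)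

theory Defs
  imports "HOL-Analysis.Analysis"
begin

section \<open>Smooth embedded curves in Euclidean spaces\<close>

text \<open>\<open>C\<^sup>\<infinity>\<close>-smoothness on an open set of parameters: \<open>D n\<close> is the \<open>n\<close>-th derivative.\<close>

definition smooth_curve_on :: "real set \<Rightarrow> (real \<Rightarrow> 'a::real_normed_vector) \<Rightarrow> bool" where
  "smooth_curve_on I c \<longleftrightarrow>
     (\<exists>D :: nat \<Rightarrow> real \<Rightarrow> 'a.
        (\<forall>t\<in>I. D 0 t = c t) \<and>
        (\<forall>n. \<forall>t\<in>I. (D n has_vector_derivative D (Suc n) t) (at t)))"

text \<open>A regularly embedded curve is a 1-dimensional embedded submanifold: locally the
  homeomorphic image of an open interval under an immersion.\<close>

definition embedded_curve :: "'a::euclidean_space set \<Rightarrow> bool" where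
  "embedded_curve S \<longleftrightarrow>
     (\<forall>p\<in>S. \<exists>U I c d. open U \<and> p \<in> U \<and> open I \<and> connected I \<and>
        smooth_curve_on I c \<and> (\<forall>t\<in>I. vector_derivative c (at t) \<noteq> 0) \<and>
        homeomorphism I (S \<inter> U) c d)"

definition tangent_space :: "'a::euclidean_space set \<Rightarrow> 'a \<Rightarrow> 'a set" where
  "tangent_space S p =
     {v. \<exists>e>0. \<exists>c. smooth_curve_on {-e<..<e} c \<and> c ` {-e<..<e} \<subseteq> S \<and> c 0 = p \<and>
           (c has_vector_derivative v) (at 0)}"

section \<open>The projectivized tangent bundle of the plane\<close>

text \<open>A pair \<open>(A, L)\<close> consists of a point and a 1-dimensional subspace of the tangent space at
  \<open>A\<close>; the actual line is the translate of \<open>L\<close> through \<open>A\<close>.\<close>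

type_synonym line_element = "(real^2) \<times> (real^2) set"

definition PT :: "line_element set" where
  "PT = {(A, L). subspace L \<and> dim L = 1}"

text \<open>The inverses of the two standard charts (slope with respect to either axis); they form an
  atlas of the 3-manifold \<open>PT\<close>, and define its topology and smooth structure.\<close>

definition slope_chart :: "(real^2) \<times> real \<Rightarrow> line_element" where
  "slope_chart = (\<lambda>(A, s). (A, span {vector [1, s]}))"

definition coslope_chart :: "(real^2) \<times> real \<Rightarrow> line_element" where
  "coslope_chart = (\<lambda>(A, s). (A, span {vector [s, 1]}))"

definition PT_charts :: "((real^2) \<times> real \<Rightarrow> line_element) set" where
  "PT_charts = {slope_chart, coslope_chart}"

definition PT_topology :: "line_element topology" where
  "PT_topology = topology (\<lambda>U. U \<subseteq> PT \<and> (\<forall>\<phi>\<in>PT_charts. open (\<phi> -` U)))"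

lemma openin_PT_topology:
  "openin PT_topology U \<longleftrightarrow> U \<subseteq> PT \<and> (\<forall>\<phi>\<in>PT_charts. open (\<phi> -` U))"
proof -
  have "istopology (\<lambda>U. U \<subseteq> PT \<and> (\<forall>\<phi>\<in>PT_charts. open (\<phi> -` U)))"
    unfolding istopology_def by (auto simp: vimage_Union vimage_Int)
  then show ?thesis
    by (simp add: PT_topology_def)
qed

definition smooth_PT_curve_on :: "real set \<Rightarrow> (real \<Rightarrow> line_element) \<Rightarrow> bool" where
  "smooth_PT_curve_on I c \<longleftrightarrow>
     (\<forall>t\<in>I. \<exists>\<phi>\<in>PT_charts. \<exists>J g. open J \<and> t \<in> J \<and> smooth_curve_on J g \<and>
        (\<forall>s\<in>J \<inter> I. c s = \<phi> (g s)))"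

definition embedded_PT_curve :: "line_element set \<Rightarrow> bool" where
  "embedded_PT_curve \<alpha> \<longleftrightarrow> \<alpha> \<subseteq> PT \<and> (\<forall>\<phi>\<in>PT_charts. embedded_curve (\<phi> -` \<alpha>))"

section \<open>Line-framed curves\<close>

definition classical_boundary :: "line_element set \<Rightarrow> (real^2) set" where
  "classical_boundary \<alpha> = fst ` \<alpha>"

text \<open>For embedded curves, smoothness of a map can be tested on smooth parametrized curves in the
  source. Hence a bijection is a diffeomorphism iff it and its inverse carry smooth parametrized
  curves to smooth ones.\<close>

definition projects_diffeomorphically :: "line_element set \<Rightarrow> bool" where
  "projects_diffeomorphically \<alpha> \<longleftrightarrow>
     bij_betw fst \<alpha> (classical_boundary \<alpha>) \<and>
     (\<forall>I c. open I \<and> c ` I \<subseteq> \<alpha> \<longrightarrow>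
        (smooth_PT_curve_on I c \<longleftrightarrow> smooth_curve_on I (fst \<circ> c)))"

definition line_framed_curve :: "line_element set \<Rightarrow> bool" where
  "line_framed_curve \<alpha> \<longleftrightarrow>
     embedded_PT_curve \<alpha> \<and> connectedin PT_topology \<alpha> \<and>
     embedded_curve (classical_boundary \<alpha>) \<and> projects_diffeomorphically \<alpha> \<and>
     (\<forall>(A, L)\<in>\<alpha>. span (L \<union> tangent_space (classical_boundary \<alpha>) A) = UNIV)"

text \<open>A germ of line-framed curve is given by a representative together with its base point.\<close>

definition local_projective_billiard :: "line_element set list \<Rightarrow> line_element list \<Rightarrow> bool" where
  "local_projective_billiard \<alpha>s bs \<longleftrightarrow>
     length bs = length \<alpha>s \<and>
     (\<forall>j<length \<alpha>s. line_framed_curve (\<alpha>s ! j) \<and> bs ! j \<in> \<alpha>s ! j)"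

definition same_germ :: "line_element \<Rightarrow> line_element set \<Rightarrow> line_element set \<Rightarrow> bool" where
  "same_germ b \<alpha> \<beta> \<longleftrightarrow> (\<exists>U. openin PT_topology U \<and> b \<in> U \<and> \<alpha> \<inter> U = \<beta> \<inter> U)"

section \<open>The real projective plane\<close>

text \<open>Points and lines are the 1- and 2-dimensional subspaces of \<open>\<real>\<^sup>2 \<times> \<real>\<close>, incidence is inclusion;
  \<open>A\<close> in the affine chart has homogeneous coordinates \<open>(A, 1)\<close>.\<close>

type_synonym hvec = "(real^2) \<times> real"

definition proj_point :: "hvec set \<Rightarrow> bool" where
  "proj_point X \<longleftrightarrow> subspace X \<and> dim X = 1"

definition proj_line :: "hvec set \<Rightarrow> bool" where
  "proj_line m \<longleftrightarrow> subspace m \<and> dim m = 2"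

definition affine_point :: "real^2 \<Rightarrow> hvec set" where
  "affine_point A = span {(A, 1)}"

text \<open>The projective line through two distinct points.\<close>

definition join :: "hvec set \<Rightarrow> hvec set \<Rightarrow> hvec set" where
  "join X Y = span (X \<union> Y)"

text \<open>The projective line extending the affine line through \<open>A\<close> with direction \<open>L\<close>.\<close>

definition line_through :: "real^2 \<Rightarrow> (real^2) set \<Rightarrow> hvec set" where
  "line_through A L = span (insert (A, 1) ((\<lambda>v. (v, 0)) ` L))"

definition noncollinear :: "hvec set \<Rightarrow> hvec set \<Rightarrow> hvec set \<Rightarrow> bool" where
  "noncollinear P Q R \<longleftrightarrow> \<not> (\<exists>m. proj_line m \<and> P \<subseteq> m \<and> Q \<subseteq> m \<and> R \<subseteq> m)"

text \<open>A projective transformation \<open>h\<close> from the line \<open>m\<close> to \<open>\<real> \<union> {\<infinity>}\<close> is \<open>h = f / g\<close>, where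
  \<open>(f, g)\<close> is injective on \<open>m\<close>. The last four conditions say that \<open>h X2 = 1\<close>, \<open>h X3 = 0\<close>,
  \<open>h X4 = \<infinity>\<close> and \<open>h X1 = r\<close>, the value \<open>r\<close> being finite.\<close>

definition has_cross_ratio :: "hvec set \<Rightarrow> hvec set \<Rightarrow> hvec set \<Rightarrow> hvec set \<Rightarrow> real \<Rightarrow> bool" where
  "has_cross_ratio X1 X2 X3 X4 r \<longleftrightarrow>
     (\<forall>X\<in>{X1, X2, X3, X4}. proj_point X) \<and>
     (\<exists>m f g. proj_line m \<and> (\<forall>X\<in>{X1, X2, X3, X4}. X \<subseteq> m) \<and>
        linear f \<and> linear g \<and> (\<forall>x\<in>m. f x = 0 \<and> g x = 0 \<longrightarrow> x = 0) \<and>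
        (\<forall>x\<in>X2. f x = g x) \<and> (\<forall>x\<in>X3. f x = 0) \<and> (\<forall>x\<in>X4. g x = 0) \<and>
        (\<forall>x\<in>X1. f x = r * g x))"

definition lines_have_cross_ratio ::
    "hvec set \<Rightarrow> hvec set \<Rightarrow> hvec set \<Rightarrow> hvec set \<Rightarrow> real \<Rightarrow> bool" where
  "lines_have_cross_ratio l1 l2 l3 l4 r \<longleftrightarrow>
     (\<forall>l\<in>{l1, l2, l3, l4}. proj_line l) \<and>
     (\<exists>X m. proj_point X \<and> (\<forall>l\<in>{l1, l2, l3, l4}. X \<subseteq> l) \<and> proj_line m \<and> \<not> X \<subseteq> m \<and>
        has_cross_ratio (l1 \<inter> m) (l2 \<inter> m) (l3 \<inter> m) (l4 \<inter> m) r)"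

definition symmetric_lines :: "hvec set \<Rightarrow> hvec set \<Rightarrow> hvec set \<Rightarrow> hvec set \<Rightarrow> bool" where
  "symmetric_lines L T l l' \<longleftrightarrow>
     (l = L \<and> l' = L) \<or> (l = T \<and> l' = T) \<or>
     (distinct [L, T, l, l'] \<and> lines_have_cross_ratio L T l l' (-1))"

section \<open>Periodic orbits and reflective billiards\<close>

definition periodic_orbit :: "line_element set list \<Rightarrow> line_element list \<Rightarrow> bool" where
  "periodic_orbit \<alpha>s xs \<longleftrightarrow>
     length xs = length \<alpha>s \<and>
     (\<forall>j<length \<alpha>s.
        let k = length \<alpha>s;
            A = fst (xs ! j);
            A_prev = fst (xs ! ((j + k - 1) mod k));
            A_next = fst (xs ! (Suc j mod k));
            L = line_through A (snd (xs ! j));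
            T = line_through A (tangent_space (classical_boundary (\<alpha>s ! j)) A);
            l = join (affine_point A_prev) (affine_point A);
            l' = join (affine_point A) (affine_point A_next)
        in xs ! j \<in> \<alpha>s ! j \<and> A \<noteq> A_prev \<and> A \<noteq> A_next \<and> l \<noteq> T \<and> l' \<noteq> T \<and>
           symmetric_lines L T l l')"

text \<open>The length of \<open>\<alpha>s\<close> is the \<open>k\<close> of \<open>k\<close>-reflectivity; ``close to the base orbit'' means: in
  arbitrarily prescribed neighbourhoods \<open>V\<close> of the base points.\<close>

definition reflective :: "line_element set list \<Rightarrow> line_element list \<Rightarrow> bool" where
  "reflective \<alpha>s bs \<longleftrightarrow>
     periodic_orbit \<alpha>s bs \<and>
     (\<forall>V. (\<forall>j<length \<alpha>s. openin PT_topology (V j) \<and> bs ! j \<in> V j) \<longrightarrow>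
        (\<exists>U1 U2. openin PT_topology U1 \<and> bs ! 0 \<in> U1 \<and> openin PT_topology U2 \<and> bs ! 1 \<in> U2 \<and>
           (\<forall>x1 \<in> \<alpha>s ! 0 \<inter> U1. \<forall>x2 \<in> \<alpha>s ! 1 \<inter> U2.
              \<exists>xs. periodic_orbit \<alpha>s xs \<and> xs ! 0 = x1 \<and> xs ! 1 = x2 \<and>
                   (\<forall>j<length \<alpha>s. xs ! j \<in> V j))))"

text \<open>The part of \<open>\<omega>(l, P)\<close> lying over the affine chart \<open>\<real>\<^sup>2\<close>; it is empty if \<open>l\<close> is the line at
  infinity.\<close>

definition omega :: "hvec set \<Rightarrow> hvec set \<Rightarrow> line_element set" where
  "omega l P = {(A, L) \<in> PT. affine_point A \<subseteq> l \<and> line_through A L = join (affine_point A) P}"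

end

theory Submission
  imports Defs
begin

text \<open>
  Write \<open>\<tau>\<^sub>A(B) = A' \<times> (B - A)\<close> for a parametrized boundary, and let \<open>\<lambda>\<^sub>A\<close> be the analogous form of
  the line \<open>L\<^sub>A\<close>. Reflection at \<open>A\<close> says that \<open>\<lambda>\<^sub>A / \<tau>\<^sub>A\<close> takes opposite values at \<open>B\<close> and \<open>C\<close>. If the
  billiard is reflective, the third vertex \<open>C(u)\<close> is given by a function \<open>u(s, t)\<close>. Differentiating the
  reflection law at each vertex expresses the ratios of \<open>ds, dt, du\<close> on the surface of orbits
  through the \<open>\<tau>\<close>'s in three ways, and their compatibility is the Menelaus relation
  \<open>\<tau>\<^sub>A(C) \<tau>\<^sub>B(A) \<tau>\<^sub>C(B) = \<tau>\<^sub>A(B) \<tau>\<^sub>B(C) \<tau>\<^sub>C(A)\<close>, where a cube root is extracted. The first derivatives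
  of this relation show that the suitably normalized curvatures of the three boundaries agree, and
  \<open>u\<^sub>s\<^sub>t = u\<^sub>t\<^sub>s\<close> then forces them to vanish. Thus the boundaries are straight, the Menelaus relation
  excludes concurrent boundaries, and with the reflection law it puts the opposite vertex of the
  boundary triangle on \<open>L\<^sub>A\<close>. Orbits with collinear vertices are harmless: for each \<open>s\<close> there is at
  most one such \<open>t\<close>.

  Conversely, in homogeneous coordinates with respect to \<open>P, Q, R\<close> the reflection laws at the three
  vertices of a right-spherical billiard are one and the same equation, which can be solved for the
  third vertex.
\<close>

section \<open>Lines in the projective plane\<close>

text \<open>Reflectivity only asserts that a third vertex exists near the base point; nothing makes
  it unique or regular. The obstacle is to differentiate an arbitrarily chosen \<open>u\<close>.
  With one vertex fixed, the reflection law there prescribes the coordinate of \<open>C\<close> in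
  the pencil at that vertex, and this coordinate is injective along the whole parameter interval of
  \<open>C\<close>. So each one-variable restriction of \<open>u\<close> is an inverse function
  composed with a differentiable one. Joint continuity, which symmetry of the mixed derivatives
  requires, comes from bounds uniform on the parameter square. The framing directions cancel from
  these derivatives, where they enter only through a factor \<open>cross2 x a\<close>. At the third
  vertex, which moves, all terms containing the derivative of the frame form one coefficient shared
  by both variables, and it is eliminated. Hence the argument up to straightness involves the
  boundaries alone, and the frames return as linear equations. Cubes appear because the law at
  \<open>C\<close> multiplies \<open>u\<close>-derivatives, themselves cubic over cubic in the
  \<open>\<tau>\<close>'s, by further cubic monomials; over the reals the root costs no
  sign.\<close>

definition cross2 :: "real^2 \<Rightarrow> real^2 \<Rightarrow> real" where
  "cross2 v w = v$1 * w$2 - v$2 * w$1"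

lemma cross2_simps [simp]:
  "cross2 0 w = 0" "cross2 v 0 = 0" "cross2 v v = 0"
  by (simp_all add: cross2_def)

lemma bounded_bilinear_cross2: "bounded_bilinear cross2"
proof
  fix a b c :: "real^2" and r :: real
  show "cross2 (a + b) c = cross2 a c + cross2 b c" "cross2 a (b + c) = cross2 a b + cross2 a c"
    "cross2 (r *\<^sub>R a) b = r *\<^sub>R cross2 a b" "cross2 a (r *\<^sub>R b) = r *\<^sub>R cross2 a b"
    by (simp_all add: cross2_def algebra_simps)
  have "norm (cross2 a b) \<le> norm a * norm b * 2" for a b :: "real^2"
  proof -
    have "\<bar>a$1 * b$2\<bar> \<le> norm a * norm b" "\<bar>a$2 * b$1\<bar> \<le> norm a * norm b"
      by (auto simp: abs_mult intro!: mult_mono component_le_norm_cart)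
    then show ?thesis by (simp add: cross2_def)
  qed
  then show "\<exists>K. \<forall>a b. norm (cross2 a b) \<le> norm a * norm b * K" by blast
qed

interpretation cross2: bounded_bilinear cross2
  by (rule bounded_bilinear_cross2)

lemma cross2_eq_0_iff:
  assumes "w \<noteq> 0"
  shows "cross2 w x = 0 \<longleftrightarrow> (\<exists>k. x = k *\<^sub>R w)"
proof
  assume h: "cross2 w x = 0"
  have "w \<bullet> w \<noteq> 0" using assms by simp
  moreover have "(w \<bullet> w) *\<^sub>R x = (x \<bullet> w) *\<^sub>R w"
    using h by (simp add: vec_eq_iff forall_2 inner_vec_def sum_2 cross2_def) algebra
  ultimately have "x = ((x \<bullet> w) / (w \<bullet> w)) *\<^sub>R w"
    by (metis divide_inverse_commute scaleR_scaleR scaleR_one left_inverse)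
  then show "\<exists>k. x = k *\<^sub>R w" by blast
qed (auto simp: cross2.scaleR_right)

text \<open>Cramer's rule in the plane: pairing with \<open>w\<close> or with \<open>v\<close>
  isolates one coefficient.\<close>

lemma cross2_nonzero_coords:
  assumes "cross2 v w \<noteq> 0"
  shows "x = (cross2 x w / cross2 v w) *\<^sub>R v + (cross2 v x / cross2 v w) *\<^sub>R w"
proof -
  have "cross2 v w *\<^sub>R x = cross2 x w *\<^sub>R v + cross2 v x *\<^sub>R w"
    by (simp add: vec_eq_iff forall_2 cross2_def algebra_simps)
  then have "(1 / cross2 v w) *\<^sub>R (cross2 v w *\<^sub>R x)
      = (1 / cross2 v w) *\<^sub>R (cross2 x w *\<^sub>R v + cross2 v x *\<^sub>R w)"
    by simp
  then show ?thesis using assms by (simp add: scaleR_add_right)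
qed

lemma span_singleton_eq_iff:
  assumes "v \<noteq> 0" "w \<noteq> 0"
  shows "span {v} = span {w} \<longleftrightarrow> cross2 v w = 0"
proof
  assume "span {v} = span {w}"
  then have "w \<in> span {v}" using span_base by blast
  then show "cross2 v w = 0" by (auto simp: span_singleton cross2.scaleR_right)
next
  assume "cross2 v w = 0"
  then obtain k where "w = k *\<^sub>R v" using cross2_eq_0_iff[OF assms(1)] by blast
  moreover from this have "k \<noteq> 0" using assms by auto
  ultimately show "span {v} = span {w}"
    using span_image_scale[of "{v}" "\<lambda>_. k"] by simp
qed

text \<open>Coefficients of the homogeneous equation of the line through \<open>A\<close> with direction \<open>w\<close>.\<close>

definition covec :: "real^2 \<Rightarrow> real^2 \<Rightarrow> hvec" where
  "covec A w = (vector [- w$2, w$1], - cross2 w A)"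

lemma inner_covec: "covec A w \<bullet> v = cross2 w (fst v - snd v *\<^sub>R A)"
  by (simp add: covec_def inner_prod_def inner_vec_def sum_2 cross2_def algebra_simps)

lemma inner_covec_affine: "covec A w \<bullet> (B, 1) = cross2 w (B - A)"
  by (simp add: inner_covec)

lemma covec_nonzero: "w \<noteq> 0 \<Longrightarrow> covec A w \<noteq> 0"
  by (auto simp: covec_def zero_prod_def vec_eq_iff forall_2)

lemma line_through_eq:
  assumes "w \<noteq> 0"
  shows "line_through A (span {w}) = {v. covec A w \<bullet> v = 0}"
proof
  show "line_through A (span {w}) \<subseteq> {v. covec A w \<bullet> v = 0}"
    unfolding line_through_def
  proof (rule span_minimal)
    show "subspace {v. covec A w \<bullet> v = 0}" by (rule subspace_hyperplane)
  qed (auto simp: inner_covec span_singleton cross2.scaleR_right)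
next
  show "{v. covec A w \<bullet> v = 0} \<subseteq> line_through A (span {w})"
  proof
    fix v assume "v \<in> {v. covec A w \<bullet> v = 0}"
    then have "cross2 w (fst v - snd v *\<^sub>R A) = 0" by (simp add: inner_covec)
    then obtain k where k: "fst v - snd v *\<^sub>R A = k *\<^sub>R w"
      using cross2_eq_0_iff assms by blast
    have "v = snd v *\<^sub>R (A, 1) + (k *\<^sub>R w, 0)"
      using k by (auto simp: prod_eq_iff algebra_simps)
    moreover have "snd v *\<^sub>R (A, 1) + (k *\<^sub>R w, 0) \<in> line_through A (span {w})"
      unfolding line_through_def
      by (intro span_add span_scale span_base) (auto simp: span_singleton)
    ultimately show "v \<in> line_through A (span {w})" by simp
  qed
qed

lemma join_span: "join (span {p}) (span {q}) = span {p, q}"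
proof
  have "span {p} \<subseteq> span {p, q}" "span {q} \<subseteq> span {p, q}" by (auto intro: span_mono[THEN subsetD])
  then show "join (span {p}) (span {q}) \<subseteq> span {p, q}"
    unfolding join_def by (intro span_minimal) auto
  show "span {p, q} \<subseteq> join (span {p}) (span {q})"
    unfolding join_def by (rule span_mono) (auto intro: span_base)
qed

lemma join_affine_eq:
  assumes "A \<noteq> B"
  shows "join (affine_point A) (affine_point B) = {v. covec A (B - A) \<bullet> v = 0}"
proof -
  have "join (affine_point A) (affine_point B) = span {(A, 1), (B, 1)}"
    by (simp add: affine_point_def join_span)
  also have "\<dots> = line_through A (span {B - A})"
  proof
    have "(B, 1) = (A, 1) + (B - A, 0::real)" by simp
    moreover have "\<dots> \<in> line_through A (span {B - A})"
      unfolding line_through_def by (intro span_add span_base) (auto intro: span_base)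
    ultimately show "span {(A, 1), (B, 1)} \<subseteq> line_through A (span {B - A})"
      unfolding line_through_def by (intro span_minimal) (auto intro: span_base)
    have "(k *\<^sub>R (B - A), 0) \<in> span {(A, 1), (B, 1::real)}" for k
    proof -
      have "(k *\<^sub>R (B - A), 0) = k *\<^sub>R ((B, 1) - (A, 1::real))" by simp
      then show ?thesis by (metis insertCI span_base span_diff span_scale)
    qed
    then show "line_through A (span {B - A}) \<subseteq> span {(A, 1), (B, 1)}"
      unfolding line_through_def by (intro span_minimal) (auto simp: span_singleton intro: span_base)
  qed
  finally show ?thesis using assms by (simp add: line_through_eq)
qed

lemma proj_line_hyperplane:
  fixes n :: hvec
  shows "n \<noteq> 0 \<Longrightarrow> proj_line {v. n \<bullet> v = 0}"
  by (simp add: proj_line_def subspace_hyperplane dim_hyperplane)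

lemma span_of_dim_1:
  assumes "subspace L" "dim L = 1" obtains x where "x \<noteq> 0" "L = span {x}"
proof -
  obtain S where S: "S \<subseteq> L" "independent S" "L \<subseteq> span S" "card S = dim L"
    using basis_exists by blast
  then obtain x where "S = {x}" using assms by (metis card_1_singletonE)
  with S assms show ?thesis
    using that[of x] by (metis dependent_single span_minimal subset_antisym)
qed

lemma proj_pointE:
  assumes "proj_point X" obtains x where "x \<noteq> 0" "X = span {x}"
  using assms span_of_dim_1 unfolding proj_point_def by metis

lemma proj_point_span: "x \<noteq> 0 \<Longrightarrow> proj_point (span {x})"
  by (simp add: proj_point_def dim_span dim_singleton)

text \<open>The vector product of three-space, transported to \<open>hvec\<close>. Thus
  \<open>cprod u v \<bullet> w\<close> is the determinant of \<open>u, v, w\<close>, and on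
  homogeneous coordinates \<open>cprod\<close> computes the join of two points as well as the meet
  of two lines given by their normals.\<close>

definition cprod :: "hvec \<Rightarrow> hvec \<Rightarrow> hvec" where
  "cprod u v =
     (vector [fst u $ 2 * snd v - snd u * fst v $ 2, snd u * fst v $ 1 - fst u $ 1 * snd v],
      fst u $ 1 * fst v $ 2 - fst u $ 2 * fst v $ 1)"

lemmas hvec_simps = inner_prod_def inner_vec_def sum_2 cprod_def prod_eq_iff vec_eq_iff forall_2

lemma cprod_orthogonal [simp]: "cprod u v \<bullet> u = 0" "cprod u v \<bullet> v = 0"
  by (simp_all add: hvec_simps algebra_simps)

lemma cprod_rotate: "cprod u v \<bullet> w = cprod v w \<bullet> u"
  by (simp add: hvec_simps algebra_simps)

text \<open>Read \<open>u, v, w\<close> as normals of the sides of a triangle: the two vertices on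
  the side \<open>u\<close> have that side as their join, up to the determinant.\<close>

lemma cprod_cprod: "cprod (cprod w u) (cprod u v) = (cprod u v \<bullet> w) *\<^sub>R u"
  by (simp add: hvec_simps algebra_simps)

text \<open>A vector is expanded in the basis \<open>u, v, cprod u v\<close>; its coefficient along
  the normal is proportional to the pairing that vanishes on the plane.\<close>

lemma span2_eq_hyperplane:
  assumes "cprod u v \<noteq> 0"
  shows "span {u, v} = {w. cprod u v \<bullet> w = 0}"
proof
  show "span {u, v} \<subseteq> {w. cprod u v \<bullet> w = 0}"
    by (rule span_minimal) (auto simp: subspace_hyperplane)
next
  show "{w. cprod u v \<bullet> w = 0} \<subseteq> span {u, v}"
  proof
    fix w assume w: "w \<in> {w. cprod u v \<bullet> w = 0}"
    define n where "n = cprod u v"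
    have nn: "n \<bullet> n \<noteq> 0" using assms by (simp add: n_def)
    have "(n \<bullet> n) *\<^sub>R w = (cprod w v \<bullet> n) *\<^sub>R u + (cprod u w \<bullet> n) *\<^sub>R v + (n \<bullet> w) *\<^sub>R n"
      unfolding n_def by (simp add: hvec_simps algebra_simps)
    then have "(n \<bullet> n) *\<^sub>R w \<in> span {u, v}"
      using w by (simp add: n_def span_add span_scale span_base)
    then have "(1 / (n \<bullet> n)) *\<^sub>R ((n \<bullet> n) *\<^sub>R w) \<in> span {u, v}"
      by (rule span_scale)
    then show "w \<in> span {u, v}" using nn by simp
  qed
qed

text \<open>The expansion of \<open>cprod u (cprod u v)\<close> shows that \<open>v\<close> equals
  its orthogonal projection onto the line of \<open>u\<close>.\<close>

lemma cprod_eq_0D: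
  assumes "cprod u v = 0" "u \<noteq> 0" shows "\<exists>k. v = k *\<^sub>R u"
proof -
  have "(u \<bullet> u) *\<^sub>R v = (u \<bullet> v) *\<^sub>R u"
  proof -
    have "(u \<bullet> u) *\<^sub>R v - (u \<bullet> v) *\<^sub>R u = - cprod u (cprod u v)"
      by (simp add: hvec_simps algebra_simps)
    also have "\<dots> = 0" unfolding assms(1) by (simp add: hvec_simps)
    finally show ?thesis by simp
  qed
  moreover have "u \<bullet> u \<noteq> 0" using assms by simp
  ultimately have "v = ((u \<bullet> v) / (u \<bullet> u)) *\<^sub>R u"
    by (metis divide_inverse_commute scaleR_scaleR scaleR_one left_inverse)
  then show ?thesis by blast
qed

lemma proj_line_containing:
  assumes "proj_line m" obtains n where "n \<noteq> 0" "m = {v::hvec. n \<bullet> v = 0}"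
proof -
  have m: "subspace m" "dim m = 2" using assms by (auto simp: proj_line_def)
  then have "dim m < dim (UNIV :: hvec set)" by simp
  then have "span m \<subset> UNIV" by (metis dim_span psubsetI subset_UNIV less_irrefl)
  then obtain n where n: "n \<noteq> 0" "\<And>x. x \<in> m \<Longrightarrow> orthogonal n x"
    using orthogonal_to_subspace_exists_gen[of m "UNIV :: hvec set"]
    by (metis span_UNIV span_base)
  have "m \<subseteq> {v. n \<bullet> v = 0}" using n(2) by (auto simp: orthogonal_def)
  moreover have "dim {v. n \<bullet> v = 0} = 2" using n(1) by (simp add: dim_hyperplane)
  ultimately have "m = {v. n \<bullet> v = 0}"
    using m subspace_dim_equal[OF m(1) subspace_hyperplane[of n]] by simp
  with n(1) that show ?thesis by blast
qed

text \<open>Collinearity means that the three vectors have a common normal. If the determinant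
  vanishes, such a normal is a nonzero \<open>cprod\<close> of two of the vectors, or, when all are
  multiples of \<open>p\<close>, anything orthogonal to \<open>p\<close>. Conversely, the
  determinant times a common normal expands in the three products with coefficients
  \<open>n \<bullet> p\<close>, \<open>n \<bullet> q\<close>, \<open>n \<bullet> r\<close>, all
  zero.\<close>

lemma noncollinear_span_iff:
  assumes "p \<noteq> 0" "q \<noteq> 0" "r \<noteq> 0"
  shows "noncollinear (span {p}) (span {q}) (span {r}) \<longleftrightarrow> cprod p q \<bullet> r \<noteq> 0"
proof
  assume nc: "noncollinear (span {p}) (span {q}) (span {r})"
  show "cprod p q \<bullet> r \<noteq> 0"
  proof
    assume d: "cprod p q \<bullet> r = 0"
    have "\<exists>n. n \<noteq> 0 \<and> n \<bullet> p = 0 \<and> n \<bullet> q = 0 \<and> n \<bullet> r = 0"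
    proof (cases "cprod p q = 0")
      case False
      then show ?thesis using d by (intro exI[of _ "cprod p q"]) auto
    next
      case True
      then obtain k where k: "q = k *\<^sub>R p" using cprod_eq_0D assms by blast
      show ?thesis
      proof (cases "cprod p r = 0")
        case False
        then show ?thesis using k by (intro exI[of _ "cprod p r"]) auto
      next
        case True
        then obtain k' where k': "r = k' *\<^sub>R p" using cprod_eq_0D assms by blast
        have "span {p} \<noteq> UNIV"
        proof
          assume "span {p} = UNIV"
          then have "dim (UNIV :: hvec set) \<le> 1"
            by (metis dim_span dim_singleton One_nat_def le0 order_refl)
          then show False by simp
        qed
        then obtain n where "n \<noteq> 0" "orthogonal n p"
          using orthogonal_to_subspace_exists_gen[of "{p}" "UNIV :: hvec set"]
          by (metis psubsetI span_UNIV subset_UNIV span_base insertI1)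
        then show ?thesis using k k' by (intro exI[of _ n]) (simp add: orthogonal_def)
      qed
    qed
    then obtain n where n: "n \<noteq> 0" "n \<bullet> p = 0" "n \<bullet> q = 0" "n \<bullet> r = 0" by blast
    then have "proj_line {v. n \<bullet> v = 0}" "span {p} \<subseteq> {v. n \<bullet> v = 0}"
      "span {q} \<subseteq> {v. n \<bullet> v = 0}" "span {r} \<subseteq> {v. n \<bullet> v = 0}"
      by (auto simp: proj_line_hyperplane span_singleton)
    with nc show False unfolding noncollinear_def by blast
  qed
next
  assume d: "cprod p q \<bullet> r \<noteq> 0"
  show "noncollinear (span {p}) (span {q}) (span {r})"
    unfolding noncollinear_def
  proof
    assume "\<exists>m. proj_line m \<and> span {p} \<subseteq> m \<and> span {q} \<subseteq> m \<and> span {r} \<subseteq> m"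
    then obtain m where m: "proj_line m" "span {p} \<subseteq> m" "span {q} \<subseteq> m" "span {r} \<subseteq> m" by blast
    obtain n where n: "n \<noteq> 0" "m = {v. n \<bullet> v = 0}" using proj_line_containing[OF m(1)] .
    have "n \<bullet> p = 0" "n \<bullet> q = 0" "n \<bullet> r = 0" using m n(2) span_base[of _ "{_}"] by blast+
    moreover have "(cprod p q \<bullet> r) *\<^sub>R n
        = (n \<bullet> p) *\<^sub>R cprod q r + (n \<bullet> q) *\<^sub>R cprod r p + (n \<bullet> r) *\<^sub>R cprod p q"
      by (simp add: hvec_simps algebra_simps)
    ultimately show False using d n(1) by simp
  qed
qed

section \<open>Harmonic pencils\<close>

lemma cross2_commute: "cross2 v w = - cross2 w v"
  by (simp add: cross2_def)

lemma covec_scaleR: "covec A (k *\<^sub>R w) = k *\<^sub>R covec A w"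
  by (simp add: covec_def vec_eq_iff forall_2 cross2.scaleR_left)

lemma pencil_line_eq_iff:
  assumes "v \<noteq> 0" "w \<noteq> 0"
  shows "{x. covec A v \<bullet> x = 0} = {x. covec A w \<bullet> x = 0} \<longleftrightarrow> cross2 v w = 0"
proof
  assume "{x. covec A v \<bullet> x = 0} = {x. covec A w \<bullet> x = 0}"
  moreover have "covec A w \<bullet> (w, 0) = 0" by (simp add: inner_covec)
  ultimately have "covec A v \<bullet> (w, 0) = 0" by blast
  then show "cross2 v w = 0" by (simp add: inner_covec)
next
  assume "cross2 v w = 0"
  then obtain k where k: "w = k *\<^sub>R v" using cross2_eq_0_iff[OF assms(1)] by blast
  then have "k \<noteq> 0" using assms by auto
  then show "{x. covec A v \<bullet> x = 0} = {x. covec A w \<bullet> x = 0}"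
    by (simp add: k covec_scaleR)
qed

lemma covec_base: "covec A w \<bullet> (A, 1) = 0"
  by (simp add: inner_covec)

lemma pencil_center:
  assumes "cross2 v w \<noteq> 0" "covec A v \<bullet> x = 0" "covec A w \<bullet> x = 0"
  shows "x = snd x *\<^sub>R (A, 1)"
proof -
  have "cross2 v (fst x - snd x *\<^sub>R A) = 0" "cross2 (fst x - snd x *\<^sub>R A) w = 0"
    using assms(2,3) cross2_commute[of "fst x - snd x *\<^sub>R A" w] by (simp_all add: inner_covec)
  then have "fst x - snd x *\<^sub>R A = 0"
    using cross2_nonzero_coords[OF assms(1), of "fst x - snd x *\<^sub>R A"] by simp
  then show ?thesis by (simp add: prod_eq_iff)
qed

lemma has_cross_ratioE:
  assumes "has_cross_ratio X1 X2 X3 X4 r"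
  obtains m and f g :: "hvec \<Rightarrow> real" where "proj_line m" "X1 \<subseteq> m" "X2 \<subseteq> m" "linear f" "linear g"
    "\<And>x. x \<in> m \<Longrightarrow> f x = 0 \<Longrightarrow> g x = 0 \<Longrightarrow> x = 0" "\<And>x. x \<in> X2 \<Longrightarrow> f x = g x"
    "\<And>x. x \<in> X3 \<Longrightarrow> f x = 0" "\<And>x. x \<in> X4 \<Longrightarrow> g x = 0" "\<And>x. x \<in> X1 \<Longrightarrow> f x = r * g x"
  using assms unfolding has_cross_ratio_def
  apply (elim conjE exE)
  subgoal for m f g by (rule that[of m f g]) auto
  done

text \<open>Projection of directions from \<open>A\<close> onto the transversal is linear, so
  \<open>f\<close> and \<open>g\<close> become linear forms on directions, determined by their
  values at \<open>X\<close> and \<open>Y\<close>. The cross-ratio -1 makes those values agree at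
  \<open>Y\<close> and differ by sign at \<open>X\<close>. Vanishing of \<open>f\<close> at
  \<open>v\<close> and of \<open>g\<close> at \<open>w\<close> is then a homogeneous linear system
  with a nontrivial solution, whose determinant is the claim.\<close>

lemma harmonic_of_cross_ratio:
  assumes tr: "cross2 X Y \<noteq> 0"
    and cr: "lines_have_cross_ratio {x. covec A X \<bullet> x = 0} {x. covec A Y \<bullet> x = 0}
      {x. covec A v \<bullet> x = 0} {x. covec A w \<bullet> x = 0} (- 1)"
  shows "cross2 X v * cross2 Y w + cross2 X w * cross2 Y v = 0"
proof -
  let ?K = "\<lambda>w. {x. covec A w \<bullet> x = 0}"
  obtain Z m where Z: "proj_point Z" "Z \<subseteq> ?K X" "Z \<subseteq> ?K Y" and m: "proj_line m" "\<not> Z \<subseteq> m"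
    and hcr: "has_cross_ratio (?K X \<inter> m) (?K Y \<inter> m) (?K v \<inter> m) (?K w \<inter> m) (- 1)"
    using cr unfolding lines_have_cross_ratio_def by auto
  obtain n where n: "n \<noteq> 0" "m = {v. n \<bullet> v = 0}" using proj_line_containing[OF m(1)] .
  \<comment> \<open>The lines with directions \<open>X\<close> and \<open>Y\<close> meet only in
    \<open>A\<close>, so \<open>Z\<close> consists of multiples of \<open>(A, 1)\<close>; as
    \<open>Z\<close> is not on \<open>m\<close>, neither is \<open>A\<close>.\<close>
  have Am: "n \<bullet> (A, 1) \<noteq> 0"
  proof
    assume "n \<bullet> (A, 1) = 0"
    moreover have "z = snd z *\<^sub>R (A, 1)" if "z \<in> Z" for z
      using pencil_center[OF tr] Z that by blast
    ultimately have "n \<bullet> z = 0" if "z \<in> Z" for z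
      using that arg_cong[of z _ "inner n"] by (metis inner_scaleR_right mult_zero_right)
    then have "Z \<subseteq> m" unfolding n(2) by blast
    with m(2) show False by blast
  qed
  obtain m' and f g :: "hvec \<Rightarrow> real"
    where m': "proj_line m'" "?K X \<inter> m \<subseteq> m'" "?K Y \<inter> m \<subseteq> m'" "linear f" "linear g"
      "\<And>x. x \<in> m' \<Longrightarrow> f x = 0 \<Longrightarrow> g x = 0 \<Longrightarrow> x = 0" "\<And>x. x \<in> ?K Y \<inter> m \<Longrightarrow> f x = g x"
      "\<And>x. x \<in> ?K v \<inter> m \<Longrightarrow> f x = 0" "\<And>x. x \<in> ?K w \<inter> m \<Longrightarrow> g x = 0"
      "\<And>x. x \<in> ?K X \<inter> m \<Longrightarrow> f x = - 1 * g x"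
    apply (rule has_cross_ratioE[OF hcr])
    subgoal for m' f g by (rule that[of m' f g])
    done
  \<comment> \<open>Subtracting a multiple of \<open>(A, 1)\<close> moves the direction within its
    line through \<open>A\<close> until it lies on \<open>m\<close>.\<close>
  define pt where "pt u = (u, 0) - ((n \<bullet> (u, 0)) / (n \<bullet> (A, 1))) *\<^sub>R (A, 1::real)" for u :: "real^2"
  have ptm: "pt u \<in> m" for u
    unfolding n(2) pt_def mem_Collect_eq inner_diff_right inner_scaleR_right using Am by simp
  have ptK: "covec A a \<bullet> pt u = cross2 a u" for a u
    by (simp add: pt_def inner_diff_right covec_base) (simp add: inner_covec)
  have pt_lin: "pt (a *\<^sub>R u + b *\<^sub>R u') = a *\<^sub>R pt u + b *\<^sub>R pt u'" for a b u u'
    by (simp add: pt_def prod_eq_iff inner_prod_def inner_add_right add_divide_distrib algebra_simps)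
  have coords: "cross2 X Y *\<^sub>R u = (- cross2 Y u) *\<^sub>R X + cross2 X u *\<^sub>R Y" for u
    by (simp add: vec_eq_iff forall_2 cross2_def algebra_simps)
  have pt0: "pt 0 = 0" by (simp add: pt_def inner_prod_def zero_prod_def)
  have fX: "f (pt X) = - g (pt X)" and fY: "f (pt Y) = g (pt Y)"
    and fv: "f (pt v) = 0" and gw: "g (pt w) = 0"
    using m' ptm ptK by auto
  have lf: "cross2 X Y * f (pt u) = - cross2 Y u * f (pt X) + cross2 X u * f (pt Y)" 
    if "linear f" for u and f :: "hvec \<Rightarrow> real"
  proof -
    have "f (pt (cross2 X Y *\<^sub>R u + 0 *\<^sub>R 0)) = f (pt ((- cross2 Y u) *\<^sub>R X + cross2 X u *\<^sub>R Y))"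
      using coords by simp
    then show ?thesis unfolding pt_lin
      using that by (simp add: linear_add linear_scale linear_diff linear_neg pt0 linear_0)
  qed
  have ne: "f (pt X) \<noteq> 0"
  proof
    assume "f (pt X) = 0"
    moreover from this fX have "g (pt X) = 0" by simp
    moreover have "pt X \<in> m'" using m'(2) ptm ptK[of X X] by auto
    ultimately have "pt X = 0" by (intro m'(6))
    then have "covec A Y \<bullet> pt X = 0" by simp
    then show False using ptK tr cross2_commute[of X Y] by simp
  qed
  have 1: "- cross2 Y v * f (pt X) + cross2 X v * f (pt Y) = 0"
    using lf[OF m'(4), of v] fv by simp
  have 2: "cross2 Y w * f (pt X) + cross2 X w * f (pt Y) = 0"
    using lf[OF m'(5), of w] gw fX fY by simp
  have "(cross2 X v * cross2 Y w + cross2 X w * cross2 Y v) * f (pt X) = 0"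
    using 1 2 by algebra
  with ne show ?thesis by simp
qed

text \<open>The line at infinity serves as transversal, since there a direction is its own trace.
  The forms are dictated by the required values: \<open>f\<close> kills \<open>v\<close>, and
  \<open>g\<close> agrees with \<open>f\<close> at \<open>Y\<close> and with \<open>- f\<close> at
  \<open>X\<close>. Harmonicity is then exactly the vanishing of \<open>g\<close> at
  \<open>w\<close>.\<close>

lemma cross_ratio_of_harmonic:
  assumes tr: "cross2 X Y \<noteq> 0" and v: "cross2 Y v \<noteq> 0" "cross2 X v \<noteq> 0"
    and w: "cross2 Y w \<noteq> 0" "cross2 X w \<noteq> 0"
    and h: "cross2 X v * cross2 Y w + cross2 X w * cross2 Y v = 0"
  shows "lines_have_cross_ratio {x. covec A X \<bullet> x = 0} {x. covec A Y \<bullet> x = 0}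
      {x. covec A v \<bullet> x = 0} {x. covec A w \<bullet> x = 0} (- 1)"
proof -
  let ?K = "\<lambda>w. {x. covec A w \<bullet> x = 0}"
  define m :: "hvec set" where "m = {x. (0, 1) \<bullet> x = 0}"
  have nz: "X \<noteq> 0" "Y \<noteq> 0" "v \<noteq> 0" "w \<noteq> 0" using assms by auto
  have Km: "?K u \<inter> m = span {(u, 0)}" if "u \<noteq> 0" for u
  proof -
    have "?K u \<inter> m = {x. snd x = 0 \<and> cross2 u (fst x) = 0}"
      unfolding m_def inner_covec by (auto simp: inner_prod_def)
    also have "\<dots> = span {(u, 0)}"
      by (auto simp: cross2_eq_0_iff[OF that] span_singleton image_iff)
    finally show ?thesis .
  qed
  define f g :: "hvec \<Rightarrow> real" where
    "f x = cross2 Y v * cross2 X (fst x) - cross2 X v * cross2 Y (fst x)" and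
    "g x = cross2 Y v * cross2 X (fst x) + cross2 X v * cross2 Y (fst x)" for x
  have lin: "linear f" "linear g"
    by (auto intro!: linearI simp: f_def g_def cross2.add_right cross2.scaleR_right algebra_simps)
  have m: "proj_line m" unfolding m_def by (rule proj_line_hyperplane) (simp add: zero_prod_def)
  have "has_cross_ratio (?K X \<inter> m) (?K Y \<inter> m) (?K v \<inter> m) (?K w \<inter> m) (- 1)"
    unfolding has_cross_ratio_def
  proof (intro conjI exI)
    show "proj_line m" by fact
    show "linear f" "linear g" by fact+
    show "\<forall>Xa\<in>{?K X \<inter> m, ?K Y \<inter> m, ?K v \<inter> m, ?K w \<inter> m}. proj_point Xa"
      using nz Km by (auto intro!: proj_point_span simp: zero_prod_def)
    show "\<forall>Xa\<in>{?K X \<inter> m, ?K Y \<inter> m, ?K v \<inter> m, ?K w \<inter> m}. Xa \<subseteq> m" by auto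
    show "\<forall>x\<in>m. f x = 0 \<and> g x = 0 \<longrightarrow> x = 0"
    proof (intro ballI impI)
      fix x assume x: "x \<in> m" "f x = 0 \<and> g x = 0"
      then have "cross2 Y v * cross2 X (fst x) = 0" "cross2 X v * cross2 Y (fst x) = 0"
        by (auto simp: f_def g_def)
      then have "cross2 X (fst x) = 0" "cross2 Y (fst x) = 0" using v by auto
      then have "fst x = 0"
        using cross2_nonzero_coords[OF tr, of "fst x"] cross2_commute[of "fst x" Y] by simp
      then show "x = 0" using x(1) by (simp add: m_def inner_prod_def prod_eq_iff)
    qed
    show "\<forall>x\<in>?K Y \<inter> m. f x = g x" "\<forall>x\<in>?K X \<inter> m. f x = - 1 * g x"
      unfolding f_def g_def m_def inner_covec by (auto simp: inner_prod_def)
    show "\<forall>x\<in>?K v \<inter> m. f x = 0" unfolding Km[OF nz(3)]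
      by (auto simp: f_def span_singleton cross2.scaleR_right)
    show "\<forall>x\<in>?K w \<inter> m. g x = 0"
    proof
      fix x assume "x \<in> ?K w \<inter> m"
      then have "x \<in> span {(w, 0)}" using Km[OF nz(4)] by blast
      then obtain k where "x = k *\<^sub>R (w, 0)" unfolding span_singleton by blast
      then have "fst x = k *\<^sub>R w" by simp
      then have "g x = k * (cross2 X v * cross2 Y w + cross2 X w * cross2 Y v)"
        by (simp add: g_def cross2.scaleR_right algebra_simps)
      then show "g x = 0" using h by simp
    qed
  qed
  moreover have "proj_point (affine_point A)" unfolding affine_point_def
    by (rule proj_point_span) (simp add: zero_prod_def)
  moreover have "affine_point A \<subseteq> ?K u" for u
    unfolding affine_point_def by (auto simp: span_singleton inner_covec)
  moreover have "\<not> affine_point A \<subseteq> m"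
  proof
    assume "affine_point A \<subseteq> m"
    then have "(A, 1) \<in> m" unfolding affine_point_def using span_base by blast
    then show False by (simp add: m_def inner_prod_def)
  qed
  ultimately show ?thesis
    unfolding lines_have_cross_ratio_def using m nz
    by (intro conjI exI[of _ "affine_point A"] exI[of _ m])
      (auto intro!: proj_line_hyperplane covec_nonzero)
qed

text \<open>Because \<open>v\<close> and \<open>w\<close> are not tangent, a single bilinear
  equation covers the harmonic case and the degenerate case in which both lines are
  \<open>L\<close>: if one of \<open>cross2 X v\<close>, \<open>cross2 X w\<close> vanishes, the
  equation makes the other vanish too. The alternative \<open>l = l' = T\<close> is excluded by the
  hypotheses.\<close>

lemma symmetric_pencil_lines_iff:
  assumes tr: "cross2 X Y \<noteq> 0" and v: "cross2 Y v \<noteq> 0" and w: "cross2 Y w \<noteq> 0"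
  shows "symmetric_lines {x. covec A X \<bullet> x = 0} {x. covec A Y \<bullet> x = 0}
      {x. covec A v \<bullet> x = 0} {x. covec A w \<bullet> x = 0} \<longleftrightarrow>
    cross2 X v * cross2 Y w + cross2 X w * cross2 Y v = 0"
proof -
  have nz: "X \<noteq> 0" "Y \<noteq> 0" "v \<noteq> 0" "w \<noteq> 0" using assms by auto
  note eq = pencil_line_eq_iff[OF nz(1,2)] pencil_line_eq_iff[OF nz(1,3)]
    pencil_line_eq_iff[OF nz(1,4)] pencil_line_eq_iff[OF nz(2,3)] pencil_line_eq_iff[OF nz(2,4)]
    pencil_line_eq_iff[OF nz(3,4)] pencil_line_eq_iff[OF nz(3,1)] pencil_line_eq_iff[OF nz(4,1)]
    pencil_line_eq_iff[OF nz(3,2)] pencil_line_eq_iff[OF nz(4,2)]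
  show ?thesis
  proof (cases "cross2 X v = 0 \<or> cross2 X w = 0")
    case True
    then show ?thesis
      using v w cross2_commute[of v X] cross2_commute[of w X] cross2_commute[of v Y]
      unfolding symmetric_lines_def eq distinct.simps list.set insert_iff by auto
  next
    case False
    show ?thesis
    proof
      assume "symmetric_lines {x. covec A X \<bullet> x = 0} {x. covec A Y \<bullet> x = 0}
        {x. covec A v \<bullet> x = 0} {x. covec A w \<bullet> x = 0}"
      then have "lines_have_cross_ratio {x. covec A X \<bullet> x = 0} {x. covec A Y \<bullet> x = 0}
        {x. covec A v \<bullet> x = 0} {x. covec A w \<bullet> x = 0} (- 1)"
        using False v cross2_commute[of v X] cross2_commute[of v Y]
        unfolding symmetric_lines_def eq by auto
      then show "cross2 X v * cross2 Y w + cross2 X w * cross2 Y v = 0"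
        using harmonic_of_cross_ratio[OF tr] by blast
    next
      assume h: "cross2 X v * cross2 Y w + cross2 X w * cross2 Y v = 0"
      \<comment> \<open>For \<open>w = k *\<^sub>R v\<close> the equation becomes twice a product of
        nonzero factors.\<close>
      have "cross2 v w \<noteq> 0"
      proof
        assume "cross2 v w = 0"
        then obtain k where k: "w = k *\<^sub>R v" using cross2_eq_0_iff nz by blast
        then have "k \<noteq> 0" using nz by auto
        then show False using h False v by (simp add: k cross2.scaleR_right)
      qed
      then show "symmetric_lines {x. covec A X \<bullet> x = 0} {x. covec A Y \<bullet> x = 0}
        {x. covec A v \<bullet> x = 0} {x. covec A w \<bullet> x = 0}"
        using cross_ratio_of_harmonic[OF tr v _ w _ h] False v w tr
        unfolding symmetric_lines_def eq distinct.simps list.set insert_iff by auto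
    qed
  qed
qed

section \<open>Parametrized germs of line-framed curves\<close>

lemma openin_PT_fst:
  assumes "open W"
  shows "openin PT_topology {x \<in> PT. fst x \<in> W}"
proof -
  have "slope_chart -` {x \<in> PT. fst x \<in> W} = fst -` W" "coslope_chart -` {x \<in> PT. fst x \<in> W} = fst -` W"
    by (auto simp: PT_def slope_chart_def coslope_chart_def dim_singleton vec_eq_iff forall_2)
  then show ?thesis
    using assms by (auto simp: openin_PT_topology PT_charts_def intro: open_vimage_fst)
qed

text \<open>The topology is tested in the charts, and a spanning vector with a nonzero coordinate is
  read in the corresponding one as a quotient. The source is a general space because the lemma
  serves one parameter as well as a pair of parameters.\<close>

lemma PT_neighbourhood:
  fixes x :: "'b::t2_space \<Rightarrow> real^2" and v :: "'b \<Rightarrow> real^2"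
  assumes V: "openin PT_topology V" "(x b, span {v b}) \<in> V"
    and "isCont x b" "isCont v b" "v b \<noteq> 0"
  shows "\<forall>\<^sub>F y in nhds b. (x y, span {v y}) \<in> V"
proof (cases "v b $ 1 = 0")
  case False
  define s where "s y = (x y, v y $ 2 / v y $ 1)" for y
  have eq: "slope_chart (s y) = (x y, span {v y})" if "v y $ 1 \<noteq> 0" for y
  proof -
    have "vector [1, v y $ 2 / v y $ 1] = (1 / v y $ 1) *\<^sub>R v y"
      using that by (simp add: vec_eq_iff forall_2)
    then show ?thesis
      using that span_image_scale[of "{v y}" "\<lambda>_. 1 / v y $ 1"] by (simp add: s_def slope_chart_def)
  qed
  have "isCont s b"
    unfolding s_def using assms False by (intro continuous_intros) auto
  moreover have "open (slope_chart -` V)" "s b \<in> slope_chart -` V"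
    using V eq[OF False] by (auto simp: openin_PT_topology PT_charts_def)
  ultimately have "\<forall>\<^sub>F y in nhds b. s y \<in> slope_chart -` V"
    by (metis isCont_def tendsto_at_iff_tendsto_nhds topological_tendstoD)
  moreover have "\<forall>\<^sub>F y in nhds b. v y $ 1 \<noteq> 0"
  proof -
    have "isCont (\<lambda>y. v y $ 1) b" using assms by (intro continuous_intros)
    then show ?thesis using False
      by (metis isCont_def tendsto_at_iff_tendsto_nhds tendsto_imp_eventually_ne)
  qed
  ultimately show ?thesis
    by eventually_elim (metis eq vimage_eq)
next
  case True
  then have nz: "v b $ 2 \<noteq> 0" using assms(5) by (auto simp: vec_eq_iff forall_2)
  define s where "s y = (x y, v y $ 1 / v y $ 2)" for y
  have eq: "coslope_chart (s y) = (x y, span {v y})" if "v y $ 2 \<noteq> 0" for y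
  proof -
    have "vector [v y $ 1 / v y $ 2, 1] = (1 / v y $ 2) *\<^sub>R v y"
      using that by (simp add: vec_eq_iff forall_2)
    then show ?thesis
      using that span_image_scale[of "{v y}" "\<lambda>_. 1 / v y $ 2"] by (simp add: s_def coslope_chart_def)
  qed
  have "isCont s b"
    unfolding s_def using assms nz by (intro continuous_intros) auto
  moreover have "open (coslope_chart -` V)" "s b \<in> coslope_chart -` V"
    using V eq[OF nz] by (auto simp: openin_PT_topology PT_charts_def)
  ultimately have "\<forall>\<^sub>F y in nhds b. s y \<in> coslope_chart -` V"
    by (metis isCont_def tendsto_at_iff_tendsto_nhds topological_tendstoD)
  moreover have "\<forall>\<^sub>F y in nhds b. v y $ 2 \<noteq> 0"
  proof -
    have "isCont (\<lambda>y. v y $ 2) b" using assms by (intro continuous_intros)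
    then show ?thesis using nz
      by (metis isCont_def tendsto_at_iff_tendsto_nhds tendsto_imp_eventually_ne)
  qed
  ultimately show ?thesis
    by eventually_elim (metis eq vimage_eq)
qed

text \<open>Tangent vectors are defined by curves based at 0 on a symmetric interval. Rescaling the
  parameter by \<open>k\<close> multiplies the velocity by \<open>k\<close>, which realizes every
  multiple of a tangent vector.\<close>

lemma smooth_curve_on_affine_reparam:
  assumes "open I" "smooth_curve_on I c" "s \<in> I"
  shows "\<exists>e>0. smooth_curve_on {-e<..<e} (\<lambda>h. c (s + k * h)) \<and> (\<forall>h\<in>{-e<..<e}. s + k * h \<in> I)"
proof -
  obtain D where D: "\<And>t. t \<in> I \<Longrightarrow> D 0 t = c t"
      "\<And>n t. t \<in> I \<Longrightarrow> (D n has_vector_derivative D (Suc n) t) (at t)"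
    using assms(2) unfolding smooth_curve_on_def by blast
  obtain d where d: "d > 0" "ball s d \<subseteq> I" using assms openE by blast
  \<comment> \<open>The summand 1 keeps the quotient meaningful for \<open>k = 0\<close>.\<close>
  define e where "e = d / (\<bar>k\<bar> + 1)"
  have e: "e > 0" using d by (simp add: e_def)
  have in_I: "s + k * h \<in> I" if "h \<in> {-e<..<e}" for h
  proof -
    have "\<bar>h\<bar> < e" using that by auto
    then have "\<bar>h\<bar> * (\<bar>k\<bar> + 1) < d" by (simp add: e_def field_simps)
    moreover have "\<bar>k * h\<bar> \<le> \<bar>h\<bar> * (\<bar>k\<bar> + 1)" by (simp add: abs_mult algebra_simps)
    ultimately have "dist s (s + k * h) < d" by (simp add: dist_real_def)
    then show ?thesis using d(2) by (auto simp: mem_ball)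
  qed
  have "smooth_curve_on {-e<..<e} (\<lambda>h. c (s + k * h))"
    unfolding smooth_curve_on_def
  proof (intro exI conjI allI ballI)
    fix h assume h: "h \<in> {-e<..<e}"
    show "(k ^ 0) *\<^sub>R D 0 (s + k * h) = c (s + k * h)" using D(1)[OF in_I[OF h]] by simp
  next
    fix n h assume h: "h \<in> {-e<..<e}"
    have "((\<lambda>h. s + k * h) has_vector_derivative k) (at h)"
      by (auto intro!: derivative_eq_intros simp: has_real_derivative_iff_has_vector_derivative[symmetric])
    from vector_diff_chain_at[OF this D(2)[OF in_I[OF h]]]
    have "((\<lambda>h. D n (s + k * h)) has_vector_derivative k *\<^sub>R D (Suc n) (s + k * h)) (at h)"
      by (simp add: o_def)
    then have "((\<lambda>h. (k ^ n) *\<^sub>R D n (s + k * h)) has_vector_derivative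
        (k ^ n) *\<^sub>R k *\<^sub>R D (Suc n) (s + k * h)) (at h)"
      by (rule bounded_linear.has_vector_derivative[OF bounded_linear_scaleR_right])
    then show "((\<lambda>h. (k ^ n) *\<^sub>R D n (s + k * h)) has_vector_derivative
        (k ^ Suc n) *\<^sub>R D (Suc n) (s + k * h)) (at h)"
      by (simp add: mult.commute)
  qed
  with e in_I show ?thesis by blast
qed

lemma has_vector_derivative_quotient:
  assumes "(c has_vector_derivative w) (at s)"
  shows "((\<lambda>x. (c x - c s) /\<^sub>R (x - s)) \<longlongrightarrow> w) (at s)"
proof -
  have "((\<lambda>x. norm (c x - c s - (x - s) *\<^sub>R w) / norm (x - s)) \<longlongrightarrow> 0) (at s)"
    using assms unfolding has_vector_derivative_def has_derivative_iff_norm by blast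
  moreover have "\<forall>\<^sub>F x in at s. norm (c x - c s - (x - s) *\<^sub>R w) / norm (x - s) =
      norm ((c x - c s) /\<^sub>R (x - s) - w)"
    unfolding eventually_at_filter
  proof (intro always_eventually allI impI)
    fix x assume "x \<noteq> s"
    then have "(c x - c s) /\<^sub>R (x - s) - w = (c x - c s - (x - s) *\<^sub>R w) /\<^sub>R (x - s)"
      by (simp add: scaleR_right_diff_distrib)
    then show "norm (c x - c s - (x - s) *\<^sub>R w) / norm (x - s) = norm ((c x - c s) /\<^sub>R (x - s) - w)"
      by (simp add: divide_inverse_commute)
  qed
  ultimately have "((\<lambda>x. norm ((c x - c s) /\<^sub>R (x - s) - w)) \<longlongrightarrow> 0) (at s)"
    by (rule Lim_transform_eventually)
  then show ?thesis
    by (rule LIM_zero_cancel[OF tendsto_norm_zero_cancel])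
qed

text \<open>A curve \<open>g\<close> in \<open>S\<close> factors through \<open>c\<close> by a
  reparametrization that is merely continuous, so the chain rule does not apply. Instead, every
  secant of \<open>g\<close> is a multiple of a secant of \<open>c\<close>. The cross product of the
  two difference quotients is therefore zero, and in the limit \<open>v\<close> is parallel to
  \<open>w\<close>.\<close>

lemma tangent_space_parametrized:
  fixes c :: "real \<Rightarrow> real^2"
  assumes I: "open I" "s \<in> I" and sm: "smooth_curve_on I c"
    and der: "(c has_vector_derivative w) (at s)" and nz: "w \<noteq> 0"
    and U: "open U" and hom: "homeomorphism I (S \<inter> U) c d"
  shows "tangent_space S (c s) = span {w}"
proof
  show "span {w} \<subseteq> tangent_space S (c s)"
  proof
    fix v assume "v \<in> span {w}"
    then obtain k where k: "v = k *\<^sub>R w" by (auto simp: span_singleton)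
    obtain e where e: "e > 0" "smooth_curve_on {-e<..<e} (\<lambda>h. c (s + k * h))"
        "\<And>h. h \<in> {-e<..<e} \<Longrightarrow> s + k * h \<in> I"
      using smooth_curve_on_affine_reparam[OF I(1) sm I(2)] by blast
    have "((\<lambda>h. s + k * h) has_vector_derivative k) (at 0)"
      by (auto intro!: derivative_eq_intros simp: has_real_derivative_iff_has_vector_derivative[symmetric])
    from vector_diff_chain_at[OF this, of c w] der
    have 2: "((\<lambda>h. c (s + k * h)) has_vector_derivative v) (at 0)"
      by (simp add: o_def k)
    have 3: "(\<lambda>h. c (s + k * h)) ` {-e<..<e} \<subseteq> S"
      using e(3) homeomorphism_image1[OF hom] by (intro image_subsetI) blast
    show "v \<in> tangent_space S (c s)"
      unfolding tangent_space_def mem_Collect_eq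
      by (intro exI[of _ e] exI[of _ "\<lambda>h. c (s + k * h)"] conjI) (use e 2 3 in simp_all)
  qed
next
  show "tangent_space S (c s) \<subseteq> span {w}"
  proof
    fix v assume "v \<in> tangent_space S (c s)"
    then obtain e g where e: "e > 0" "g ` {-e<..<e} \<subseteq> S" "g 0 = c s"
        "(g has_vector_derivative v) (at 0)"
      unfolding tangent_space_def by blast
    define k where "k h = d (g h)" for h
    have k0: "k 0 = s" using hom I e(3) by (simp add: k_def homeomorphism_def)
    have gcont: "isCont g 0" using e(4) has_vector_derivative_continuous by blast
    have csU: "c s \<in> S \<inter> U" using homeomorphism_image1[OF hom] I by blast
    have ev: "\<forall>\<^sub>F h in at 0. g h \<in> S \<inter> U"
    proof -
      have "\<forall>\<^sub>F h in at 0. g h \<in> U"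
        using gcont U csU e(3) unfolding isCont_def by (metis IntD2 topological_tendstoD)
      moreover have "\<forall>\<^sub>F h in at 0. h \<in> {-e<..<e}"
        using e(1) by (intro eventually_at_in_open') auto
      ultimately show ?thesis by eventually_elim (use e(2) in blast)
    qed
    have klim: "(k \<longlongrightarrow> s) (at 0)"
    proof -
      have "continuous_on (S \<inter> U) d" using hom by (simp add: homeomorphism_def)
      moreover have "(g \<longlongrightarrow> c s) (at 0)"
        using gcont e(3) by (simp add: isCont_def)
      ultimately have "((\<lambda>h. d (g h)) \<longlongrightarrow> d (c s)) (at 0)"
        using csU ev by (rule continuous_on_tendsto_compose)
      then show ?thesis using k0 e(3) by (simp add: k_def[abs_def])
    qed
    have ck: "\<forall>\<^sub>F h in at 0. c (k h) = g h"
      using ev by eventually_elim (use hom in \<open>simp add: k_def homeomorphism_def\<close>)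
    \<comment> \<open>The difference quotient of \<open>c\<close> is completed by its limit at
      \<open>s\<close>, so that \<open>k h = s\<close> causes no exception.\<close>
    define Q where "Q x = (if x = s then w else (c x - c s) /\<^sub>R (x - s))" for x
    have Qc: "isCont Q s"
    proof -
      have "((\<lambda>x. (c x - c s) /\<^sub>R (x - s)) \<longlongrightarrow> w) (at s)"
        using der by (rule has_vector_derivative_quotient)
      then have "(Q \<longlongrightarrow> w) (at s)"
        by (rule Lim_transform_eventually) (auto simp: Q_def eventually_at_filter)
      then show ?thesis by (simp add: isCont_def Q_def)
    qed
    have Qeq: "c x - c s = (x - s) *\<^sub>R Q x" for x by (simp add: Q_def)
    have Qk: "((\<lambda>h. Q (k h)) \<longlongrightarrow> w) (at 0)"
      using isCont_tendsto_compose[OF Qc klim] by (simp add: Q_def)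
    have glim: "((\<lambda>h. (g h - g 0) /\<^sub>R h) \<longlongrightarrow> v) (at 0)"
      using has_vector_derivative_quotient[OF e(4)] by simp
    have "((\<lambda>h. cross2 (Q (k h)) ((g h - g 0) /\<^sub>R h)) \<longlongrightarrow> cross2 w v) (at 0)"
      by (intro cross2.tendsto Qk glim)
    moreover have "\<forall>\<^sub>F h in at 0. cross2 (Q (k h)) ((g h - g 0) /\<^sub>R h) = 0"
      using ck
    proof eventually_elim
      case (elim h)
      have "g h - g 0 = (k h - s) *\<^sub>R Q (k h)" using Qeq[of "k h"] elim e(3) by simp
      then show ?case by (simp add: cross2.scaleR_right)
    qed
    ultimately have "((\<lambda>h::real. 0::real) \<longlongrightarrow> cross2 w v) (at 0)"
      by (rule Lim_transform_eventually)
    then have "cross2 w v = 0" by (simp add: tendsto_const_iff)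
    then show "v \<in> span {w}" using cross2_eq_0_iff[OF nz] by (auto simp: span_singleton)
  qed
qed

lemma smooth_curve_onE:
  assumes "smooth_curve_on I c" "open I"
  obtains D where "\<And>t. t \<in> I \<Longrightarrow> D 0 t = c t"
    "\<And>n t. t \<in> I \<Longrightarrow> (D n has_vector_derivative D (Suc n) t) (at t)"
    "\<And>t. t \<in> I \<Longrightarrow> (c has_vector_derivative D (Suc 0) t) (at t)"
proof -
  obtain D where D: "\<And>t. t \<in> I \<Longrightarrow> D 0 t = c t"
    "\<And>n t. t \<in> I \<Longrightarrow> (D n has_vector_derivative D (Suc n) t) (at t)"
    using assms(1) unfolding smooth_curve_on_def by blast
  have "(c has_vector_derivative D (Suc 0) t) (at t)" if "t \<in> I" for t
    using has_vector_derivative_transform_within_open[OF D(2)[OF that, of 0] assms(2) that] D(1) by blast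
  with D that show thesis by blast
qed

lemma smooth_curve_on_cong:
  assumes "smooth_curve_on I c" "\<And>t. t \<in> I \<Longrightarrow> c t = c' t"
  shows "smooth_curve_on I c'"
  using assms unfolding smooth_curve_on_def by metis

text \<open>A germ of line-framed curve: \<open>A\<close> parametrizes the classical boundary, \<open>X s\<close> spans the line
  at \<open>A s\<close>.\<close>

locale framed_arc =
  fixes \<alpha> :: "line_element set" and b :: line_element and r :: real
    and A A1 A2 X X1 :: "real \<Rightarrow> real^2"
  assumes radius_pos: "r > 0"
    and base: "b = (A 0, span {X 0})"
    and arc_in: "s \<in> {-r<..<r} \<Longrightarrow> (A s, span {X s}) \<in> \<alpha>"
    and arc_deriv: "s \<in> {-r<..<r} \<Longrightarrow> (A has_vector_derivative A1 s) (at s)"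
    and arc_deriv2: "s \<in> {-r<..<r} \<Longrightarrow> (A1 has_vector_derivative A2 s) (at s)"
    and arc_cont2: "s \<in> {-r<..<r} \<Longrightarrow> isCont A2 s"
    and frame_deriv: "s \<in> {-r<..<r} \<Longrightarrow> (X has_vector_derivative X1 s) (at s)"
    and transversal: "s \<in> {-r<..<r} \<Longrightarrow> cross2 (X s) (A1 s) \<noteq> 0"
    and tangent: "s \<in> {-r<..<r} \<Longrightarrow> tangent_space (classical_boundary \<alpha>) (A s) = span {A1 s}"
    and nbhd: "0 < \<delta> \<Longrightarrow> \<delta> \<le> r \<Longrightarrow>
      \<exists>W. open W \<and> A 0 \<in> W \<and> (\<forall>x\<in>\<alpha>. fst x \<in> W \<longrightarrow> (\<exists>s\<in>{-\<delta><..<\<delta>}. x = (A s, span {X s})))"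
    and subset_PT: "\<alpha> \<subseteq> PT"

text \<open>A local parametrization of the boundary is lifted by the inverse of the projection;
  since the projection is a diffeomorphism, the lift is smooth. Reading it in one chart gives a
  differentiable spanning vector of the framing line. The parameter is shifted so that the base
  point sits at 0.\<close>

lemma framed_arc_exists:
  assumes lf: "line_framed_curve \<alpha>" and b: "b \<in> \<alpha>"
  shows "\<exists>r A A1 A2 X X1. framed_arc \<alpha> b r A A1 A2 X X1"
proof -
  define a where "a = classical_boundary \<alpha>"
  have emb: "embedded_curve a" and PT: "\<alpha> \<subseteq> PT" and bij: "bij_betw fst \<alpha> a"
    and lift: "\<And>I c. open I \<Longrightarrow> c ` I \<subseteq> \<alpha> \<Longrightarrow> smooth_curve_on I (fst \<circ> c) \<Longrightarrow> smooth_PT_curve_on I c"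
    and tr: "\<And>A L. (A, L) \<in> \<alpha> \<Longrightarrow> span (L \<union> tangent_space a A) = UNIV"
    using lf unfolding line_framed_curve_def projects_diffeomorphically_def embedded_PT_curve_def a_def
    by auto
  have "fst b \<in> a" using b by (simp add: a_def classical_boundary_def)
  then obtain U I c d where U: "open U" "fst b \<in> U" and I: "open I"
      and sm: "smooth_curve_on I c" and imm: "\<forall>t\<in>I. vector_derivative c (at t) \<noteq> 0"
      and hom: "homeomorphism I (a \<inter> U) c d"
    using emb unfolding embedded_curve_def by metis
  define s0 where "s0 = d (fst b)"
  have s0: "s0 \<in> I" "c s0 = fst b"
    using homeomorphism_image2[OF hom] homeomorphism_apply2[OF hom] \<open>fst b \<in> a\<close> U(2)
    by (auto simp: s0_def)
  obtain D where D: "\<And>t. t \<in> I \<Longrightarrow> D 0 t = c t"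
    "\<And>n t. t \<in> I \<Longrightarrow> (D n has_vector_derivative D (Suc n) t) (at t)"
    "\<And>t. t \<in> I \<Longrightarrow> (c has_vector_derivative D (Suc 0) t) (at t)"
    using smooth_curve_onE[OF sm I] by blast
  define e where "e t = inv_into \<alpha> fst (c t)" for t
  have ca: "c t \<in> a \<inter> U" if "t \<in> I" for t using homeomorphism_image1[OF hom] that by blast
  have e: "e t \<in> \<alpha>" "fst (e t) = c t" if "t \<in> I" for t
  proof -
    have "c t \<in> fst ` \<alpha>" using ca[OF that] bij by (simp add: bij_betw_def)
    then show "e t \<in> \<alpha>" "fst (e t) = c t" by (auto simp: e_def inv_into_into f_inv_into_f)
  qed
  have e_eq: "x = e t" if "x \<in> \<alpha>" "fst x = c t" "t \<in> I" for x t
    using that e[OF that(3)] bij by (metis bij_betw_def inj_onD)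
  have "smooth_curve_on I (fst \<circ> e)" by (rule smooth_curve_on_cong[OF sm]) (simp add: e)
  then have "smooth_PT_curve_on I e" using lift[OF I] e by blast
  then obtain \<phi> J g where \<phi>: "\<phi> \<in> PT_charts" and J: "open J" "s0 \<in> J" and g: "smooth_curve_on J g"
      and eg: "\<forall>s\<in>J \<inter> I. e s = \<phi> (g s)"
    using s0(1) unfolding smooth_PT_curve_on_def by blast
  obtain G where G: "\<And>t. t \<in> J \<Longrightarrow> (g has_vector_derivative G t) (at t)"
    using smooth_curve_onE[OF g J(1)] by metis
  obtain r where r: "r > 0" "ball s0 r \<subseteq> I \<inter> J"
    using openE[of "I \<inter> J" s0] I J s0 by blast
  have rI: "s0 + s \<in> I" "s0 + s \<in> J" if "s \<in> {-r<..<r}" for s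
  proof -
    have "s0 + s \<in> ball s0 r" using that by (auto simp: dist_real_def)
    then show "s0 + s \<in> I" "s0 + s \<in> J" using r(2) by blast+
  qed
  \<comment> \<open>In either chart the line is spanned by a vector affine in the chart coordinate,
    so its derivative is constant.\<close>
  obtain i :: "real \<Rightarrow> real^2" and i' where i: "\<And>A s. \<phi> (A, s) = (A, span {i s})"
      and i': "\<And>s. (i has_vector_derivative i') (at s)"
  proof (cases "\<phi> = slope_chart")
    case True
    have "((\<lambda>s. axis 1 1 + s *\<^sub>R axis 2 1) has_vector_derivative (axis 2 1 :: real^2)) (at s)" for s
      by (auto intro!: derivative_eq_intros)
    moreover have "axis 1 1 + s *\<^sub>R axis 2 1 = (vector [1, s] :: real^2)" for s
      by (simp add: vec_eq_iff forall_2 axis_def)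
    ultimately show thesis using that[of "\<lambda>s. vector [1, s]" "axis 2 1"] by (simp add: True slope_chart_def)
  next
    case False
    then have "\<phi> = coslope_chart" using \<phi> by (auto simp: PT_charts_def)
    moreover have "((\<lambda>s. s *\<^sub>R axis 1 1 + axis 2 1) has_vector_derivative (axis 1 1 :: real^2)) (at s)" for s
      by (auto intro!: derivative_eq_intros)
    moreover have "s *\<^sub>R axis 1 1 + axis 2 1 = (vector [s, 1] :: real^2)" for s
      by (simp add: vec_eq_iff forall_2 axis_def)
    ultimately show thesis using that[of "\<lambda>s. vector [s, 1]" "axis 1 1"] by (simp add: coslope_chart_def)
  qed
  define A A1 A2 X X1 where "A s = c (s0 + s)" and "A1 s = D 1 (s0 + s)" and "A2 s = D 2 (s0 + s)"
    and "X s = i (snd (g (s0 + s)))" and "X1 s = snd (G (s0 + s)) *\<^sub>R i'" for s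
  have shift: "((\<lambda>s. s0 + s) has_vector_derivative 1) (at s)" for s
    by (auto intro!: derivative_eq_intros)
  have der_shift: "((\<lambda>s. f (s0 + s)) has_vector_derivative f') (at s)"
    if "(f has_vector_derivative f') (at (s0 + s))" for f :: "real \<Rightarrow> 'z::real_normed_vector" and f' s
    using vector_diff_chain_at[OF shift that] by (simp add: o_def)
  have elt: "e (s0 + s) = (A s, span {X s})" if "s \<in> {-r<..<r}" for s
  proof -
    have "e (s0 + s) = \<phi> (g (s0 + s))" using eg rI[OF that] by blast
    also have "\<dots> = (fst (g (s0 + s)), span {X s})"
      using i[of "fst (g (s0 + s))" "snd (g (s0 + s))"] by (simp add: X_def)
    finally show ?thesis using e(2)[OF rI(1)[OF that]] by (simp add: A_def)
  qed
  have A1: "A1 s \<noteq> 0" if "s \<in> {-r<..<r}" for s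
    using imm rI(1)[OF that] vector_derivative_at[OF D(3)] by (simp add: A1_def)
  have tan: "tangent_space a (A s) = span {A1 s}" if "s \<in> {-r<..<r}" for s
    unfolding A_def A1_def
    using tangent_space_parametrized[OF I rI(1)[OF that] sm _ _ U(1) hom] D(3)[OF rI(1)[OF that]]
      A1[OF that] by (simp add: A1_def)
  have "framed_arc \<alpha> b r A A1 A2 X X1"
  proof
    show "r > 0" by fact
    show "\<alpha> \<subseteq> PT" by fact
    have "e s0 = b" using e_eq[OF b _ s0(1)] s0(2) by simp
    then show "b = (A 0, span {X 0})" using elt[of 0] r(1) by simp
  next
    fix s assume s: "s \<in> {-r<..<r}"
    note sI = rI[OF s]
    show "(A s, span {X s}) \<in> \<alpha>" using e(1)[OF sI(1)] elt[OF s] by simp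
    show "(A has_vector_derivative A1 s) (at s)"
      unfolding A_def[abs_def] A1_def by (rule der_shift) (use D(3)[OF sI(1)] in simp)
    show "(A1 has_vector_derivative A2 s) (at s)"
      unfolding A1_def[abs_def] A2_def
      by (rule der_shift) (use D(2)[OF sI(1), of 1] in \<open>simp add: numeral_2_eq_2\<close>)
    \<comment> \<open>The third derivative enters only to make the second one continuous.\<close>
    have "(A2 has_vector_derivative D 3 (s0 + s)) (at s)"
      unfolding A2_def[abs_def]
      by (rule der_shift) (use D(2)[OF sI(1), of 2] in \<open>simp add: numeral_3_eq_3 numeral_2_eq_2\<close>)
    then show "isCont A2 s" by (rule has_vector_derivative_continuous)
    have "((\<lambda>s. snd (g s)) has_vector_derivative snd (G (s0 + s))) (at (s0 + s))"
      by (rule bounded_linear.has_vector_derivative[OF bounded_linear_snd G[OF sI(2)]])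
    from der_shift[OF vector_diff_chain_at[OF this i']]
    show "(X has_vector_derivative X1 s) (at s)"
      unfolding X_def[abs_def] X1_def by (simp add: o_def)
    show "tangent_space (classical_boundary \<alpha>) (A s) = span {A1 s}"
      using tan[OF s] by (simp add: a_def)
    show "cross2 (X s) (A1 s) \<noteq> 0"
    proof
      assume "cross2 (X s) (A1 s) = 0"
      moreover have "cross2 (A1 s) (X s) = - cross2 (X s) (A1 s)" by (simp add: cross2_def)
      ultimately obtain k where "X s = k *\<^sub>R A1 s" using cross2_eq_0_iff[OF A1[OF s]] by auto
      then have "span {X s} \<subseteq> span {A1 s}"
        by (metis span_minimal span_base span_scale subspace_span insertI1 singletonD subsetI)
      then have "span (span {X s} \<union> span {A1 s}) = span {A1 s}" by (simp add: sup.absorb2)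
      moreover have "span (span {X s} \<union> span {A1 s}) = UNIV"
        using tr[of "A s" "span {X s}"] e(1)[OF sI(1)] elt[OF s] tan[OF s] by simp
      ultimately have "dim (UNIV :: (real^2) set) = dim {A1 s}" by (metis dim_span)
      then show False by (simp add: dim_singleton split: if_splits)
    qed
  next
    fix \<delta> :: real assume \<delta>: "0 < \<delta>" "\<delta> \<le> r"
    define N where "N = (\<lambda>s. s0 + s) ` {-\<delta><..<\<delta>}"
    have N: "open N" "N \<subseteq> I"
      using rI(1) \<delta> by (auto simp: N_def open_translation)
    \<comment> \<open>Openness of \<open>c\<close> onto its image says that no other piece of the
      boundary returns near \<open>A 0\<close>.\<close>
    have "openin (top_of_set (a \<inter> U)) (c ` N)"
      using homeomorphism_imp_open_map[OF hom] N by (simp add: openin_open_eq[OF I])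
    then obtain W where W: "open W" "c ` N = a \<inter> U \<inter> W" by (auto simp: openin_open)
    show "\<exists>W. open W \<and> A 0 \<in> W \<and>
        (\<forall>x\<in>\<alpha>. fst x \<in> W \<longrightarrow> (\<exists>s\<in>{-\<delta><..<\<delta>}. x = (A s, span {X s})))"
    proof (intro exI[of _ "U \<inter> W"] conjI ballI impI)
      show "open (U \<inter> W)" using U W by blast
      have "A 0 \<in> c ` N" using \<delta> by (force simp: N_def A_def)
      then show "A 0 \<in> U \<inter> W" using W(2) by blast
    next
      fix x assume x: "x \<in> \<alpha>" "fst x \<in> U \<inter> W"
      then have "fst x \<in> c ` N" unfolding W(2) by (auto simp: a_def classical_boundary_def)
      then obtain s where s: "s \<in> {-\<delta><..<\<delta>}" "fst x = c (s0 + s)" by (auto simp: N_def)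
      then have sr: "s \<in> {-r<..<r}" using \<delta> by auto
      have "x = (A s, span {X s})"
        using e_eq[OF x(1) s(2) rI(1)[OF sr]] elt[OF sr] by simp
      with s(1) show "\<exists>s\<in>{-\<delta><..<\<delta>}. x = (A s, span {X s})" by blast
    qed
  qed
  then show ?thesis by blast
qed

section \<open>The orbit surface\<close>

lemma inj_on_of_deriv_nonzero:
  fixes g :: "real \<Rightarrow> real"
  assumes g: "\<And>x. x \<in> {a<..<b} \<Longrightarrow> (g has_real_derivative g' x) (at x)"
    and nz: "\<And>x. x \<in> {a<..<b} \<Longrightarrow> g' x \<noteq> 0"
  shows "inj_on g {a<..<b}"
proof (rule linorder_inj_onI')
  fix x y assume xy: "x \<in> {a<..<b}" "y \<in> {a<..<b}" "x < y"
  have "(g has_real_derivative g' z) (at z)" if "x \<le> z" "z \<le> y" for z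
    using that xy by (intro g) auto
  from MVT2[OF \<open>x < y\<close> this] obtain z where "x < z" "z < y" "g y - g x = (y - x) * g' z" by blast
  then show "g x \<noteq> g y" using xy nz[of z] by auto
qed

text \<open>Here \<open>\<phi>\<close> is an arbitrary solution of
  \<open>g (\<phi> t) = h t\<close>, with no continuity at hand. As \<open>g'\<close> has no zero,
  \<open>g\<close> is injective on the entire interval, so \<open>\<phi>\<close> is forced to be the
  inverse of \<open>g\<close> after \<open>h\<close>, and the inverse function theorem
  applies.\<close>

lemma has_real_derivative_implicit:
  fixes g h \<phi> :: "real \<Rightarrow> real"
  assumes g: "\<And>x. x \<in> {a<..<b} \<Longrightarrow> (g has_real_derivative g' x) (at x)"
    and nz: "\<And>x. x \<in> {a<..<b} \<Longrightarrow> g' x \<noteq> 0"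
    and J: "open J" "t0 \<in> J" and \<phi>: "\<And>t. t \<in> J \<Longrightarrow> \<phi> t \<in> {a<..<b}"
    and eq: "\<And>t. t \<in> J \<Longrightarrow> g (\<phi> t) = h t"
    and h: "(h has_real_derivative h') (at t0)"
  shows "(\<phi> has_real_derivative h' / g' (\<phi> t0)) (at t0)"
proof -
  have inj: "inj_on g {a<..<b}" by (rule inj_on_of_deriv_nonzero[OF g nz])
  define G where "G = inv_into {a<..<b} g"
  have G: "G (g x) = x" if "x \<in> {a<..<b}" for x
    unfolding G_def by (rule inv_into_f_f[OF inj that])
  let ?x = "\<phi> t0"
  have x: "?x \<in> {a<..<b}" using \<phi> J by blast
  have "(G has_derivative (\<lambda>y. y / g' ?x)) (at (g ?x))"
  proof (rule has_derivative_inverse_strong[where f = g and x = "\<phi> t0" and S = "{a<..<b}" and f' = "(*) (g' (\<phi> t0))"])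
    show "open {a<..<b}" by simp
    show "?x \<in> {a<..<b}" by (rule x)
    show "continuous_on {a<..<b} g" using g by (intro DERIV_continuous_on) (auto intro: DERIV_subset)
    show "G (g y) = y" if "y \<in> {a<..<b}" for y using G that .
    show "(g has_derivative (*) (g' ?x)) (at ?x)" using g[OF x] by (simp add: has_field_derivative_def)
    show "(*) (g' ?x) \<circ> (\<lambda>y. y / g' ?x) = id" using nz[OF x] by (auto simp: fun_eq_iff)
  qed
  then have "(G has_real_derivative 1 / g' ?x) (at (h t0))"
    unfolding eq[OF J(2)] has_field_derivative_def by (rule has_derivative_eq_rhs) auto
  then have "((\<lambda>t. G (h t)) has_real_derivative 1 / g' ?x * h') (at t0)"
    by (rule DERIV_chain2[OF _ h])
  then have "(\<phi> has_real_derivative 1 / g' ?x * h') (at t0)"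
    by (rule has_field_derivative_transform_within_open[OF _ J]) (metis G \<phi> eq)
  then show ?thesis by simp
qed

text \<open>Only separate partial derivatives are available. The second difference of
  \<open>u\<close> over a small square, evaluated by the mean value theorem in both orders, gives
  two nearby points at which \<open>pt\<close> and \<open>qs\<close> agree; continuity at the corner
  concludes.\<close>

lemma mixed_partials_eq:
  fixes u p q pt qs :: "real \<Rightarrow> real \<Rightarrow> real"
  assumes e: "e > 0"
    and us: "\<And>s t. \<bar>s - s0\<bar> < e \<Longrightarrow> \<bar>t - t0\<bar> < e \<Longrightarrow> ((\<lambda>s. u s t) has_real_derivative p s t) (at s)"
    and ut: "\<And>s t. \<bar>s - s0\<bar> < e \<Longrightarrow> \<bar>t - t0\<bar> < e \<Longrightarrow> ((\<lambda>t. u s t) has_real_derivative q s t) (at t)"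
    and pt: "\<And>s t. \<bar>s - s0\<bar> < e \<Longrightarrow> \<bar>t - t0\<bar> < e \<Longrightarrow> ((\<lambda>t. p s t) has_real_derivative pt s t) (at t)"
    and qs: "\<And>s t. \<bar>s - s0\<bar> < e \<Longrightarrow> \<bar>t - t0\<bar> < e \<Longrightarrow> ((\<lambda>s. q s t) has_real_derivative qs s t) (at s)"
    and cont: "isCont (\<lambda>x. pt (fst x) (snd x)) (s0, t0)" "isCont (\<lambda>x. qs (fst x) (snd x)) (s0, t0)"
  shows "pt s0 t0 = qs s0 t0"
proof -
  have ex: "\<exists>x y x' y'. \<bar>x - s0\<bar> < h \<and> \<bar>y - t0\<bar> < h \<and> \<bar>x' - s0\<bar> < h \<and> \<bar>y' - t0\<bar> < h \<and>
      pt x y = qs x' y'" if h: "0 < h" "h < e" for h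
  proof -
    have lt: "s0 < s0 + h" "t0 < t0 + h" using h by auto
    have "((\<lambda>s. u s (t0 + h) - u s t0) has_real_derivative p s (t0 + h) - p s t0) (at s)"
      if "s0 \<le> s" "s \<le> s0 + h" for s
      using that h by (intro derivative_intros us) auto
    from MVT2[OF lt(1) this] obtain x where x: "s0 < x" "x < s0 + h"
        "u (s0 + h) (t0 + h) - u (s0 + h) t0 - (u s0 (t0 + h) - u s0 t0)
          = (s0 + h - s0) * (p x (t0 + h) - p x t0)" by blast
    have "((\<lambda>t. p x t) has_real_derivative pt x t) (at t)" if "t0 \<le> t" "t \<le> t0 + h" for t
      using that h x by (intro pt) auto
    from MVT2[OF lt(2) this] obtain y where y: "t0 < y" "y < t0 + h"
        "p x (t0 + h) - p x t0 = (t0 + h - t0) * pt x y" by blast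
    have "((\<lambda>t. u (s0 + h) t - u s0 t) has_real_derivative q (s0 + h) t - q s0 t) (at t)"
      if "t0 \<le> t" "t \<le> t0 + h" for t
      using that h by (intro derivative_intros ut) auto
    from MVT2[OF lt(2) this] obtain y' where y': "t0 < y'" "y' < t0 + h"
        "u (s0 + h) (t0 + h) - u s0 (t0 + h) - (u (s0 + h) t0 - u s0 t0)
          = (t0 + h - t0) * (q (s0 + h) y' - q s0 y')" by blast
    have "((\<lambda>s. q s y') has_real_derivative qs s y') (at s)" if "s0 \<le> s" "s \<le> s0 + h" for s
      using that h y' by (intro qs) auto
    from MVT2[OF lt(1) this] obtain x' where x': "s0 < x'" "x' < s0 + h"
        "q (s0 + h) y' - q s0 y' = (s0 + h - s0) * qs x' y'" by blast
    \<comment> \<open>Both sides are the second difference of \<open>u\<close> over the square of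
      side \<open>h\<close> with corner \<open>(s0, t0)\<close>.\<close>
    have "h * (h * pt x y) = h * (h * qs x' y')" 
      using x(3)[unfolded y(3) add_diff_cancel_left'] y'(3)[unfolded x'(3) add_diff_cancel_left']
      by linarith
    then have "pt x y = qs x' y'" using h by simp
    then show ?thesis using x y x' y' by (intro exI[of _ x] exI[of _ y] exI[of _ x'] exI[of _ y']) auto
  qed
  have small: "\<exists>d>0. \<forall>x y. \<bar>x - s0\<bar> < d \<and> \<bar>y - t0\<bar> < d \<longrightarrow> \<bar>f x y - f s0 t0\<bar> < \<eta>"
    if "isCont (\<lambda>x. f (fst x) (snd x)) (s0, t0)" "\<eta> > 0" for f :: "real \<Rightarrow> real \<Rightarrow> real" and \<eta>
  proof -
    from that(1)[unfolded continuous_at_eps_delta, rule_format, OF that(2)]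
    obtain d where d: "d > 0" "\<forall>z. dist z (s0, t0) < d \<longrightarrow> dist (f (fst z) (snd z)) (f s0 t0) < \<eta>"
      by auto
    have "\<bar>f x y - f s0 t0\<bar> < \<eta>" if "\<bar>x - s0\<bar> < d / 2" "\<bar>y - t0\<bar> < d / 2" for x y
    proof -
      have "dist (x, y) (s0, t0) \<le> dist x s0 + dist y t0"
        unfolding dist_prod_def by (simp add: sqrt_sum_squares_le_sum)
      then have "dist (x, y) (s0, t0) < d" using that by (simp add: dist_real_def)
      from d(2)[rule_format, OF this] show ?thesis by (simp add: dist_real_def)
    qed
    then show ?thesis using d(1) by (intro exI[of _ "d / 2"]) auto
  qed
  show ?thesis
  proof (rule ccontr)
    assume ne: "pt s0 t0 \<noteq> qs s0 t0"
    define \<eta> where "\<eta> = \<bar>pt s0 t0 - qs s0 t0\<bar> / 2"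
    have \<eta>: "\<eta> > 0" using ne by (simp add: \<eta>_def)
    obtain d1 where d1: "d1 > 0" "\<And>x y. \<bar>x - s0\<bar> < d1 \<Longrightarrow> \<bar>y - t0\<bar> < d1 \<Longrightarrow> \<bar>pt x y - pt s0 t0\<bar> < \<eta>"
      using small[OF cont(1) \<eta>] by blast
    obtain d2 where d2: "d2 > 0" "\<And>x y. \<bar>x - s0\<bar> < d2 \<Longrightarrow> \<bar>y - t0\<bar> < d2 \<Longrightarrow> \<bar>qs x y - qs s0 t0\<bar> < \<eta>"
      using small[OF cont(2) \<eta>] by blast
    define h where "h = min (e / 2) (min d1 d2)"
    have "0 < h" "h < e" using e d1(1) d2(1) by (auto simp: h_def)
    then obtain x y x' y' where xy: "\<bar>x - s0\<bar> < h" "\<bar>y - t0\<bar> < h" "\<bar>x' - s0\<bar> < h" "\<bar>y' - t0\<bar> < h"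
        "pt x y = qs x' y'" using ex by blast
    have "\<bar>pt x y - pt s0 t0\<bar> < \<eta>" using xy by (intro d1(2)) (auto simp: h_def)
    moreover have "\<bar>qs x' y' - qs s0 t0\<bar> < \<eta>" using xy by (intro d2(2)) (auto simp: h_def)
    ultimately
    show False using xy(5) unfolding \<eta>_def by (smt (verit) field_sum_of_halves)
  qed
qed

section \<open>Differentiation of the reflection law\<close>

lemma has_real_derivative_cross2:
  assumes "(f has_vector_derivative f') (at t)" "(g has_vector_derivative g') (at t)"
  shows "((\<lambda>t. cross2 (f t) (g t)) has_real_derivative cross2 (f t) g' + cross2 f' (g t)) (at t)"
  unfolding has_real_derivative_iff_has_vector_derivative
  by (rule cross2.has_vector_derivative[OF assms])

lemma continuous_cross2 [continuous_intros]:
  "continuous F f \<Longrightarrow> continuous F g \<Longrightarrow> continuous F (\<lambda>x. cross2 (f x) (g x))"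
  by (rule cross2.continuous)

text \<open>A Pluecker relation collapses the numerator of the quotient rule to a product. It shows
  when the coordinate is strictly monotone: \<open>x\<close> and \<open>a\<close> independent, and
  the line to \<open>P\<close> not tangent to \<open>c\<close>.\<close>

lemma pencil_coordinate_deriv:
  assumes c: "(c has_vector_derivative c') (at t)" and nz: "cross2 a (c t - P) \<noteq> 0"
  shows "((\<lambda>t. cross2 x (c t - P) / cross2 a (c t - P)) has_real_derivative
    - (cross2 x a * cross2 c' (P - c t)) / (cross2 a (c t - P))\<^sup>2) (at t)"
proof -
  have d: "((\<lambda>t. cross2 y (c t - P)) has_real_derivative cross2 y c') (at t)" for y
  proof -
    have "((\<lambda>t. c t - P) has_vector_derivative c' - 0) (at t)"
      by (intro derivative_intros c)
    from has_real_derivative_cross2[OF has_vector_derivative_const this, of y]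
    show ?thesis by simp
  qed
  have "cross2 x c' * cross2 a (c t - P) - cross2 x (c t - P) * cross2 a c'
      = - (cross2 x a * cross2 c' (P - c t))"
    by (simp add: cross2_def algebra_simps)
  then show ?thesis
    using DERIV_divide[OF d d nz, of x] by (simp add: power2_eq_square)
qed

text \<open>Seen from the fixed vertex \<open>P\<close>, the coordinates of \<open>b t\<close> and
  of \<open>c (\<phi> t)\<close> are opposite. The factor \<open>cross2 x a\<close> occurs in the
  derivatives of both and cancels, so the formula contains tangents only and no framing
  direction.\<close>

lemma reflected_point_deriv:
  fixes b c :: "real \<Rightarrow> real^2"
  assumes tr: "cross2 x a \<noteq> 0"
    and b: "(b has_vector_derivative b') (at t0)"
    and c: "\<And>v. v \<in> {-r<..<r} \<Longrightarrow> (c has_vector_derivative c1 v) (at v)"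
    and nz: "\<And>v. v \<in> {-r<..<r} \<Longrightarrow> cross2 a (c v - P) \<noteq> 0"
      "\<And>v. v \<in> {-r<..<r} \<Longrightarrow> cross2 (c1 v) (P - c v) \<noteq> 0"
      "\<And>t. t \<in> J \<Longrightarrow> cross2 a (b t - P) \<noteq> 0"
    and J: "open J" "t0 \<in> J" and \<phi>: "\<And>t. t \<in> J \<Longrightarrow> \<phi> t \<in> {-r<..<r}"
    and harm: "\<And>t. t \<in> J \<Longrightarrow>
      cross2 x (b t - P) * cross2 a (c (\<phi> t) - P) + cross2 x (c (\<phi> t) - P) * cross2 a (b t - P) = 0"
  shows "(\<phi> has_real_derivative - (cross2 b' (P - b t0) * (cross2 a (c (\<phi> t0) - P))\<^sup>2) /
      (cross2 (c1 (\<phi> t0)) (P - c (\<phi> t0)) * (cross2 a (b t0 - P))\<^sup>2)) (at t0)"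
proof -
  let ?v = "\<phi> t0"
  define g where "g v = cross2 x (c v - P) / cross2 a (c v - P)" for v
  define h where "h t = - (cross2 x (b t - P) / cross2 a (b t - P))" for t
  have "(\<phi> has_real_derivative (- (- (cross2 x a * cross2 b' (P - b t0)) / (cross2 a (b t0 - P))\<^sup>2)) /
      (- (cross2 x a * cross2 (c1 ?v) (P - c ?v)) / (cross2 a (c ?v - P))\<^sup>2)) (at t0)"
  proof (rule has_real_derivative_implicit[where g = g and h = h and a = "-r" and b = r and J = J and
        g' = "\<lambda>v. - (cross2 x a * cross2 (c1 v) (P - c v)) / (cross2 a (c v - P))\<^sup>2"])
    show "(g has_real_derivative - (cross2 x a * cross2 (c1 v) (P - c v)) / (cross2 a (c v - P))\<^sup>2) (at v)"
      if "v \<in> {-r<..<r}" for v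
      unfolding g_def[abs_def] by (rule pencil_coordinate_deriv[OF c[OF that] nz(1)[OF that]])
    show "- (cross2 x a * cross2 (c1 v) (P - c v)) / (cross2 a (c v - P))\<^sup>2 \<noteq> 0"
      if "v \<in> {-r<..<r}" for v
      using tr nz that by simp
    show "(h has_real_derivative - (- (cross2 x a * cross2 b' (P - b t0)) / (cross2 a (b t0 - P))\<^sup>2)) (at t0)"
      unfolding h_def[abs_def] by (intro DERIV_minus pencil_coordinate_deriv b nz(3) J)
    show "g (\<phi> t) = h t" if "t \<in> J" for t
    proof -
      note n = nz(1)[OF \<phi>[OF that]] nz(3)[OF that]
      have "g (\<phi> t) - h t = (cross2 x (b t - P) * cross2 a (c (\<phi> t) - P)
          + cross2 x (c (\<phi> t) - P) * cross2 a (b t - P)) / (cross2 a (c (\<phi> t) - P) * cross2 a (b t - P))"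
        using n by (simp add: g_def h_def divide_simps)
      then show ?thesis using harm[OF that] by simp
    qed
  qed (use J \<phi> in auto)
  moreover have "- (- (\<kappa> * p) / q\<^sup>2) / (- (\<kappa> * k) / l\<^sup>2) = - (p * l\<^sup>2) / (k * q\<^sup>2)"
    if "\<kappa> \<noteq> 0" "k \<noteq> 0" "l \<noteq> 0" "q \<noteq> 0" for \<kappa> p q k l :: real
    using that by (simp add: divide_simps)
  ultimately show ?thesis
    using tr nz(1,2)[OF \<phi>[OF J(2)]] nz(3)[OF J(2)] by metis
qed

text \<open>Here \<open>P3 - P2\<close>, \<open>Q1 - Q3\<close>, \<open>R2 - R1\<close> are normalized curvatures in barycentric coordinates. The
  first two equations express them through one another, and \<open>u\<^sub>s\<^sub>t = u\<^sub>t\<^sub>s\<close> adds the multiple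
  \<open>3 x y (R2 - R1) = 0\<close>.\<close>

lemma log_derivative_system:
  fixes P2 P3 Q1 Q3 R1 R2 :: real and N1 N2 N3 x y a b c :: real
  assumes x: "x * N3 = - N1" and y: "y * N3 = - N2" and nz: "x \<noteq> 0" "y \<noteq> 0"
    and s: "(P2 + x * (c - N3)) + (a - N1) + x * R1 = P3 + x * (c + N3) + (x * R2 + (a + N1))"
    and t: "y * (c - N3) + Q3 + (y * R1 + (b - N2)) = (b + N2) + (Q1 + y * (c + N3)) + y * R2"
    and st: "y * ((a - N1) + 2 * (P2 + x * (c - N3)) - (x * R2 + (a + N1)) - 2 * P3)
      = x * ((b + N2) + 2 * (Q1 + y * (c + N3)) - (y * R1 + (b - N2)) - 2 * Q3)"
  shows "P2 = P3" "Q1 = Q3" "R1 = R2"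
proof -
  have 1: "P3 - P2 = - x * (R2 - R1)" using s x by algebra
  have 2: "Q1 - Q3 = - y * (R2 - R1)" using t y by algebra
  have "3 * (x * y * (R2 - R1)) = 0" using st 1 2 x y by algebra
  then show "R1 = R2" using nz by simp
  with 1 2 show "P2 = P3" "Q1 = Q3" by auto
qed

text \<open>Velocity and acceleration at each vertex are decomposed along the two sides issuing from
  it. Cross products with sides then isolate single coordinates up to the common factor
  \<open>\<Delta>\<close>, and the equations become \<open>log_derivative_system\<close>. A
  conclusion such as \<open>p2 / a2 = p3 / a3\<close> says that acceleration is parallel to
  velocity.\<close>

lemma curvatures_vanish:
  fixes A B C A1 A2 B1 B2 C1 C2 :: "real^2" and x y :: real
  assumes \<Delta>: "cross2 (B - A) (C - A) \<noteq> 0"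
    and nz: "cross2 A1 (B - A) \<noteq> 0" "cross2 A1 (C - A) \<noteq> 0" "cross2 B1 (A - B) \<noteq> 0"
      "cross2 B1 (C - B) \<noteq> 0" "cross2 C1 (A - C) \<noteq> 0" "cross2 C1 (B - C) \<noteq> 0"
    and x: "x = - (cross2 A1 (B - A) * (cross2 B1 (C - B))\<^sup>2) / (cross2 C1 (B - C) * (cross2 B1 (A - B))\<^sup>2)"
    and y: "y = - (cross2 B1 (A - B) * (cross2 A1 (C - A))\<^sup>2) / (cross2 C1 (A - C) * (cross2 A1 (B - A))\<^sup>2)"
    and G: "cross2 A1 (C - A) * cross2 B1 (A - B) * cross2 C1 (B - C)
      = cross2 A1 (B - A) * cross2 B1 (C - B) * cross2 C1 (A - C)"
    and Gs: "(cross2 A2 (C - A) + x * cross2 A1 C1) / cross2 A1 (C - A) + cross2 B1 A1 / cross2 B1 (A - B)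
        + x * cross2 C2 (B - C) / cross2 C1 (B - C)
      = cross2 A2 (B - A) / cross2 A1 (B - A) + x * cross2 B1 C1 / cross2 B1 (C - B)
        + (x * cross2 C2 (A - C) + cross2 C1 A1) / cross2 C1 (A - C)"
    and Gt: "y * cross2 A1 C1 / cross2 A1 (C - A) + cross2 B2 (A - B) / cross2 B1 (A - B)
        + (y * cross2 C2 (B - C) + cross2 C1 B1) / cross2 C1 (B - C)
      = cross2 A1 B1 / cross2 A1 (B - A) + (cross2 B2 (C - B) + y * cross2 B1 C1) / cross2 B1 (C - B)
        + y * cross2 C2 (A - C) / cross2 C1 (A - C)"
    and st: "y * (cross2 B1 A1 / cross2 B1 (A - B)
        + 2 * ((cross2 A2 (C - A) + x * cross2 A1 C1) / cross2 A1 (C - A))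
        - (x * cross2 C2 (A - C) + cross2 C1 A1) / cross2 C1 (A - C)
        - 2 * (cross2 A2 (B - A) / cross2 A1 (B - A)))
      = x * (cross2 A1 B1 / cross2 A1 (B - A)
        + 2 * ((cross2 B2 (C - B) + y * cross2 B1 C1) / cross2 B1 (C - B))
        - (y * cross2 C2 (B - C) + cross2 C1 B1) / cross2 C1 (B - C)
        - 2 * (cross2 B2 (A - B) / cross2 B1 (A - B)))"
  shows "cross2 A1 A2 = 0" "cross2 B1 B2 = 0" "cross2 C1 C2 = 0"
proof -
  define \<Delta> where "\<Delta> = cross2 (B - A) (C - A)"
  have \<Delta>0: "\<Delta> \<noteq> 0" using \<Delta> by (simp add: \<Delta>_def)
  have \<Delta>': "cross2 (C - B) (A - B) = \<Delta>" "cross2 (A - C) (B - C) = \<Delta>"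
    by (simp_all add: \<Delta>_def cross2_def algebra_simps)
  have dec: "\<exists>k l. v = k *\<^sub>R D + l *\<^sub>R E" if "cross2 D E = \<Delta>" for v D E :: "real^2"
    using cross2_nonzero_coords[of D E v] \<Delta>0 that by auto
  obtain a2 a3 where A1: "A1 = a2 *\<^sub>R (B - A) + a3 *\<^sub>R (C - A)" using dec \<Delta>_def by metis
  obtain p2 p3 where A2: "A2 = p2 *\<^sub>R (B - A) + p3 *\<^sub>R (C - A)" using dec \<Delta>_def by metis
  obtain b3 b1 where B1: "B1 = b3 *\<^sub>R (C - B) + b1 *\<^sub>R (A - B)" using dec \<Delta>'(1) by metis
  obtain q3 q1 where B2: "B2 = q3 *\<^sub>R (C - B) + q1 *\<^sub>R (A - B)" using dec \<Delta>'(1) by metis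
  obtain c1 c2 where C1: "C1 = c1 *\<^sub>R (A - C) + c2 *\<^sub>R (B - C)" using dec \<Delta>'(2) by metis
  obtain r1 r2 where C2: "C2 = r1 *\<^sub>R (A - C) + r2 *\<^sub>R (B - C)" using dec \<Delta>'(2) by metis
  \<comment> \<open>The weight at the vertex itself, chosen so that the barycentric coordinates of
    the velocity sum to zero.\<close>
  define a1 b2 c3 where "a1 = - a2 - a3" and "b2 = - b3 - b1" and "c3 = - c1 - c2"
  note bary = a1_def b2_def c3_def
  have v: "cross2 A1 (B - A) = - (a3 * \<Delta>)" "cross2 A1 (C - A) = a2 * \<Delta>"
    "cross2 B1 (A - B) = b3 * \<Delta>" "cross2 B1 (C - B) = - (b1 * \<Delta>)"
    "cross2 C1 (B - C) = c1 * \<Delta>" "cross2 C1 (A - C) = - (c2 * \<Delta>)"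
    "cross2 A2 (B - A) = - (p3 * \<Delta>)" "cross2 A2 (C - A) = p2 * \<Delta>"
    "cross2 B2 (A - B) = q3 * \<Delta>" "cross2 B2 (C - B) = - (q1 * \<Delta>)"
    "cross2 C2 (B - C) = r1 * \<Delta>" "cross2 C2 (A - C) = - (r2 * \<Delta>)"
    by (simp_all add: A1 A2 B1 B2 C1 C2 \<Delta>_def cross2_def algebra_simps)
  have w: "cross2 A1 C1 = (a2 * c3 - a3 * c2) * \<Delta>" "cross2 B1 A1 = (b3 * a1 - b1 * a3) * \<Delta>"
    "cross2 C1 B1 = (c1 * b2 - c2 * b1) * \<Delta>"
    by (simp_all add: A1 B1 C1 \<Delta>_def cross2_def bary algebra_simps)
  have w': "cross2 C1 A1 = - ((a2 * c3 - a3 * c2) * \<Delta>)" "cross2 A1 B1 = - ((b3 * a1 - b1 * a3) * \<Delta>)"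
    "cross2 B1 C1 = - ((c1 * b2 - c2 * b1) * \<Delta>)"
    unfolding w[symmetric] by (simp_all add: cross2_def)
  have n: "a2 \<noteq> 0" "a3 \<noteq> 0" "b1 \<noteq> 0" "b3 \<noteq> 0" "c1 \<noteq> 0" "c2 \<noteq> 0"
    using nz unfolding v by auto
  have g: "a2 * b3 * c1 = - (a3 * b1 * c2)"
  proof -
    have "\<Delta> ^ 3 * (a2 * b3 * c1) = \<Delta> ^ 3 * - (a3 * b1 * c2)" using G unfolding v by algebra
    moreover have "\<Delta> ^ 3 \<noteq> 0" using \<Delta>0 by simp
    ultimately show ?thesis using mult_left_cancel by blast
  qed
  \<comment> \<open>By the Menelaus relation \<open>g\<close>, each of these has a second expression
    with opposite sign. According to which of the two denominators occurs, a quotient of mixed cross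
    products is \<open>a1 - N1\<close> or \<open>a1 + N1\<close>, and similarly for
    \<open>b2\<close> and \<open>c3\<close>.\<close>
  define N1 N2 N3 where "N1 = a3 * b1 / b3" and "N2 = b1 * c2 / c1" and "N3 = c2 * a3 / a2"
  have N: "c1 * a2 / c2 = - N1" "a2 * b3 / a3 = - N2" "b3 * c1 / b1 = - N3"
    using n g by (simp_all add: N1_def N2_def N3_def divide_simps) (algebra)+
  have x': "x = a3 * b1\<^sup>2 / (c1 * b3\<^sup>2)" and y': "y = b3 * a2\<^sup>2 / (c2 * a3\<^sup>2)"
    unfolding x y v using \<Delta>0 n by (simp_all add: divide_simps power2_eq_square)
  have xN: "x * N3 = - N1"
    unfolding x' N1_def N3_def using n g by (simp add: divide_simps power2_eq_square) algebra
  have yN: "y * N3 = - N2"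
    unfolding y' N2_def N3_def using n g by (simp add: divide_simps power2_eq_square) algebra
  have xy: "x \<noteq> 0" "y \<noteq> 0" unfolding x' y' using n by auto
  have l: "(cross2 A2 (C - A) + x * cross2 A1 C1) / cross2 A1 (C - A) = p2 / a2 + x * (c3 - N3)"
    "cross2 B1 A1 / cross2 B1 (A - B) = a1 - N1"
    "x * cross2 C2 (B - C) / cross2 C1 (B - C) = x * (r1 / c1)"
    "cross2 A2 (B - A) / cross2 A1 (B - A) = p3 / a3"
    "y * cross2 A1 C1 / cross2 A1 (C - A) = y * (c3 - N3)"
    "cross2 B2 (A - B) / cross2 B1 (A - B) = q3 / b3"
    "(y * cross2 C2 (B - C) + cross2 C1 B1) / cross2 C1 (B - C) = y * (r1 / c1) + (b2 - N2)"
    "y * cross2 C2 (A - C) / cross2 C1 (A - C) = y * (r2 / c2)"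
    unfolding v w N1_def N2_def N3_def using \<Delta>0 n by (simp_all add: divide_simps) (simp_all add: algebra_simps)
  have l': "x * cross2 B1 C1 / cross2 B1 (C - B) = x * (c3 + N3)" 
    "(x * cross2 C2 (A - C) + cross2 C1 A1) / cross2 C1 (A - C) = x * (r2 / c2) + (a1 + N1)"
    "cross2 A1 B1 / cross2 A1 (B - A) = b2 + N2"
    "(cross2 B2 (C - B) + y * cross2 B1 C1) / cross2 B1 (C - B) = q1 / b1 + y * (c3 + N3)"
  proof -
    have 1: "c1 * b2 - c2 * b1 = b1 * (c3 + N3)" "a2 * c3 - a3 * c2 = c2 * (a1 + N1)"
      "b3 * a1 - b1 * a3 = a3 * (b2 + N2)"
    proof -
      have "b1 * N3 = - (b3 * c1)" "c2 * N1 = - (c1 * a2)" "a3 * N2 = - (a2 * b3)"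
        using N n by (simp_all add: field_simps)
      then show "c1 * b2 - c2 * b1 = b1 * (c3 + N3)" "a2 * c3 - a3 * c2 = c2 * (a1 + N1)"
        "b3 * a1 - b1 * a3 = a3 * (b2 + N2)"
        by (simp_all add: bary algebra_simps)
    qed
    show "x * cross2 B1 C1 / cross2 B1 (C - B) = x * (c3 + N3)" 
      "(x * cross2 C2 (A - C) + cross2 C1 A1) / cross2 C1 (A - C) = x * (r2 / c2) + (a1 + N1)"
      "cross2 A1 B1 / cross2 A1 (B - A) = b2 + N2"
      "(cross2 B2 (C - B) + y * cross2 B1 C1) / cross2 B1 (C - B) = q1 / b1 + y * (c3 + N3)"
      unfolding v w' 1 using \<Delta>0 n by (simp_all add: divide_simps) (simp_all add: algebra_simps)
  qed
  have "p2 / a2 = p3 / a3" "q1 / b1 = q3 / b3" "r1 / c1 = r2 / c2"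
    using log_derivative_system[OF xN yN xy Gs[unfolded l l'] Gt[unfolded l l'] st[unfolded l l']] .
  then have "a2 * p3 - a3 * p2 = 0" "b3 * q1 - b1 * q3 = 0" "c1 * r2 - c2 * r1 = 0"
    using n by (simp_all add: field_simps)
  moreover have "cross2 A1 A2 = (a2 * p3 - a3 * p2) * \<Delta>" "cross2 B1 B2 = (b3 * q1 - b1 * q3) * \<Delta>"
    "cross2 C1 C2 = (c1 * r2 - c2 * r1) * \<Delta>"
    by (simp_all add: A1 A2 B1 B2 C1 C2 \<Delta>_def cross2_def algebra_simps)
  ultimately show "cross2 A1 A2 = 0" "cross2 B1 B2 = 0" "cross2 C1 C2 = 0" by simp_all
qed

text \<open>The uniform bounds make the partial derivatives of the third vertex bounded, hence the third
  vertex jointly continuous.\<close>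

definition nontangent :: "real \<Rightarrow> real \<Rightarrow> real \<Rightarrow> (real \<Rightarrow> real^2) \<Rightarrow> (real \<Rightarrow> real^2) \<Rightarrow> (real \<Rightarrow> real^2) \<Rightarrow> bool" where
  "nontangent r m M A A1 B \<longleftrightarrow>
     (\<forall>s\<in>{-r<..<r}. \<forall>t\<in>{-r<..<r}. m \<le> \<bar>cross2 (A1 s) (B t - A s)\<bar> \<and> \<bar>cross2 (A1 s) (B t - A s)\<bar> \<le> M)"

text \<open>The pencil coordinate \<open>v \<mapsto> (x \<times> v) / (a \<times> v)\<close> takes opposite values on lines that are symmetric
  with respect to the directions \<open>x\<close> and \<open>a\<close>.\<close>

definition reflects :: "real^2 \<Rightarrow> real^2 \<Rightarrow> real^2 \<Rightarrow> real^2 \<Rightarrow> real^2 \<Rightarrow> bool" where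
  "reflects x a P B C \<longleftrightarrow> cross2 x (B - P) * cross2 a (C - P) + cross2 x (C - P) * cross2 a (B - P) = 0"

text \<open>This is the shape of both partial derivatives of \<open>u\<close>. The logarithmic form
  keeps the derivative a multiple of the monomial itself, as the comparison of mixed derivatives
  uses it.\<close>

lemma DERIV_log_quotient:
  fixes f g h k :: "real \<Rightarrow> real"
  assumes "(f has_real_derivative f') (at s)" "(g has_real_derivative g') (at s)"
    "(h has_real_derivative h') (at s)" "(k has_real_derivative k') (at s)"
    and "f s \<noteq> 0" "g s \<noteq> 0" "h s \<noteq> 0" "k s \<noteq> 0"
  shows "((\<lambda>s. - (f s * (g s)\<^sup>2) / (h s * (k s)\<^sup>2)) has_real_derivative
    - (f s * (g s)\<^sup>2) / (h s * (k s)\<^sup>2) * (f' / f s + 2 * (g' / g s) - h' / h s - 2 * (k' / k s))) (at s)"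
  using assms(5-8)
  by (auto intro!: derivative_eq_intros assms(1-4) simp: divide_simps power2_eq_square)
    (simp_all add: algebra_simps)

text \<open>Logarithmic differentiation of an identity between products, done without logarithms
  because the factors may have either sign.\<close>

lemma log_derivative_of_product_eq:
  fixes f g h f' g' h' :: "real \<Rightarrow> real"
  assumes "(f has_real_derivative df) (at s)" "(g has_real_derivative dg) (at s)"
    "(h has_real_derivative dh) (at s)" "(f' has_real_derivative df') (at s)"
    "(g' has_real_derivative dg') (at s)" "(h' has_real_derivative dh') (at s)"
    and nz: "f s \<noteq> 0" "g s \<noteq> 0" "h s \<noteq> 0" "f' s \<noteq> 0" "g' s \<noteq> 0" "h' s \<noteq> 0"
    and S: "open S" "s \<in> S" and eq: "\<And>x. x \<in> S \<Longrightarrow> f x * g x * h x = f' x * g' x * h' x"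
  shows "df / f s + dg / g s + dh / h s = df' / f' s + dg' / g' s + dh' / h' s"
proof -
  have 1: "((\<lambda>x. f x * g x * h x) has_real_derivative (df * g s + dg * f s) * h s + dh * (f s * g s)) (at s)"
    by (intro DERIV_mult assms)
  have 2: "((\<lambda>x. f' x * g' x * h' x) has_real_derivative
      (df' * g' s + dg' * f' s) * h' s + dh' * (f' s * g' s)) (at s)"
    by (intro DERIV_mult assms)
  then have "((\<lambda>x. f x * g x * h x) has_real_derivative
      (df' * g' s + dg' * f' s) * h' s + dh' * (f' s * g' s)) (at s)"
    by (rule has_field_derivative_transform_within_open[OF _ S]) (simp add: eq)
  from DERIV_unique[OF 1 this]
  have "(df / f s + dg / g s + dh / h s) * (f s * g s * h s)
      = (df' / f' s + dg' / g' s + dh' / h' s) * (f' s * g' s * h' s)"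
    using nz by (simp add: field_simps)
  then have "(df / f s + dg / g s + dh / h s) * (f s * g s * h s)
      = (df' / f' s + dg' / g' s + dh' / h' s) * (f s * g s * h s)"
    using eq[OF S(2)] by simp
  then show ?thesis using nz by simp
qed

section \<open>Triangles near the base orbit and families of orbits\<close>

lemma tau_deriv:
  assumes "(P has_vector_derivative P') (at t)" "(a has_vector_derivative a') (at t)"
    "(Q has_vector_derivative Q') (at t)"
  shows "((\<lambda>t. cross2 (a t) (Q t - P t)) has_real_derivative cross2 (a t) (Q' - P') + cross2 a' (Q t - P t)) (at t)"
  by (intro has_real_derivative_cross2 assms has_vector_derivative_diff)

lemma nontangentD:
  assumes "nontangent r m M A A1 B" "m > 0" "s \<in> {-r<..<r}" "t \<in> {-r<..<r}"
  shows "cross2 (A1 s) (B t - A s) \<noteq> 0"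
proof -
  have "m \<le> \<bar>cross2 (A1 s) (B t - A s)\<bar>" using assms unfolding nontangent_def by blast
  with assms(2) show ?thesis by auto
qed

locale framed_triangle =
  fa: framed_arc \<alpha> a0 r A A1 A2 X X1 + fb: framed_arc \<beta> b0 r B B1 B2 Y Y1 +
  fc: framed_arc \<gamma> c0 r C C1 C2 Z Z1
  for \<alpha> a0 r A A1 A2 X X1 \<beta> b0 B B1 B2 Y Y1 \<gamma> c0 C C1 C2 Z Z1 +
  fixes m M :: real
  assumes m_pos: "m > 0"
    and nt: "nontangent r m M A A1 B" "nontangent r m M A A1 C" "nontangent r m M B B1 A"
      "nontangent r m M B B1 C" "nontangent r m M C C1 A" "nontangent r m M C C1 B"
begin

lemma nonzero:
  assumes "s \<in> {-r<..<r}" "t \<in> {-r<..<r}" "v \<in> {-r<..<r}"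
  shows "cross2 (A1 s) (B t - A s) \<noteq> 0" "cross2 (A1 s) (C v - A s) \<noteq> 0"
    "cross2 (B1 t) (A s - B t) \<noteq> 0" "cross2 (B1 t) (C v - B t) \<noteq> 0"
    "cross2 (C1 v) (A s - C v) \<noteq> 0" "cross2 (C1 v) (B t - C v) \<noteq> 0"
  by (rule nontangentD[OF nt(1) m_pos] nontangentD[OF nt(2) m_pos] nontangentD[OF nt(3) m_pos]
      nontangentD[OF nt(4) m_pos] nontangentD[OF nt(5) m_pos] nontangentD[OF nt(6) m_pos]; rule assms)+

end

text \<open>Here \<open>u\<close> is any selection of third vertices, known only through its range
  and the three reflection laws. The first two parameters stay in the smaller interval, while
  \<open>u\<close> may take any value at which the uniform bounds hold.\<close>

locale orbit_family = framed_triangle +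
  fixes \<epsilon> :: real and u :: "real \<Rightarrow> real \<Rightarrow> real"
  assumes eps: "0 < \<epsilon>" "\<epsilon> \<le> r"
    and u_range: "s \<in> {-\<epsilon><..<\<epsilon>} \<Longrightarrow> t \<in> {-\<epsilon><..<\<epsilon>} \<Longrightarrow> u s t \<in> {-r<..<r}"
    and reflA: "s \<in> {-\<epsilon><..<\<epsilon>} \<Longrightarrow> t \<in> {-\<epsilon><..<\<epsilon>} \<Longrightarrow> reflects (X s) (A1 s) (A s) (B t) (C (u s t))"
    and reflB: "s \<in> {-\<epsilon><..<\<epsilon>} \<Longrightarrow> t \<in> {-\<epsilon><..<\<epsilon>} \<Longrightarrow> reflects (Y t) (B1 t) (B t) (A s) (C (u s t))"
    and reflC: "s \<in> {-\<epsilon><..<\<epsilon>} \<Longrightarrow> t \<in> {-\<epsilon><..<\<epsilon>} \<Longrightarrow>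
      reflects (Z (u s t)) (C1 (u s t)) (C (u s t)) (A s) (B t)"
begin

abbreviation "AB s t \<equiv> cross2 (A1 s) (B t - A s)"
abbreviation "AC s v \<equiv> cross2 (A1 s) (C v - A s)"
abbreviation "BA t s \<equiv> cross2 (B1 t) (A s - B t)"
abbreviation "BC t v \<equiv> cross2 (B1 t) (C v - B t)"
abbreviation "CA v s \<equiv> cross2 (C1 v) (A s - C v)"
abbreviation "CB v t \<equiv> cross2 (C1 v) (B t - C v)"

lemma bounds:
  assumes "s \<in> {-r<..<r}" "t \<in> {-r<..<r}" "v \<in> {-r<..<r}"
  shows "m \<le> \<bar>AB s t\<bar>" "m \<le> \<bar>AC s v\<bar>" "m \<le> \<bar>BA t s\<bar>" "m \<le> \<bar>BC t v\<bar>" "m \<le> \<bar>CA v s\<bar>" "m \<le> \<bar>CB v t\<bar>"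
    "\<bar>AB s t\<bar> \<le> M" "\<bar>AC s v\<bar> \<le> M" "\<bar>BA t s\<bar> \<le> M" "\<bar>BC t v\<bar> \<le> M" "\<bar>CA v s\<bar> \<le> M" "\<bar>CB v t\<bar> \<le> M"
  using nt assms unfolding nontangent_def by blast+

lemma in_r: "s \<in> {-\<epsilon><..<\<epsilon>} \<Longrightarrow> s \<in> {-r<..<r}"
  using eps by auto

text \<open>The values that \<open>reflected_point_deriv\<close> gives for the partial derivatives
  of \<open>u\<close>: \<open>B t\<close> is the fixed vertex for \<open>us\<close>, and
  \<open>A s\<close> is the fixed vertex for \<open>ut\<close>.\<close>

definition "us s t = - (AB s t * (BC t (u s t))\<^sup>2) / (CB (u s t) t * (BA t s)\<^sup>2)"
definition "ut s t = - (BA t s * (AC s (u s t))\<^sup>2) / (CA (u s t) s * (AB s t)\<^sup>2)"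

context
  fixes s t :: real
  assumes st: "s \<in> {-\<epsilon><..<\<epsilon>}" "t \<in> {-\<epsilon><..<\<epsilon>}"
begin

lemmas nz = nonzero[OF in_r[OF st(1)] in_r[OF st(2)] u_range[OF st]]

lemma u_deriv_t: "((\<lambda>t. u s t) has_real_derivative ut s t) (at t)"
  unfolding ut_def
proof (rule reflected_point_deriv[where J = "{-\<epsilon><..<\<epsilon>}" and r = r and P = "A s"])
  show "cross2 (X s) (A1 s) \<noteq> 0" by (rule fa.transversal[OF in_r[OF st(1)]])
  show "(B has_vector_derivative B1 t) (at t)" by (rule fb.arc_deriv[OF in_r[OF st(2)]])
  show "(C has_vector_derivative C1 v) (at v)" if "v \<in> {-r<..<r}" for v by (rule fc.arc_deriv[OF that])
  show "AC s v \<noteq> 0" "CA v s \<noteq> 0" if "v \<in> {-r<..<r}" for v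
    using nonzero[OF in_r[OF st(1)] in_r[OF st(2)] that] by auto
  show "AB s t \<noteq> 0" "u s t \<in> {-r<..<r}"
    "cross2 (X s) (B t - A s) * AC s (u s t) + cross2 (X s) (C (u s t) - A s) * AB s t = 0"
    if "t \<in> {-\<epsilon><..<\<epsilon>}" for t
    using nonzero[OF in_r[OF st(1)] in_r[OF that] u_range[OF st(1) that]] u_range[OF st(1) that]
      reflA[OF st(1) that] by (auto simp: reflects_def)
qed (use st in auto)

lemma u_deriv_s: "((\<lambda>s. u s t) has_real_derivative us s t) (at s)"
  unfolding us_def
proof (rule reflected_point_deriv[where J = "{-\<epsilon><..<\<epsilon>}" and r = r and P = "B t"])
  show "cross2 (Y t) (B1 t) \<noteq> 0" by (rule fb.transversal[OF in_r[OF st(2)]])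
  show "(A has_vector_derivative A1 s) (at s)" by (rule fa.arc_deriv[OF in_r[OF st(1)]])
  show "(C has_vector_derivative C1 v) (at v)" if "v \<in> {-r<..<r}" for v by (rule fc.arc_deriv[OF that])
  show "BC t v \<noteq> 0" "CB v t \<noteq> 0" if "v \<in> {-r<..<r}" for v
    using nonzero[OF in_r[OF st(1)] in_r[OF st(2)] that] by auto
  show "BA t s \<noteq> 0" "u s t \<in> {-r<..<r}"
    "cross2 (Y t) (A s - B t) * BC t (u s t) + cross2 (Y t) (C (u s t) - B t) * BA t s = 0"
    if "s \<in> {-\<epsilon><..<\<epsilon>}" for s
    using nonzero[OF in_r[OF that] in_r[OF st(2)] u_range[OF that st(2)]] u_range[OF that st(2)]
      reflB[OF that st(2)] by (auto simp: reflects_def)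
qed (use st in auto)

lemma us_ut_nonzero: "us s t \<noteq> 0" "ut s t \<noteq> 0"
  using nz by (auto simp: us_def ut_def)

lemma vderiv_s:
  "((\<lambda>s. A s) has_vector_derivative A1 s) (at s)" "((\<lambda>s. A1 s) has_vector_derivative A2 s) (at s)"
  "((\<lambda>s. C (u s t)) has_vector_derivative us s t *\<^sub>R C1 (u s t)) (at s)"
  "((\<lambda>s. C1 (u s t)) has_vector_derivative us s t *\<^sub>R C2 (u s t)) (at s)"
  "((\<lambda>s. Z (u s t)) has_vector_derivative us s t *\<^sub>R Z1 (u s t)) (at s)"
  using vector_diff_chain_at[OF u_deriv_s[unfolded has_real_derivative_iff_has_vector_derivative]]
    fa.arc_deriv[OF in_r[OF st(1)]] fa.arc_deriv2[OF in_r[OF st(1)]]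
    fc.arc_deriv[OF u_range[OF st]] fc.arc_deriv2[OF u_range[OF st]] fc.frame_deriv[OF u_range[OF st]]
  by (auto simp: o_def)

lemma vderiv_t:
  "((\<lambda>t. B t) has_vector_derivative B1 t) (at t)" "((\<lambda>t. B1 t) has_vector_derivative B2 t) (at t)"
  "((\<lambda>t. C (u s t)) has_vector_derivative ut s t *\<^sub>R C1 (u s t)) (at t)"
  "((\<lambda>t. C1 (u s t)) has_vector_derivative ut s t *\<^sub>R C2 (u s t)) (at t)"
  "((\<lambda>t. Z (u s t)) has_vector_derivative ut s t *\<^sub>R Z1 (u s t)) (at t)"
  using vector_diff_chain_at[OF u_deriv_t[unfolded has_real_derivative_iff_has_vector_derivative]]
    fb.arc_deriv[OF in_r[OF st(2)]] fb.arc_deriv2[OF in_r[OF st(2)]]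
    fc.arc_deriv[OF u_range[OF st]] fc.arc_deriv2[OF u_range[OF st]] fc.frame_deriv[OF u_range[OF st]]
  by (auto simp: o_def)

lemmas tau_deriv_s =
  tau_deriv[OF vderiv_s(1) vderiv_s(2) has_vector_derivative_const[of "B t"]]
  tau_deriv[OF vderiv_s(1) vderiv_s(2) vderiv_s(3)]
  tau_deriv[OF has_vector_derivative_const[of "B t"] has_vector_derivative_const[of "B1 t"] vderiv_s(1)]
  tau_deriv[OF has_vector_derivative_const[of "B t"] has_vector_derivative_const[of "B1 t"] vderiv_s(3)]
  tau_deriv[OF vderiv_s(3) vderiv_s(4) vderiv_s(1)]
  tau_deriv[OF vderiv_s(3) vderiv_s(4) has_vector_derivative_const[of "B t"]]

lemmas tau_deriv_t =
  tau_deriv[OF has_vector_derivative_const[of "A s"] has_vector_derivative_const[of "A1 s"] vderiv_t(1)]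
  tau_deriv[OF has_vector_derivative_const[of "A s"] has_vector_derivative_const[of "A1 s"] vderiv_t(3)]
  tau_deriv[OF vderiv_t(1) vderiv_t(2) has_vector_derivative_const[of "A s"]]
  tau_deriv[OF vderiv_t(1) vderiv_t(2) vderiv_t(3)]
  tau_deriv[OF vderiv_t(3) vderiv_t(4) has_vector_derivative_const[of "A s"]]
  tau_deriv[OF vderiv_t(3) vderiv_t(4) vderiv_t(1)]

lemma deriv_s:
  "((\<lambda>s. AB s t) has_real_derivative cross2 (A2 s) (B t - A s)) (at s)"
  "((\<lambda>s. AC s (u s t)) has_real_derivative
    cross2 (A2 s) (C (u s t) - A s) + us s t * cross2 (A1 s) (C1 (u s t))) (at s)"
  "((\<lambda>s. BA t s) has_real_derivative cross2 (B1 t) (A1 s)) (at s)"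
  "((\<lambda>s. BC t (u s t)) has_real_derivative us s t * cross2 (B1 t) (C1 (u s t))) (at s)"
  "((\<lambda>s. CA (u s t) s) has_real_derivative
    us s t * cross2 (C2 (u s t)) (A s - C (u s t)) + cross2 (C1 (u s t)) (A1 s)) (at s)"
  "((\<lambda>s. CB (u s t) t) has_real_derivative us s t * cross2 (C2 (u s t)) (B t - C (u s t))) (at s)"
  using tau_deriv_s
  by (simp_all add: cross2.diff_right cross2.scaleR_right cross2.scaleR_left cross2.minus_right algebra_simps)

lemma deriv_t:
  "((\<lambda>t. AB s t) has_real_derivative cross2 (A1 s) (B1 t)) (at t)"
  "((\<lambda>t. AC s (u s t)) has_real_derivative ut s t * cross2 (A1 s) (C1 (u s t))) (at t)"
  "((\<lambda>t. BA t s) has_real_derivative cross2 (B2 t) (A s - B t)) (at t)"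
  "((\<lambda>t. BC t (u s t)) has_real_derivative
    cross2 (B2 t) (C (u s t) - B t) + ut s t * cross2 (B1 t) (C1 (u s t))) (at t)"
  "((\<lambda>t. CA (u s t) s) has_real_derivative ut s t * cross2 (C2 (u s t)) (A s - C (u s t))) (at t)"
  "((\<lambda>t. CB (u s t) t) has_real_derivative
    ut s t * cross2 (C2 (u s t)) (B t - C (u s t)) + cross2 (C1 (u s t)) (B1 t)) (at t)"
  using tau_deriv_t
  by (simp_all add: cross2.diff_right cross2.scaleR_right cross2.scaleR_left cross2.minus_right algebra_simps)

text \<open>At the third vertex position, tangent and frame all move with \<open>u\<close>. Their
  contribution to the derivative of the law is \<open>us\<close> or \<open>ut\<close> times the same
  coefficient \<open>E\<close>, whichever variable moves. Eliminating \<open>E\<close> removes the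
  frame, its derivative and the curvature at \<open>C\<close>.\<close>

lemma us_ut_relation:
  "us s t * (BC t (u s t) * (CA (u s t) s)\<^sup>2) = ut s t * (AC s (u s t) * (CB (u s t) t)\<^sup>2)"
proof -
  let ?v = "u s t"
  define ZA ZB where "ZA = cross2 (Z ?v) (A s - C ?v)" and "ZB = cross2 (Z ?v) (B t - C ?v)"
  define \<kappa> where "\<kappa> = cross2 (Z ?v) (C1 ?v)"
  have \<kappa>: "\<kappa> \<noteq> 0" unfolding \<kappa>_def by (rule fc.transversal[OF u_range[OF st]])
  have harm: "ZA * CB ?v t + ZB * CA ?v s = 0"
    using reflC[OF st] by (simp add: reflects_def ZA_def ZB_def)
  define E where "E = (cross2 (Z1 ?v) (A s - C ?v) - \<kappa>) * CB ?v t + ZA * cross2 (C2 ?v) (B t - C ?v)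
    + (cross2 (Z1 ?v) (B t - C ?v) - \<kappa>) * CA ?v s + ZB * cross2 (C2 ?v) (A s - C ?v)"
  have const: "d = 0" if d: "(f has_real_derivative d) (at x)" and x: "x \<in> {-\<epsilon><..<\<epsilon>}"
    and f: "\<And>y. y \<in> {-\<epsilon><..<\<epsilon>} \<Longrightarrow> f y = 0" for f d x
  proof -
    have "((\<lambda>_. 0::real) has_real_derivative d) (at x)"
      using has_field_derivative_transform_within_open[OF d _ x, of "\<lambda>_. 0"] f by auto
    from DERIV_unique[OF this DERIV_const] show ?thesis .
  qed
  have s_eq: "us s t * E + cross2 (Z ?v) (A1 s) * CB ?v t + ZB * cross2 (C1 ?v) (A1 s) = 0"
  proof (rule const[OF _ st(1)])
    have "((\<lambda>s. cross2 (Z (u s t)) (A s - C (u s t)) * CB (u s t) t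
        + cross2 (Z (u s t)) (B t - C (u s t)) * CA (u s t) s) has_real_derivative
      (cross2 (Z ?v) (A1 s - us s t *\<^sub>R C1 ?v) + cross2 (us s t *\<^sub>R Z1 ?v) (A s - C ?v)) * CB ?v t
      + (us s t * cross2 (C2 ?v) (B t - C ?v)) * ZA
      + ((cross2 (Z ?v) (0 - us s t *\<^sub>R C1 ?v) + cross2 (us s t *\<^sub>R Z1 ?v) (B t - C ?v)) * CA ?v s
      + (us s t * cross2 (C2 ?v) (A s - C ?v) + cross2 (C1 ?v) (A1 s)) * ZB)) (at s)"
      unfolding ZA_def ZB_def
      by (intro DERIV_add DERIV_mult deriv_s tau_deriv vderiv_s has_vector_derivative_const)
    then show "((\<lambda>s. cross2 (Z (u s t)) (A s - C (u s t)) * CB (u s t) t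
        + cross2 (Z (u s t)) (B t - C (u s t)) * CA (u s t) s) has_real_derivative
      us s t * E + cross2 (Z ?v) (A1 s) * CB ?v t + ZB * cross2 (C1 ?v) (A1 s)) (at s)"
      by (rule DERIV_cong)
        (simp add: E_def \<kappa>_def cross2.diff_right cross2.minus_right cross2.scaleR_right cross2.scaleR_left algebra_simps)
    show "cross2 (Z (u s t)) (A s - C (u s t)) * CB (u s t) t
        + cross2 (Z (u s t)) (B t - C (u s t)) * CA (u s t) s = 0" if "s \<in> {-\<epsilon><..<\<epsilon>}" for s
      using reflC[OF that st(2)] by (simp add: reflects_def)
  qed
  have t_eq: "ut s t * E + cross2 (Z ?v) (B1 t) * CA ?v s + ZA * cross2 (C1 ?v) (B1 t) = 0"
  proof (rule const[OF _ st(2)])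
    have "((\<lambda>t. cross2 (Z (u s t)) (A s - C (u s t)) * CB (u s t) t
        + cross2 (Z (u s t)) (B t - C (u s t)) * CA (u s t) s) has_real_derivative
      (cross2 (Z ?v) (0 - ut s t *\<^sub>R C1 ?v) + cross2 (ut s t *\<^sub>R Z1 ?v) (A s - C ?v)) * CB ?v t
      + (ut s t * cross2 (C2 ?v) (B t - C ?v) + cross2 (C1 ?v) (B1 t)) * ZA
      + ((cross2 (Z ?v) (B1 t - ut s t *\<^sub>R C1 ?v) + cross2 (ut s t *\<^sub>R Z1 ?v) (B t - C ?v)) * CA ?v s
      + (ut s t * cross2 (C2 ?v) (A s - C ?v)) * ZB)) (at t)"
      unfolding ZA_def ZB_def
      by (intro DERIV_add DERIV_mult deriv_t tau_deriv vderiv_t has_vector_derivative_const)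
    then show "((\<lambda>t. cross2 (Z (u s t)) (A s - C (u s t)) * CB (u s t) t
        + cross2 (Z (u s t)) (B t - C (u s t)) * CA (u s t) s) has_real_derivative
      ut s t * E + cross2 (Z ?v) (B1 t) * CA ?v s + ZA * cross2 (C1 ?v) (B1 t)) (at t)"
      by (rule DERIV_cong)
        (simp add: E_def \<kappa>_def cross2.diff_right cross2.minus_right cross2.scaleR_right cross2.scaleR_left algebra_simps)
    show "cross2 (Z (u s t)) (A s - C (u s t)) * CB (u s t) t
        + cross2 (Z (u s t)) (B t - C (u s t)) * CA (u s t) s = 0" if "t \<in> {-\<epsilon><..<\<epsilon>}" for t
      using reflC[OF st(1) that] by (simp add: reflects_def)
  qed
  \<comment> \<open>The Pluecker relation combines the remaining terms, after the law itself has
    been used to trade one product for the other, into a multiple of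
    \<open>\<kappa>\<close>.\<close>
  have pl: "cross2 (Z ?v) a * cross2 (C1 ?v) w - cross2 (Z ?v) w * cross2 (C1 ?v) a = \<kappa> * cross2 a w" for a w
    by (simp add: \<kappa>_def cross2_def algebra_simps)
  have "us s t * E * CA ?v s + CB ?v t * (\<kappa> * cross2 (A1 s) (A s - C ?v)) = 0"
    using s_eq harm unfolding pl[symmetric] ZA_def[symmetric] by algebra
  moreover have "cross2 (A1 s) (A s - C ?v) = - AC s ?v" by (simp add: cross2_def algebra_simps)
  ultimately have 1: "us s t * E * CA ?v s = CB ?v t * \<kappa> * AC s ?v" by simp
  have "ut s t * E * CB ?v t + CA ?v s * (\<kappa> * cross2 (B1 t) (B t - C ?v)) = 0"
    using t_eq harm unfolding pl[symmetric] ZB_def[symmetric] by algebra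
  moreover have "cross2 (B1 t) (B t - C ?v) = - BC t ?v" by (simp add: cross2_def algebra_simps)
  ultimately have 2: "ut s t * E * CB ?v t = CA ?v s * \<kappa> * BC t ?v" by simp
  \<comment> \<open>The right side of \<open>1\<close> is a product of nonzero factors.\<close>
  have "E \<noteq> 0" using 1 \<kappa> nz by auto
  moreover have "E * (us s t * (BC t ?v * (CA ?v s)\<^sup>2)) = E * (ut s t * (AC s ?v * (CB ?v t)\<^sup>2))"
    using 1 2 by algebra
  ultimately show ?thesis using mult_left_cancel by blast
qed

text \<open>Inserting the explicit \<open>us\<close> and \<open>ut\<close> into the relation at
  \<open>C\<close> leaves an equality of two cubes. For noncollinear vertices the result says that
  the tangents at the vertices meet the opposite sides in three collinear points.\<close>

lemma menelaus:
  "AC s (u s t) * BA t s * CB (u s t) t = AB s t * BC t (u s t) * CA (u s t) s"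
proof -
  have cube: "a = b" if "a ^ 3 = b ^ 3" for a b :: real
    using that odd_real_root_power_cancel[of 3] by (metis odd_numeral)
  have *: "(ac * ba * cb) ^ 3 = (ab * bc * ca) ^ 3"
    if "- (ab * bc\<^sup>2) / (cb * ba\<^sup>2) * (bc * ca\<^sup>2) = - (ba * ac\<^sup>2) / (ca * ab\<^sup>2) * (ac * cb\<^sup>2)"
      and "ab \<noteq> 0" "ba \<noteq> 0" "ca \<noteq> 0" "cb \<noteq> 0" for ab ac ba bc ca cb :: real
  proof -
    have "(ab * bc\<^sup>2 * (bc * ca\<^sup>2)) * (ca * ab\<^sup>2) = (ba * ac\<^sup>2 * (ac * cb\<^sup>2)) * (cb * ba\<^sup>2)"
      using that by (simp add: field_simps)
    then show ?thesis by (simp add: power2_eq_square power3_eq_cube algebra_simps)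
  qed
  show ?thesis
    by (rule cube, rule *[OF us_ut_relation[unfolded us_def ut_def]]) (use nz in auto)
qed

end

text \<open>The derivative of \<open>us\<close> in \<open>t\<close>, in the form delivered by
  \<open>DERIV_log_quotient\<close>; \<open>uts\<close> is its counterpart for \<open>ut\<close> in
  \<open>s\<close>.\<close>

definition "ust s t = us s t * (cross2 (A1 s) (B1 t) / AB s t
  + 2 * ((cross2 (B2 t) (C (u s t) - B t) + ut s t * cross2 (B1 t) (C1 (u s t))) / BC t (u s t))
  - (ut s t * cross2 (C2 (u s t)) (B t - C (u s t)) + cross2 (C1 (u s t)) (B1 t)) / CB (u s t) t
  - 2 * (cross2 (B2 t) (A s - B t) / BA t s))"

definition "uts s t = ut s t * (cross2 (B1 t) (A1 s) / BA t s
  + 2 * ((cross2 (A2 s) (C (u s t) - A s) + us s t * cross2 (A1 s) (C1 (u s t))) / AC s (u s t))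
  - (us s t * cross2 (C2 (u s t)) (A s - C (u s t)) + cross2 (C1 (u s t)) (A1 s)) / CA (u s t) s
  - 2 * (cross2 (A2 s) (B t - A s) / AB s t))"

lemma u_bound:
  assumes st: "s \<in> {-\<epsilon><..<\<epsilon>}" "t \<in> {-\<epsilon><..<\<epsilon>}"
  shows "\<bar>us s t\<bar> \<le> (M * M\<^sup>2) / (m * m\<^sup>2)" "\<bar>ut s t\<bar> \<le> (M * M\<^sup>2) / (m * m\<^sup>2)"
proof -
  note b = bounds[OF in_r[OF st(1)] in_r[OF st(2)] u_range[OF st]]
  have *: "\<bar>- (x * y\<^sup>2) / (z * w\<^sup>2)\<bar> \<le> (M * M\<^sup>2) / (m * m\<^sup>2)"
    if "\<bar>x\<bar> \<le> M" "\<bar>y\<bar> \<le> M" "m \<le> \<bar>z\<bar>" "m \<le> \<bar>w\<bar>" for x y z w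
    unfolding abs_divide abs_mult abs_minus power_abs
    using that m_pos by (intro frac_le mult_mono power_mono) auto
  show "\<bar>us s t\<bar> \<le> (M * M\<^sup>2) / (m * m\<^sup>2)" "\<bar>ut s t\<bar> \<le> (M * M\<^sup>2) / (m * m\<^sup>2)"
    unfolding us_def ut_def by (rule *; rule b)+
qed

text \<open>Separate differentiability alone would not give joint continuity of \<open>u\<close>.
  Bounds on both partial derivatives that are uniform on the square do, by moving along one axis at
  a time.\<close>

lemma u_lipschitz:
  assumes "s \<in> {-\<epsilon><..<\<epsilon>}" "t \<in> {-\<epsilon><..<\<epsilon>}" "s' \<in> {-\<epsilon><..<\<epsilon>}" "t' \<in> {-\<epsilon><..<\<epsilon>}"
  shows "\<bar>u s t - u s' t'\<bar> \<le> (M * M\<^sup>2) / (m * m\<^sup>2) * (\<bar>s - s'\<bar> + \<bar>t - t'\<bar>)"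
proof -
  let ?K = "(M * M\<^sup>2) / (m * m\<^sup>2)"
  have "norm (u s t - u s' t) \<le> ?K * norm (s - s')"
    by (rule field_differentiable_bound[where S = "{-\<epsilon><..<\<epsilon>}" and f' = "\<lambda>s. us s t" and f = "\<lambda>s. u s t"])
      (use assms u_bound u_deriv_s in \<open>auto intro: has_field_derivative_at_within\<close>)
  moreover have "norm (u s' t - u s' t') \<le> ?K * norm (t - t')"
    by (rule field_differentiable_bound[where S = "{-\<epsilon><..<\<epsilon>}" and f' = "\<lambda>t. ut s' t" and f = "\<lambda>t. u s' t"])
      (use assms u_bound u_deriv_t in \<open>auto intro: has_field_derivative_at_within\<close>)
  ultimately show ?thesis by (simp add: distrib_left)
qed

context
  fixes s t :: real
  assumes st: "s \<in> {-\<epsilon><..<\<epsilon>}" "t \<in> {-\<epsilon><..<\<epsilon>}"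
begin

lemma isCont_u: "isCont (\<lambda>p. u (fst p) (snd p)) (s, t)"
proof -
  let ?K = "(M * M\<^sup>2) / (m * m\<^sup>2)"
  have "((\<lambda>p. ?K * (\<bar>fst p - s\<bar> + \<bar>snd p - t\<bar>)) \<longlongrightarrow> ?K * (\<bar>fst (s, t) - s\<bar> + \<bar>snd (s, t) - t\<bar>)) (at (s, t))"
    by (intro tendsto_intros)
  then have "((\<lambda>p. ?K * (\<bar>fst p - s\<bar> + \<bar>snd p - t\<bar>)) \<longlongrightarrow> 0) (at (s, t))" by simp
  moreover have "\<forall>\<^sub>F p in at (s, t). norm (u (fst p) (snd p) - u s t) \<le> ?K * (\<bar>fst p - s\<bar> + \<bar>snd p - t\<bar>)"
  proof -
    have "\<forall>\<^sub>F p in at (s, t). p \<in> {-\<epsilon><..<\<epsilon>} \<times> {-\<epsilon><..<\<epsilon>}"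
      using st by (intro eventually_at_in_open') (auto intro: open_Times)
    then show ?thesis
      by eventually_elim (use u_lipschitz st in auto)
  qed
  ultimately have "((\<lambda>p. u (fst p) (snd p) - u s t) \<longlongrightarrow> 0) (at (s, t))"
    by (rule Lim_null_comparison[rotated])
  then show ?thesis by (simp add: isCont_def LIM_zero_iff)
qed

lemma isCont_arcs:
  "isCont (\<lambda>p. A (fst p)) (s, t)" "isCont (\<lambda>p. A1 (fst p)) (s, t)" "isCont (\<lambda>p. A2 (fst p)) (s, t)"
  "isCont (\<lambda>p. B (snd p)) (s, t)" "isCont (\<lambda>p. B1 (snd p)) (s, t)" "isCont (\<lambda>p. B2 (snd p)) (s, t)"
  "isCont (\<lambda>p. C (u (fst p) (snd p))) (s, t)" "isCont (\<lambda>p. C1 (u (fst p) (snd p))) (s, t)"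
  "isCont (\<lambda>p. C2 (u (fst p) (snd p))) (s, t)"
proof -
  note vc = has_vector_derivative_continuous
  have 1: "isCont (\<lambda>p. f (fst p)) (s, t)" if "isCont f s" for f :: "real \<Rightarrow> real^2"
    by (rule isCont_o2[where f = fst and g = f]) (use that in simp_all)
  have 2: "isCont (\<lambda>p. f (snd p)) (s, t)" if "isCont f t" for f :: "real \<Rightarrow> real^2"
    by (rule isCont_o2[where f = snd and g = f]) (use that in simp_all)
  have 3: "isCont (\<lambda>p. f (u (fst p) (snd p))) (s, t)" if "isCont f (u s t)" for f :: "real \<Rightarrow> real^2"
    by (rule isCont_o2[where g = f, OF isCont_u]) (use that in simp)
  show "isCont (\<lambda>p. A (fst p)) (s, t)" "isCont (\<lambda>p. A1 (fst p)) (s, t)" "isCont (\<lambda>p. A2 (fst p)) (s, t)"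
    by (intro 1 vc[OF fa.arc_deriv] vc[OF fa.arc_deriv2] fa.arc_cont2 in_r st)+
  show "isCont (\<lambda>p. B (snd p)) (s, t)" "isCont (\<lambda>p. B1 (snd p)) (s, t)" "isCont (\<lambda>p. B2 (snd p)) (s, t)"
    by (intro 2 vc[OF fb.arc_deriv] vc[OF fb.arc_deriv2] fb.arc_cont2 in_r st)+
  show "isCont (\<lambda>p. C (u (fst p) (snd p))) (s, t)" "isCont (\<lambda>p. C1 (u (fst p) (snd p))) (s, t)"
    "isCont (\<lambda>p. C2 (u (fst p) (snd p))) (s, t)"
    by (intro 3 vc[OF fc.arc_deriv] vc[OF fc.arc_deriv2] fc.arc_cont2 u_range st)+
qed

lemma isCont_mixed:
  "isCont (\<lambda>p. ust (fst p) (snd p)) (s, t)" "isCont (\<lambda>p. uts (fst p) (snd p)) (s, t)"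
proof -
  note n = nz[OF st]
  have c: "isCont (\<lambda>p. us (fst p) (snd p)) (s, t)" "isCont (\<lambda>p. ut (fst p) (snd p)) (s, t)"
    unfolding us_def ut_def using n by (intro continuous_intros isCont_arcs; simp)+
  show "isCont (\<lambda>p. ust (fst p) (snd p)) (s, t)"
    unfolding ust_def using n by (intro continuous_intros isCont_arcs c) simp_all
  show "isCont (\<lambda>p. uts (fst p) (snd p)) (s, t)"
    unfolding uts_def using n by (intro continuous_intros isCont_arcs c) simp_all
qed

lemma mixed_partials: "ust s t = uts s t"
proof -
  define e where "e = min (\<epsilon> - \<bar>s\<bar>) (\<epsilon> - \<bar>t\<bar>)"
  have e: "e > 0" using st by (auto simp: e_def)
  have in_eps: "s' \<in> {-\<epsilon><..<\<epsilon>}" "t' \<in> {-\<epsilon><..<\<epsilon>}" if "\<bar>s' - s\<bar> < e" "\<bar>t' - t\<bar> < e" for s' t'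
    using that by (auto simp: e_def)
  show ?thesis
  proof (rule mixed_partials_eq[OF e, where u = u and p = us and q = ut and pt = ust and qs = uts])
    fix s' t' assume "\<bar>s' - s\<bar> < e" "\<bar>t' - t\<bar> < e"
    note i = in_eps[OF this]
    show "((\<lambda>s. u s t') has_real_derivative us s' t') (at s')" by (rule u_deriv_s[OF i])
    show "((\<lambda>t. u s' t) has_real_derivative ut s' t') (at t')" by (rule u_deriv_t[OF i])
    show "((\<lambda>t. us s' t) has_real_derivative ust s' t') (at t')"
      unfolding us_def[abs_def] ust_def us_def[of s' t']
      using nz[OF i] by (intro DERIV_log_quotient deriv_t[OF i])
    show "((\<lambda>s. ut s t') has_real_derivative uts s' t') (at s')"
      unfolding ut_def[abs_def] uts_def ut_def[of s' t']
      using nz[OF i] by (intro DERIV_log_quotient deriv_s[OF i])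
  qed (rule isCont_mixed)+
qed

text \<open>Noncollinear vertices supply the coordinate triangle of
  \<open>curvatures_vanish\<close>. Its remaining inputs hold at every orbit of the family.\<close>

lemma curvature_zero:
  assumes "cross2 (B t - A s) (C (u s t) - A s) \<noteq> 0"
  shows "cross2 (A1 s) (A2 s) = 0" "cross2 (B1 t) (B2 t) = 0" "cross2 (C1 (u s t)) (C2 (u s t)) = 0"
proof -
  note n = nz[OF st]
  have Gs: "(cross2 (A2 s) (C (u s t) - A s) + us s t * cross2 (A1 s) (C1 (u s t))) / AC s (u s t)
        + cross2 (B1 t) (A1 s) / BA t s + us s t * cross2 (C2 (u s t)) (B t - C (u s t)) / CB (u s t) t
      = cross2 (A2 s) (B t - A s) / AB s t + us s t * cross2 (B1 t) (C1 (u s t)) / BC t (u s t)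
        + (us s t * cross2 (C2 (u s t)) (A s - C (u s t)) + cross2 (C1 (u s t)) (A1 s)) / CA (u s t) s"
    by (rule log_derivative_of_product_eq[OF deriv_s(2)[OF st] deriv_s(3)[OF st] deriv_s(6)[OF st]
          deriv_s(1)[OF st] deriv_s(4)[OF st] deriv_s(5)[OF st], where S = "{-\<epsilon><..<\<epsilon>}"])
      (use n st menelaus in auto)
  have Gt: "ut s t * cross2 (A1 s) (C1 (u s t)) / AC s (u s t) + cross2 (B2 t) (A s - B t) / BA t s
        + (ut s t * cross2 (C2 (u s t)) (B t - C (u s t)) + cross2 (C1 (u s t)) (B1 t)) / CB (u s t) t
      = cross2 (A1 s) (B1 t) / AB s t
        + (cross2 (B2 t) (C (u s t) - B t) + ut s t * cross2 (B1 t) (C1 (u s t))) / BC t (u s t)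
        + ut s t * cross2 (C2 (u s t)) (A s - C (u s t)) / CA (u s t) s"
    by (rule log_derivative_of_product_eq[OF deriv_t(2)[OF st] deriv_t(3)[OF st] deriv_t(6)[OF st]
          deriv_t(1)[OF st] deriv_t(4)[OF st] deriv_t(5)[OF st], where S = "{-\<epsilon><..<\<epsilon>}"])
      (use n st menelaus in auto)
  show "cross2 (A1 s) (A2 s) = 0" "cross2 (B1 t) (B2 t) = 0" "cross2 (C1 (u s t)) (C2 (u s t)) = 0"
    using curvatures_vanish[OF assms n(1,2,3,4,5,6) us_def ut_def menelaus[OF st] Gs Gt
        mixed_partials[unfolded ust_def uts_def, symmetric]] .
qed

end

end

section \<open>Germs of right-spherical billiards\<close>

lemma join_commute: "join P Q = join Q P"
  by (simp add: join_def Un_commute)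

text \<open>Both sides are planes, so one inclusion suffices, and it amounts to \<open>q\<close>
  lying on the line.\<close>

lemma join_affine_span_eq:
  assumes "cprod (A, 1) q \<noteq> 0" "w \<noteq> 0"
  shows "line_through A (span {w}) = join (affine_point A) (span {q}) \<longleftrightarrow> covec A w \<bullet> q = 0"
proof -
  have j: "join (affine_point A) (span {q}) = span {(A, 1), q}"
    by (simp add: affine_point_def join_span)
  show ?thesis
  proof
    assume "line_through A (span {w}) = join (affine_point A) (span {q})"
    then have "q \<in> {v. covec A w \<bullet> v = 0}"
      unfolding j line_through_eq[OF assms(2)] by (auto intro: span_base)
    then show "covec A w \<bullet> q = 0" by simp
  next
    assume q: "covec A w \<bullet> q = 0"
    have "span {(A, 1), q} \<subseteq> {v. covec A w \<bullet> v = 0}"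
      using q by (intro span_minimal subspace_hyperplane) (simp add: covec_base)
    moreover have "dim (span {(A, 1), q}) = dim {v. covec A w \<bullet> v = 0}"
      unfolding span2_eq_hyperplane[OF assms(1)]
      using assms covec_nonzero by (simp add: dim_hyperplane)
    ultimately show "line_through A (span {w}) = join (affine_point A) (span {q})"
      unfolding j line_through_eq[OF assms(2)]
      using subspace_dim_equal[OF subspace_span subspace_hyperplane] by (metis order_refl)
  qed
qed

lemma line_through_inj:
  assumes "v \<noteq> 0" "w \<noteq> 0" "line_through A (span {v}) = line_through A (span {w})"
  shows "span {v} = span {w}"
  using assms by (simp add: line_through_eq pencil_line_eq_iff span_singleton_eq_iff)

text \<open>Membership turns into two linear equations. The condition
  \<open>n \<bullet> q \<noteq> 0\<close> keeps \<open>q\<close> off the base line, hence distinct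
  from every \<open>A\<close> on it, so that the join really is a line.\<close>

lemma in_omega_iff:
  assumes "n \<bullet> q \<noteq> 0"
  shows "(A, span {w}) \<in> omega {v. n \<bullet> v = 0} (span {q}) \<longleftrightarrow>
    w \<noteq> 0 \<and> n \<bullet> (A, 1) = 0 \<and> covec A w \<bullet> q = 0"
proof -
  have 1: "(A, span {w}) \<in> PT \<longleftrightarrow> w \<noteq> 0" by (simp add: PT_def dim_singleton)
  have 2: "affine_point A \<subseteq> {v. n \<bullet> v = 0} \<longleftrightarrow> n \<bullet> (A, 1) = 0"
  proof
    assume "affine_point A \<subseteq> {v. n \<bullet> v = 0}"
    moreover have "(A, 1) \<in> affine_point A" unfolding affine_point_def by (rule span_base) simp
    ultimately show "n \<bullet> (A, 1) = 0" by blast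
  next
    assume "n \<bullet> (A, 1) = 0"
    then show "affine_point A \<subseteq> {v. n \<bullet> v = 0}" unfolding affine_point_def
      by (intro span_minimal subspace_hyperplane) simp
  qed
  have 3: "cprod (A, 1) q \<noteq> 0" if "n \<bullet> (A, 1) = 0"
  proof
    assume "cprod (A, 1) q = 0"
    moreover have "(A, 1) \<noteq> (0 :: hvec)" by (simp add: zero_prod_def)
    ultimately obtain k where "q = k *\<^sub>R (A, 1)" using cprod_eq_0D by blast
    then have "n \<bullet> q = k * (n \<bullet> (A, 1))" by (simp only: inner_scaleR_right)
    then show False using that assms by simp
  qed
  show ?thesis
    unfolding omega_def using 1 2 join_affine_span_eq[OF 3] by auto
qed

context framed_arc
begin

lemma frame_nonzero: "s \<in> {-r<..<r} \<Longrightarrow> X s \<noteq> 0"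
  and velocity_nonzero: "s \<in> {-r<..<r} \<Longrightarrow> A1 s \<noteq> 0"
  using transversal by fastforce+

text \<open>All lines involved belong to the pencil at \<open>A s\<close> and are kernels of
  \<open>covec (A s)\<close>, so the orbit condition becomes polynomial. Distinctness from the
  neighbours is contained in nontangency.\<close>

lemma reflection_at_vertex_iff:
  assumes s: "s \<in> {-r<..<r}"
  defines "T \<equiv> line_through (A s) (tangent_space (classical_boundary \<alpha>) (A s))"
  shows "(A s \<noteq> P \<and> A s \<noteq> Q \<and> join (affine_point P) (affine_point (A s)) \<noteq> T \<and>
      join (affine_point (A s)) (affine_point Q) \<noteq> T \<and>
      symmetric_lines (line_through (A s) (span {X s})) T
        (join (affine_point P) (affine_point (A s))) (join (affine_point (A s)) (affine_point Q)))
    \<longleftrightarrow> cross2 (A1 s) (P - A s) \<noteq> 0 \<and> cross2 (A1 s) (Q - A s) \<noteq> 0 \<and> reflects (X s) (A1 s) (A s) P Q"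
    (is "?lhs \<longleftrightarrow> ?rhs")
proof (cases "A s = P \<or> A s = Q")
  case True
  then show ?thesis by auto
next
  case False
  then have PQ: "A s \<noteq> P" "A s \<noteq> Q" "P - A s \<noteq> 0" "Q - A s \<noteq> 0" by auto
  note nz = frame_nonzero[OF s] velocity_nonzero[OF s]
  have T: "T = {v. covec (A s) (A1 s) \<bullet> v = 0}"
    unfolding T_def tangent[OF s] by (rule line_through_eq[OF nz(2)])
  have L: "line_through (A s) (span {X s}) = {v. covec (A s) (X s) \<bullet> v = 0}"
    by (rule line_through_eq[OF nz(1)])
  have l: "join (affine_point P) (affine_point (A s)) = {v. covec (A s) (P - A s) \<bullet> v = 0}"
    "join (affine_point (A s)) (affine_point Q) = {v. covec (A s) (Q - A s) \<bullet> v = 0}"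
    using join_affine_eq PQ by (simp_all add: join_commute[of "affine_point P"])
  have e: "{v. covec (A s) (P - A s) \<bullet> v = 0} = T \<longleftrightarrow> cross2 (A1 s) (P - A s) = 0"
    "{v. covec (A s) (Q - A s) \<bullet> v = 0} = T \<longleftrightarrow> cross2 (A1 s) (Q - A s) = 0"
    unfolding T using pencil_line_eq_iff nz PQ cross2_commute[of "A1 s"] by auto
  show ?thesis
    unfolding l L e using PQ symmetric_pencil_lines_iff[OF transversal[OF s], of "P - A s" "Q - A s" "A s"]
    unfolding T reflects_def by auto
qed

text \<open>The equations put the arc into \<open>omega\<close>. For the reverse inclusion the arc
  must cover a whole interval of the line, which follows because its projection \<open>f\<close>
  onto the initial velocity is strictly increasing.\<close>

lemma same_germ_omega:
  assumes \<delta>: "0 < \<delta>" "\<delta> \<le> r" and n: "n = covec (A 0) (A1 0)"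
    and on_line: "\<And>s. s \<in> {-\<delta><..<\<delta>} \<Longrightarrow> n \<bullet> (A s, 1) = 0"
    and through: "\<And>s. s \<in> {-\<delta><..<\<delta>} \<Longrightarrow> covec (A s) (X s) \<bullet> q = 0"
    and q: "n \<bullet> q \<noteq> 0"
  shows "same_germ b \<alpha> (omega {v. n \<bullet> v = 0} (span {q}))"
proof -
  let ?e = "A1 0"
  have e0: "?e \<noteq> 0" using velocity_nonzero radius_pos by simp
  have r0: "0 \<in> {-r<..<r}" using radius_pos by simp
  have "isCont (\<lambda>s. ?e \<bullet> A1 s) 0"
    by (intro continuous_intros has_vector_derivative_continuous[OF arc_deriv2[OF r0]])
  moreover have "?e \<bullet> A1 0 > 0" using e0 by simp
  ultimately have "\<forall>\<^sub>F s in nhds 0. ?e \<bullet> A1 s > 0"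
    by (metis isCont_def tendsto_at_iff_tendsto_nhds order_tendstoD(1))
  then obtain d where d: "d > 0" "\<And>s. dist s 0 < d \<Longrightarrow> ?e \<bullet> A1 s > 0"
    unfolding eventually_nhds_metric by blast
  define \<eta> where "\<eta> = min \<delta> d"
  have \<eta>: "\<eta> > 0" "\<eta> \<le> r" "\<eta> \<le> \<delta>" using \<delta> d(1) by (auto simp: \<eta>_def)
  define f where "f s = ?e \<bullet> (A s - A 0)" for s
  have fd: "(f has_real_derivative ?e \<bullet> A1 s) (at s)" if "s \<in> {-r<..<r}" for s
  proof -
    have "((\<lambda>s. A s - A 0) has_vector_derivative A1 s - 0) (at s)"
      by (intro derivative_intros arc_deriv that)
    from bounded_linear.has_vector_derivative[OF bounded_linear_inner_right this, of ?e]
    show ?thesis by (simp add: f_def[abs_def] has_real_derivative_iff_has_vector_derivative)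
  qed
  have pos: "?e \<bullet> A1 s > 0" if "s \<in> {-\<eta><..<\<eta>}" for s
    using that by (intro d(2)) (auto simp: \<eta>_def dist_real_def)
  have mono: "f x < f y" if "x \<in> {-\<eta><..<\<eta>}" "y \<in> {-\<eta><..<\<eta>}" "x < y" for x y
    using that \<eta> by (intro DERIV_pos_imp_increasing[OF that(3)]) (auto intro!: exI[of _ "?e \<bullet> A1 _"] fd pos)
  have f0: "f 0 = 0" by (simp add: f_def)
  have "f (- \<eta> / 2) < f 0" "f 0 < f (\<eta> / 2)" using mono[of "- \<eta> / 2" 0] mono[of 0 "\<eta> / 2"] \<eta> by auto
  then have fsign: "f (- \<eta> / 2) < 0" "0 < f (\<eta> / 2)" unfolding f0 .
  have surj: "\<exists>s\<in>{-\<eta><..<\<eta>}. f s = y" if "f (- \<eta> / 2) < y" "y < f (\<eta> / 2)" for y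
  proof -
    have "\<exists>s\<ge>- \<eta> / 2. s \<le> \<eta> / 2 \<and> f s = y"
      using that \<eta> by (intro IVT) (auto intro!: DERIV_isCont fd)
    then show ?thesis using \<eta> by force
  qed
  obtain W where W: "open W" "A 0 \<in> W"
      "\<And>x. x \<in> \<alpha> \<Longrightarrow> fst x \<in> W \<Longrightarrow> \<exists>s\<in>{-\<eta><..<\<eta>}. x = (A s, span {X s})"
    using nbhd[OF \<eta>(1,2)] by blast
  \<comment> \<open>The slab admits only points of the line whose projection is attained on the arc,
    by the intermediate value theorem between \<open>- \<eta> / 2\<close> and
    \<open>\<eta> / 2\<close>.\<close>
  define W' where "W' = W \<inter> {P. f (- \<eta> / 2) < ?e \<bullet> (P - A 0)} \<inter> {P. ?e \<bullet> (P - A 0) < f (\<eta> / 2)}"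
  have W': "open W'" unfolding W'_def
    by (intro open_Int W open_Collect_less continuous_intros)
  have AW': "A 0 \<in> W'" unfolding W'_def using W fsign by simp
  define U where "U = {x \<in> PT. fst x \<in> W'}"
  have "openin PT_topology U" unfolding U_def by (rule openin_PT_fst[OF W'])
  moreover have "b \<in> U"
    using arc_in[OF r0] subset_PT AW' by (auto simp: U_def base)
  moreover have "\<alpha> \<inter> U = omega {v. n \<bullet> v = 0} (span {q}) \<inter> U"
  proof (intro equalityI subsetI)
    fix x assume x: "x \<in> \<alpha> \<inter> U"
    then obtain s where s: "s \<in> {-\<eta><..<\<eta>}" "x = (A s, span {X s})"
      using W(3)[of x] by (auto simp: U_def W'_def)
    then have "s \<in> {-\<delta><..<\<delta>}" "s \<in> {-r<..<r}" using \<eta> by auto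
    then have "x \<in> omega {v. n \<bullet> v = 0} (span {q})"
      unfolding s(2) in_omega_iff[OF q] using on_line through frame_nonzero by blast
    with x show "x \<in> omega {v. n \<bullet> v = 0} (span {q}) \<inter> U" by blast
  next
    fix x assume x: "x \<in> omega {v. n \<bullet> v = 0} (span {q}) \<inter> U"
    obtain P L where PL: "x = (P, L)" by (cases x)
    obtain w where w: "w \<noteq> 0" "L = span {w}"
      using x span_of_dim_1[of L] by (auto simp: PL omega_def PT_def)
    have P: "n \<bullet> (P, 1) = 0" "covec P w \<bullet> q = 0"
      using x in_omega_iff[OF q] by (auto simp: PL w(2))
    have "f (- \<eta> / 2) < ?e \<bullet> (P - A 0)" "?e \<bullet> (P - A 0) < f (\<eta> / 2)"
      using x by (auto simp: U_def W'_def PL)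
    then obtain s where s: "s \<in> {-\<eta><..<\<eta>}" "f s = ?e \<bullet> (P - A 0)" using surj by blast
    then have sr: "s \<in> {-\<delta><..<\<delta>}" "s \<in> {-r<..<r}" using \<eta> by auto
    have "cross2 ?e (P - A 0) = 0" "cross2 ?e (A s - A 0) = 0"
      using P(1) on_line[OF sr(1)] by (auto simp: n inner_covec_affine)
    then have "cross2 ?e (P - A s) = 0"
      by (simp add: cross2_def algebra_simps)
    then obtain k where k: "P - A s = k *\<^sub>R ?e" using cross2_eq_0_iff[OF e0] by blast
    have "?e \<bullet> (P - A s) = 0" using s(2) by (simp add: f_def inner_diff_right)
    then have "P = A s" using k e0 by simp
    moreover have "span {w} = span {X s}"
    proof (rule line_through_inj[OF w(1) frame_nonzero[OF sr(2)]])
      have "(A s, span {X s}) \<in> omega {v. n \<bullet> v = 0} (span {q})"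
        unfolding in_omega_iff[OF q] using on_line[OF sr(1)] through[OF sr(1)] frame_nonzero[OF sr(2)] by blast
      then show "line_through P (span {w}) = line_through P (span {X s})"
        using x \<open>P = A s\<close> by (auto simp: PL w(2) omega_def)
    qed
    ultimately have "x \<in> \<alpha>" using arc_in[OF sr(2)] by (simp add: PL w(2))
    with x show "x \<in> \<alpha> \<inter> U" by blast
  qed
  ultimately show ?thesis unfolding same_germ_def by blast
qed

end

lemma periodic_orbit_triangle_iff:
  assumes "framed_arc \<alpha> a0 r A A1 A2 X X1" "framed_arc \<beta> b0 r B B1 B2 Y Y1" "framed_arc \<gamma> c0 r C C1 C2 Z Z1"
    and s: "s \<in> {-r<..<r}" and t: "t \<in> {-r<..<r}" and v: "v \<in> {-r<..<r}"
  shows "periodic_orbit [\<alpha>, \<beta>, \<gamma>] [(A s, span {X s}), (B t, span {Y t}), (C v, span {Z v})] \<longleftrightarrow>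
    (cross2 (A1 s) (C v - A s) \<noteq> 0 \<and> cross2 (A1 s) (B t - A s) \<noteq> 0 \<and> reflects (X s) (A1 s) (A s) (C v) (B t)) \<and>
    (cross2 (B1 t) (A s - B t) \<noteq> 0 \<and> cross2 (B1 t) (C v - B t) \<noteq> 0 \<and> reflects (Y t) (B1 t) (B t) (A s) (C v)) \<and>
    (cross2 (C1 v) (B t - C v) \<noteq> 0 \<and> cross2 (C1 v) (A s - C v) \<noteq> 0 \<and> reflects (Z v) (C1 v) (C v) (B t) (A s))"
proof -
  interpret fa: framed_arc \<alpha> a0 r A A1 A2 X X1 by fact
  interpret fb: framed_arc \<beta> b0 r B B1 B2 Y Y1 by fact
  interpret fc: framed_arc \<gamma> c0 r C C1 C2 Z Z1 by fact
  have "{..<3::nat} = {0, 1, 2}" by auto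
  then have 3: "(\<forall>j<3. P j) \<longleftrightarrow> P 0 \<and> P 1 \<and> P (2::nat)" for P
    by (metis insertCI insertE lessThan_iff singletonD)
  show ?thesis
    unfolding fa.reflection_at_vertex_iff[OF s, symmetric] fb.reflection_at_vertex_iff[OF t, symmetric]
      fc.reflection_at_vertex_iff[OF v, symmetric]
    unfolding periodic_orbit_def Let_def
    using fa.arc_in[OF s] fb.arc_in[OF t] fc.arc_in[OF v]
    by (simp add: 3 numeral_3_eq_3[symmetric] numeral_2_eq_2[symmetric] eval_nat_numeral(3)[symmetric])
qed

section \<open>Straightness of the boundaries\<close>

lemma isCont_zero_off_point:
  fixes f :: "real \<Rightarrow> real"
  assumes "isCont f z" "open S" "z \<in> S" "\<And>x. x \<in> S \<Longrightarrow> x \<noteq> z \<Longrightarrow> f x = 0"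
  shows "f z = 0"
proof -
  have "\<forall>\<^sub>F x in at z. f x = 0"
    using assms(2-4) by (auto simp: eventually_at_topological)
  then have "((\<lambda>x. 0) \<longlongrightarrow> f z) (at z)"
    using assms(1) unfolding isCont_def by (rule Lim_transform_eventually[rotated])
  then show ?thesis by (simp add: tendsto_const_iff)
qed

context framed_arc
begin

text \<open>\<open>f\<close> is the tangent of the angle from the initial velocity to
  \<open>A1 s\<close>, and its derivative is a multiple of \<open>cross2 (A1 s) (A2 s)\<close>. So
  the direction is constant, whatever the speed of the parametrization. The radius
  \<open>\<rho>\<close> keeps the angle acute.\<close>

lemma straight:
  assumes \<epsilon>: "0 < \<epsilon>" "\<epsilon> \<le> r" and flat: "\<And>s. s \<in> {-\<epsilon><..<\<epsilon>} \<Longrightarrow> cross2 (A1 s) (A2 s) = 0"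
  shows "\<exists>\<rho>>0. \<rho> \<le> \<epsilon> \<and> (\<forall>s\<in>{-\<rho><..<\<rho>}. cross2 (A1 0) (A s - A 0) = 0 \<and> cross2 (A1 0) (A1 s) = 0)"
proof -
  let ?e = "A1 0"
  have e0: "?e \<noteq> 0" using velocity_nonzero radius_pos by simp
  have r0: "0 \<in> {-r<..<r}" using radius_pos by simp
  have "isCont (\<lambda>s. ?e \<bullet> A1 s) 0"
    by (intro continuous_intros has_vector_derivative_continuous[OF arc_deriv2[OF r0]])
  moreover have "?e \<bullet> A1 0 > 0" using e0 by simp
  ultimately have "\<forall>\<^sub>F s in nhds 0. ?e \<bullet> A1 s > 0"
    by (metis isCont_def tendsto_at_iff_tendsto_nhds order_tendstoD(1))
  then obtain d where d: "d > 0" "\<And>s. dist s 0 < d \<Longrightarrow> ?e \<bullet> A1 s > 0"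
    unfolding eventually_nhds_metric by blast
  define \<rho> where "\<rho> = min \<epsilon> d"
  have \<rho>: "\<rho> > 0" "\<rho> \<le> \<epsilon>" using \<epsilon> d(1) by (auto simp: \<rho>_def)
  have pos: "?e \<bullet> A1 s > 0" if "s \<in> {-\<rho><..<\<rho>}" for s
    using that by (intro d(2)) (auto simp: \<rho>_def dist_real_def)
  have in_r: "s \<in> {-r<..<r}" if "s \<in> {-\<rho><..<\<rho>}" for s using that \<rho> \<epsilon> by auto
  define f where "f s = cross2 ?e (A1 s) / (?e \<bullet> A1 s)" for s
  have "(f has_real_derivative 0) (at s)" if s: "s \<in> {-\<rho><..<\<rho>}" for s
  proof -
    have 1: "((\<lambda>s. cross2 ?e (A1 s)) has_real_derivative cross2 ?e (A2 s)) (at s)"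
      using has_real_derivative_cross2[OF has_vector_derivative_const arc_deriv2[OF in_r[OF s]], of ?e] by simp
    have 2: "((\<lambda>s. ?e \<bullet> A1 s) has_real_derivative ?e \<bullet> A2 s) (at s)"
      unfolding has_real_derivative_iff_has_vector_derivative
      by (rule bounded_linear.has_vector_derivative[OF bounded_linear_inner_right arc_deriv2[OF in_r[OF s]]])
    have "cross2 ?e (A2 s) * (?e \<bullet> A1 s) - cross2 ?e (A1 s) * (?e \<bullet> A2 s) = (?e \<bullet> ?e) * cross2 (A1 s) (A2 s)"
      by (simp add: cross2_def inner_vec_def sum_2 algebra_simps)
    also have "\<dots> = 0" using flat[of s] s \<rho> by auto
    finally show ?thesis
      using DERIV_divide[OF 1 2] pos[OF s] by (simp add: f_def[abs_def])
  qed
  then have const: "f s = f 0" if "s \<in> {-\<rho><..<\<rho>}" for s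
    using that \<rho>(1) by (intro DERIV_isconst3[of "-\<rho>" \<rho>]) auto
  have par: "cross2 ?e (A1 s) = 0" if "s \<in> {-\<rho><..<\<rho>}" for s
  proof -
    have "f s = 0" using const[OF that] by (simp add: f_def)
    then show ?thesis using pos[OF that] by (simp add: f_def)
  qed
  have "((\<lambda>s. cross2 ?e (A s - A 0)) has_real_derivative 0) (at s)" if s: "s \<in> {-\<rho><..<\<rho>}" for s
    using tau_deriv[OF has_vector_derivative_const[of "A 0"] has_vector_derivative_const[of ?e] arc_deriv[OF in_r[OF s]]]
      par[OF s] by simp
  then have "cross2 ?e (A s - A 0) = cross2 ?e (A 0 - A 0)" if "s \<in> {-\<rho><..<\<rho>}" for s
    using that \<rho>(1) by (intro DERIV_isconst3[of "-\<rho>" \<rho> _ _ "\<lambda>s. cross2 ?e (A s - A 0)"]) auto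
  with \<rho> par show ?thesis by auto
qed

lemma restrict:
  assumes "0 < \<rho>" "\<rho> \<le> r" shows "framed_arc \<alpha> b \<rho> A A1 A2 X X1"
proof -
  have in_r: "s \<in> {-r<..<r}" if "s \<in> {-\<rho><..<\<rho>}" for s using that assms by auto
  show ?thesis
  proof
    show "\<exists>W. open W \<and> A 0 \<in> W \<and> (\<forall>x\<in>\<alpha>. fst x \<in> W \<longrightarrow> (\<exists>s\<in>{-\<delta><..<\<delta>}. x = (A s, span {X s})))"
      if "0 < \<delta>" "\<delta> \<le> \<rho>" for \<delta>
      using nbhd[of \<delta>] that assms by simp
  qed (rule assms(1) base subset_PT arc_in[OF in_r] arc_deriv[OF in_r] arc_deriv2[OF in_r]
      arc_cont2[OF in_r] frame_deriv[OF in_r] transversal[OF in_r] tangent[OF in_r] | assumption)+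
qed

end

lemma nontangent_mono: "nontangent r m M A A1 B \<Longrightarrow> \<rho> \<le> r \<Longrightarrow> nontangent \<rho> m M A A1 B"
  unfolding nontangent_def by auto

section \<open>Collinear orbits and the passage to all parameters\<close>

context orbit_family
begin

text \<open>For collinear vertices the two sides at \<open>A s\<close> are one line, and the only
  nontangent line symmetric to itself is the framing line; the same holds at
  \<open>B t\<close>.\<close>

lemma degenerate_on_frames:
  assumes st: "s \<in> {-\<epsilon><..<\<epsilon>}" "t \<in> {-\<epsilon><..<\<epsilon>}"
    and deg: "cross2 (B t - A s) (C (u s t) - A s) = 0"
  shows "cross2 (X s) (B t - A s) = 0" "cross2 (Y t) (A s - B t) = 0"
proof -
  note n = nz[OF st]
  have "B t - A s \<noteq> 0" using n(1) by auto
  then obtain k where k: "C (u s t) - A s = k *\<^sub>R (B t - A s)"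
    using deg cross2_eq_0_iff by blast
  have "cross2 (X s) (B t - A s) * (k * AB s t) + k * cross2 (X s) (B t - A s) * AB s t = 0"
    using reflA[OF st] unfolding reflects_def k by (simp only: cross2.scaleR_right real_scaleR_def)
  then have "2 * (k * (cross2 (X s) (B t - A s) * AB s t)) = 0" by algebra
  moreover have "k \<noteq> 0" using k n(2) by auto
  ultimately show "cross2 (X s) (B t - A s) = 0" using n(1) by simp
  have k': "C (u s t) - B t = (1 - k) *\<^sub>R (A s - B t)"
    using k by (simp add: algebra_simps)
  have "cross2 (Y t) (A s - B t) * ((1 - k) * BA t s) + (1 - k) * cross2 (Y t) (A s - B t) * BA t s = 0"
    using reflB[OF st] unfolding reflects_def k' by (simp only: cross2.scaleR_right real_scaleR_def)
  then have "2 * ((1 - k) * (cross2 (Y t) (A s - B t) * BA t s)) = 0" by algebra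
  moreover have "1 - k \<noteq> 0" using k' n(4) by auto
  ultimately show "cross2 (Y t) (A s - B t) = 0" using n(3) by simp
qed

text \<open>A collinear orbit places \<open>B t\<close> on the framing line of \<open>A s\<close>.
  Since the pencil coordinate at \<open>A s\<close> is injective along \<open>B\<close>, that line
  is met at most once.\<close>

lemma degenerate_unique_t:
  assumes "s \<in> {-\<epsilon><..<\<epsilon>}" "t \<in> {-\<epsilon><..<\<epsilon>}" "t' \<in> {-\<epsilon><..<\<epsilon>}"
    "cross2 (B t - A s) (C (u s t) - A s) = 0" "cross2 (B t' - A s) (C (u s t') - A s) = 0"
  shows "t = t'"
proof -
  have "inj_on (\<lambda>t. cross2 (X s) (B t - A s) / cross2 (A1 s) (B t - A s)) {-\<epsilon><..<\<epsilon>}"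
  proof (rule inj_on_of_deriv_nonzero)
    fix t assume t: "t \<in> {-\<epsilon><..<\<epsilon>}"
    note n = nz[OF assms(1) t]
    show "((\<lambda>t. cross2 (X s) (B t - A s) / cross2 (A1 s) (B t - A s)) has_real_derivative
        - (cross2 (X s) (A1 s) * BA t s) / (AB s t)\<^sup>2) (at t)"
      by (rule pencil_coordinate_deriv[OF fb.arc_deriv[OF in_r[OF t]] n(1)])
    show "- (cross2 (X s) (A1 s) * BA t s) / (AB s t)\<^sup>2 \<noteq> 0"
      using n fa.transversal[OF in_r[OF assms(1)]] by simp
  qed
  from inj_onD[OF this _ assms(2,3)] show ?thesis
    using degenerate_on_frames(1)[OF assms(1,2,4)] degenerate_on_frames(1)[OF assms(1,3,5)] by simp
qed

lemma degenerate_unique_s: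
  assumes "t \<in> {-\<epsilon><..<\<epsilon>}" "s \<in> {-\<epsilon><..<\<epsilon>}" "s' \<in> {-\<epsilon><..<\<epsilon>}"
    "cross2 (B t - A s) (C (u s t) - A s) = 0" "cross2 (B t - A s') (C (u s' t) - A s') = 0"
  shows "s = s'"
proof -
  have "inj_on (\<lambda>s. cross2 (Y t) (A s - B t) / cross2 (B1 t) (A s - B t)) {-\<epsilon><..<\<epsilon>}"
  proof (rule inj_on_of_deriv_nonzero)
    fix s assume s: "s \<in> {-\<epsilon><..<\<epsilon>}"
    note n = nz[OF s assms(1)]
    show "((\<lambda>s. cross2 (Y t) (A s - B t) / cross2 (B1 t) (A s - B t)) has_real_derivative
        - (cross2 (Y t) (B1 t) * AB s t) / (BA t s)\<^sup>2) (at s)"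
      by (rule pencil_coordinate_deriv[OF fa.arc_deriv[OF in_r[OF s]] n(3)])
    show "- (cross2 (Y t) (B1 t) * AB s t) / (BA t s)\<^sup>2 \<noteq> 0"
      using n fb.transversal[OF in_r[OF assms(1)]] by simp
  qed
  from inj_onD[OF this _ assms(2,3)] show ?thesis
    using degenerate_on_frames(2)[OF assms(2,1,4)] degenerate_on_frames(2)[OF assms(3,1,5)] by simp
qed

lemma ex_nondegenerate_t:
  assumes "s \<in> {-\<epsilon><..<\<epsilon>}"
  shows "\<exists>t\<in>{-\<epsilon><..<\<epsilon>}. cross2 (B t - A s) (C (u s t) - A s) \<noteq> 0"
proof -
  have "0 \<in> {-\<epsilon><..<\<epsilon>}" "\<epsilon> / 2 \<in> {-\<epsilon><..<\<epsilon>}" "0 \<noteq> \<epsilon> / 2" using eps by auto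
  then show ?thesis using degenerate_unique_t[OF assms] by blast
qed

lemma ex_nondegenerate_s:
  assumes "t \<in> {-\<epsilon><..<\<epsilon>}"
  shows "\<exists>s\<in>{-\<epsilon><..<\<epsilon>}. cross2 (B t - A s) (C (u s t) - A s) \<noteq> 0"
proof -
  have "0 \<in> {-\<epsilon><..<\<epsilon>}" "\<epsilon> / 2 \<in> {-\<epsilon><..<\<epsilon>}" "0 \<noteq> \<epsilon> / 2" using eps by auto
  then show ?thesis using degenerate_unique_s[OF assms] by blast
qed

text \<open>The third vertex sweeps out a neighbourhood, and all but one of its positions are
  accounted for by nondegenerate orbits; continuity takes care of the exception.\<close>

lemma zero_near_third_vertex:
  assumes cont: "\<And>v. v \<in> {-r<..<r} \<Longrightarrow> isCont f v" and u0: "u 0 0 = 0"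
    and zero: "\<And>t. t \<in> {-\<epsilon><..<\<epsilon>} \<Longrightarrow> cross2 (B t - A 0) (C (u 0 t) - A 0) \<noteq> 0 \<Longrightarrow> f (u 0 t) = (0::real)"
  shows "\<exists>\<rho>>0. \<rho> \<le> r \<and> (\<forall>v\<in>{-\<rho><..<\<rho>}. f v = 0)"
proof -
  have z: "0 \<in> {-\<epsilon><..<\<epsilon>}" using eps by auto
  have inj: "inj_on (u 0) {-\<epsilon><..<\<epsilon>}"
    by (rule inj_on_of_deriv_nonzero[where g' = "\<lambda>t. ut 0 t"]) (use u_deriv_t us_ut_nonzero z in auto)
  have "continuous_on {-\<epsilon><..<\<epsilon>} (u 0)"
    by (rule DERIV_continuous_on) (use u_deriv_t[OF z] in \<open>auto intro: has_field_derivative_at_within\<close>)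
  then have op: "open (u 0 ` {-\<epsilon><..<\<epsilon>})" by (rule invariance_of_domain) (use inj in auto)
  have all: "f v = 0" if v: "v \<in> u 0 ` {-\<epsilon><..<\<epsilon>}" for v
  proof (cases "\<exists>t\<in>{-\<epsilon><..<\<epsilon>}. v = u 0 t \<and> cross2 (B t - A 0) (C (u 0 t) - A 0) \<noteq> 0")
    case True
    then show ?thesis using zero by blast
  next
    case False
    obtain t where t: "t \<in> {-\<epsilon><..<\<epsilon>}" "v = u 0 t" using v by blast
    with False have deg: "cross2 (B t - A 0) (C (u 0 t) - A 0) = 0" by blast
    show ?thesis
    proof (rule isCont_zero_off_point[OF _ op v])
      show "isCont f v" unfolding t(2) by (intro cont u_range z t)
      fix w assume "w \<in> u 0 ` {-\<epsilon><..<\<epsilon>}" "w \<noteq> v"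
      then obtain t' where t': "t' \<in> {-\<epsilon><..<\<epsilon>}" "w = u 0 t'" "t' \<noteq> t" using t by blast
      then show "f w = 0" using zero[OF t'(1)] degenerate_unique_t[OF z t(1) t'(1) deg] by blast
    qed
  qed
  \<comment> \<open>The normalization of \<open>u\<close> centres the swept neighbourhood at the
    base parameter of the third vertex.\<close>
  have "0 \<in> u 0 ` {-\<epsilon><..<\<epsilon>}" using u0 z by force
  with op obtain d where d: "d > 0" "ball 0 d \<subseteq> u 0 ` {-\<epsilon><..<\<epsilon>}" using openE by blast
  have "f v = 0" if "v \<in> {- (min d r)<..<min d r}" for v
  proof -
    have "v \<in> ball 0 d" using that by (auto simp: dist_real_def)
    then show ?thesis using d(2) all by blast
  qed
  then show ?thesis using d(1) fa.radius_pos by (intro exI[of _ "min d r"]) auto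
qed

text \<open>Every parameter of the first or second boundary belongs to a noncollinear orbit, because
  two values of the other parameter cannot both be exceptional. The third parameter is not free and
  needs \<open>zero_near_third_vertex\<close>.\<close>

lemma all_straight:
  assumes u0: "u 0 0 = 0"
  shows "\<exists>\<rho>>0. \<rho> \<le> r \<and> (\<forall>s\<in>{-\<rho><..<\<rho>}.
    cross2 (A1 0) (A s - A 0) = 0 \<and> cross2 (A1 0) (A1 s) = 0 \<and>
    cross2 (B1 0) (B s - B 0) = 0 \<and> cross2 (B1 0) (B1 s) = 0 \<and>
    cross2 (C1 0) (C s - C 0) = 0 \<and> cross2 (C1 0) (C1 s) = 0)"
proof -
  have z: "0 \<in> {-\<epsilon><..<\<epsilon>}" using eps by auto
  have "cross2 (A1 s) (A2 s) = 0" if "s \<in> {-\<epsilon><..<\<epsilon>}" for s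
    using ex_nondegenerate_t[OF that] curvature_zero(1)[OF that] by blast
  from fa.straight[OF eps this] obtain \<rho>1 where 1: "\<rho>1 > 0" "\<rho>1 \<le> \<epsilon>"
    "\<forall>s\<in>{-\<rho>1<..<\<rho>1}. cross2 (A1 0) (A s - A 0) = 0 \<and> cross2 (A1 0) (A1 s) = 0" by blast
  have "cross2 (B1 t) (B2 t) = 0" if "t \<in> {-\<epsilon><..<\<epsilon>}" for t
    using ex_nondegenerate_s[OF that] curvature_zero(2)[OF _ that] by blast
  from fb.straight[OF eps this] obtain \<rho>2 where 2: "\<rho>2 > 0" "\<rho>2 \<le> \<epsilon>"
    "\<forall>s\<in>{-\<rho>2<..<\<rho>2}. cross2 (B1 0) (B s - B 0) = 0 \<and> cross2 (B1 0) (B1 s) = 0" by blast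
  have "\<exists>\<rho>>0. \<rho> \<le> r \<and> (\<forall>v\<in>{-\<rho><..<\<rho>}. cross2 (C1 v) (C2 v) = 0)"
  proof (rule zero_near_third_vertex[OF _ u0])
    show "isCont (\<lambda>v. cross2 (C1 v) (C2 v)) v" if "v \<in> {-r<..<r}" for v
      by (intro continuous_intros fc.arc_cont2[OF that]
          has_vector_derivative_continuous[OF fc.arc_deriv2[OF that]])
    show "cross2 (C1 (u 0 t)) (C2 (u 0 t)) = 0"
      if "t \<in> {-\<epsilon><..<\<epsilon>}" "cross2 (B t - A 0) (C (u 0 t) - A 0) \<noteq> 0" for t
      using curvature_zero(3)[OF z that] .
  qed
  then obtain \<rho>' where \<rho>': "0 < \<rho>'" "\<rho>' \<le> r" "\<And>v. v \<in> {-\<rho>'<..<\<rho>'} \<Longrightarrow> cross2 (C1 v) (C2 v) = 0"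
    by blast
  from fc.straight[OF \<rho>'] obtain \<rho>3 where 3: "\<rho>3 > 0" "\<rho>3 \<le> \<rho>'"
    "\<forall>s\<in>{-\<rho>3<..<\<rho>3}. cross2 (C1 0) (C s - C 0) = 0 \<and> cross2 (C1 0) (C1 s) = 0" by blast
  show ?thesis
    using 1 2 3 \<rho>' eps by (intro exI[of _ "min \<rho>1 (min \<rho>2 \<rho>3)"]) auto
qed

end

section \<open>From straight boundaries to concurrent framing lines\<close>

lemma det_mult:
  "(cprod l m \<bullet> n) * (cprod u v \<bullet> w) =
    (l \<bullet> u) * ((m \<bullet> v) * (n \<bullet> w) - (m \<bullet> w) * (n \<bullet> v))
    - (l \<bullet> v) * ((m \<bullet> u) * (n \<bullet> w) - (m \<bullet> w) * (n \<bullet> u))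
    + (l \<bullet> w) * ((m \<bullet> u) * (n \<bullet> v) - (m \<bullet> v) * (n \<bullet> u))"
  by (simp add: cprod_def inner_prod_def inner_vec_def sum_2 algebra_simps)

lemma cprod_affine: "cprod (A, 1) (B, 1) \<bullet> (C, 1) = cross2 (B - A) (C - A)"
  by (simp add: hvec_simps cross2_def algebra_simps)

text \<open>The side lines \<open>nA\<close>, \<open>nB\<close>, \<open>nC\<close> of the tangent triangle pass through \<open>A\<close>, \<open>B\<close>, \<open>C\<close>. By
  the product formula for determinants, in the basis \<open>A, B, C\<close> everything reduces to the Menelaus
  relation.\<close>

lemma concurrency_at_orbit:
  fixes nA nB nC lA lB lC A B C :: hvec
  assumes on: "nA \<bullet> A = 0" "nB \<bullet> B = 0" "nC \<bullet> C = 0"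
    and men: "nA \<bullet> C * (nB \<bullet> A) * (nC \<bullet> B) = nA \<bullet> B * (nB \<bullet> C) * (nC \<bullet> A)"
    and nz: "nA \<bullet> B \<noteq> 0" "nA \<bullet> C \<noteq> 0" "nB \<bullet> A \<noteq> 0" "nB \<bullet> C \<noteq> 0" "nC \<bullet> A \<noteq> 0" "nC \<bullet> B \<noteq> 0"
    and ndeg: "cprod A B \<bullet> C \<noteq> 0"
    and lA: "lA \<bullet> A = 0" "lA \<bullet> B * (nA \<bullet> C) + lA \<bullet> C * (nA \<bullet> B) = 0"
    and lB: "lB \<bullet> B = 0" "lB \<bullet> A * (nB \<bullet> C) + lB \<bullet> C * (nB \<bullet> A) = 0"
    and lC: "lC \<bullet> C = 0" "lC \<bullet> A * (nC \<bullet> B) + lC \<bullet> B * (nC \<bullet> A) = 0"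
  shows "cprod nA nB \<bullet> nC \<noteq> 0" "lA \<bullet> cprod nB nC = 0" "lB \<bullet> cprod nC nA = 0" "lC \<bullet> cprod nA nB = 0"
proof -
  \<comment> \<open>The matrix of pairings has zero diagonal, so two cyclic products remain in its
    determinant; the Menelaus relation makes them equal instead of opposite.\<close>
  have "(cprod nA nB \<bullet> nC) * (cprod A B \<bullet> C) = 2 * (nA \<bullet> B * (nB \<bullet> C) * (nC \<bullet> A))"
    unfolding det_mult using on men by (simp add: algebra_simps)
  then show "cprod nA nB \<bullet> nC \<noteq> 0" using nz ndeg by auto
  have flip: "l \<bullet> cprod m n = cprod l m \<bullet> n" for l m n
    using cprod_rotate[of l m n] by (simp add: inner_commute)
  have "(lA \<bullet> cprod nB nC) * (cprod A B \<bullet> C) * (nA \<bullet> B) = 0"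
    unfolding flip det_mult using on men lA by algebra
  then show "lA \<bullet> cprod nB nC = 0" using nz ndeg by simp
  have "(lB \<bullet> cprod nC nA) * (cprod A B \<bullet> C) * (nB \<bullet> C) = 0"
    unfolding flip det_mult using on men lB by algebra
  then show "lB \<bullet> cprod nC nA = 0" using nz ndeg by simp
  have "(lC \<bullet> cprod nA nB) * (cprod A B \<bullet> C) * (nC \<bullet> A) = 0"
    unfolding flip det_mult using on men lC by algebra
  then show "lC \<bullet> cprod nA nB = 0" using nz ndeg by simp
qed

text \<open>On a straight boundary the forms \<open>\<tau>\<^sub>A\<close> at all positions are
  proportional to one fixed linear form, and the scalars drop out of homogeneous relations.\<close>

lemma (in framed_arc) straight_form:
  assumes s: "s \<in> {-r<..<r}" and par: "cross2 (A1 0) (A s - A 0) = 0" "cross2 (A1 0) (A1 s) = 0"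
  shows "\<exists>k. k \<noteq> 0 \<and> (\<forall>P. cross2 (A1 s) (P - A s) = k * (covec (A 0) (A1 0) \<bullet> (P, 1)))"
proof -
  have "A1 0 \<noteq> 0" using velocity_nonzero radius_pos by simp
  then obtain k where k: "A1 s = k *\<^sub>R A1 0" using par(2) cross2_eq_0_iff by blast
  then have "k \<noteq> 0" using velocity_nonzero[OF s] by auto
  moreover have "cross2 (A1 s) (P - A s) = k * (covec (A 0) (A1 0) \<bullet> (P, 1))" for P
    unfolding inner_covec_affine k using par(1)
    by (simp add: cross2.scaleR_left cross2.diff_right algebra_simps)
  ultimately show ?thesis by blast
qed

context orbit_family
begin

text \<open>Each equation concerns one vertex but is read off a whole noncollinear orbit through it.
  Such an orbit exists for each position of the first and of the second vertex; the third again
  needs continuity.\<close>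

lemma frames_concurrent:
  assumes straight: "\<And>s. s \<in> {-r<..<r} \<Longrightarrow>
      cross2 (A1 0) (A s - A 0) = 0 \<and> cross2 (A1 0) (A1 s) = 0 \<and>
      cross2 (B1 0) (B s - B 0) = 0 \<and> cross2 (B1 0) (B1 s) = 0 \<and>
      cross2 (C1 0) (C s - C 0) = 0 \<and> cross2 (C1 0) (C1 s) = 0"
    and u0: "u 0 0 = 0"
  defines "nA \<equiv> covec (A 0) (A1 0)" and "nB \<equiv> covec (B 0) (B1 0)" and "nC \<equiv> covec (C 0) (C1 0)"
  shows "cprod nA nB \<bullet> nC \<noteq> 0"
    and "s \<in> {-\<epsilon><..<\<epsilon>} \<Longrightarrow> covec (A s) (X s) \<bullet> cprod nB nC = 0"
    and "t \<in> {-\<epsilon><..<\<epsilon>} \<Longrightarrow> covec (B t) (Y t) \<bullet> cprod nC nA = 0"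
    and "\<exists>\<rho>>0. \<rho> \<le> r \<and> (\<forall>v\<in>{-\<rho><..<\<rho>}. covec (C v) (Z v) \<bullet> cprod nA nB = 0)"
proof -
  have z: "0 \<in> {-\<epsilon><..<\<epsilon>}" using eps by auto
  have orbit: "cprod nA nB \<bullet> nC \<noteq> 0 \<and> covec (A s) (X s) \<bullet> cprod nB nC = 0 \<and>
      covec (B t) (Y t) \<bullet> cprod nC nA = 0 \<and> covec (C (u s t)) (Z (u s t)) \<bullet> cprod nA nB = 0"
    if st: "s \<in> {-\<epsilon><..<\<epsilon>}" "t \<in> {-\<epsilon><..<\<epsilon>}" and nd: "cross2 (B t - A s) (C (u s t) - A s) \<noteq> 0" for s t
  proof -
    note R = in_r[OF st(1)] in_r[OF st(2)] u_range[OF st]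
    note n = nz[OF st]
    obtain kA where kA: "kA \<noteq> 0" "\<And>P. cross2 (A1 s) (P - A s) = kA * (nA \<bullet> (P, 1))"
      using fa.straight_form[OF R(1)] straight[OF R(1)] unfolding nA_def by blast
    obtain kB where kB: "kB \<noteq> 0" "\<And>P. cross2 (B1 t) (P - B t) = kB * (nB \<bullet> (P, 1))"
      using fb.straight_form[OF R(2)] straight[OF R(2)] unfolding nB_def by blast
    obtain kC where kC: "kC \<noteq> 0" "\<And>P. cross2 (C1 (u s t)) (P - C (u s t)) = kC * (nC \<bullet> (P, 1))"
      using fc.straight_form[OF R(3)] straight[OF R(3)] unfolding nC_def by blast
    have on: "nA \<bullet> (A s, 1) = 0" "nB \<bullet> (B t, 1) = 0" "nC \<bullet> (C (u s t), 1) = 0"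
      using straight[OF R(1)] straight[OF R(2)] straight[OF R(3)]
      by (auto simp: nA_def nB_def nC_def inner_covec_affine)
    have men: "nA \<bullet> (C (u s t), 1) * (nB \<bullet> (A s, 1)) * (nC \<bullet> (B t, 1))
        = nA \<bullet> (B t, 1) * (nB \<bullet> (C (u s t), 1)) * (nC \<bullet> (A s, 1))"
    proof -
      have "(kA * kB * kC) * (nA \<bullet> (C (u s t), 1) * (nB \<bullet> (A s, 1)) * (nC \<bullet> (B t, 1)))
          = (kA * kB * kC) * (nA \<bullet> (B t, 1) * (nB \<bullet> (C (u s t), 1)) * (nC \<bullet> (A s, 1)))"
        using menelaus[OF st] unfolding kA kB kC by (simp only: ac_simps)
      moreover have "kA * kB * kC \<noteq> 0" using kA kB kC by simp
      ultimately show ?thesis using mult_left_cancel by blast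
    qed
    have cancel: "x * a + y * b = 0" if "x * (k * a) + y * (k * b) = 0" "k \<noteq> 0" for x y a b k :: real
    proof -
      have "k * (x * a + y * b) = 0" using that(1) by algebra
      then show ?thesis using that(2) by simp
    qed
    have refl: "covec (A s) (X s) \<bullet> (B t, 1) * (nA \<bullet> (C (u s t), 1))
        + covec (A s) (X s) \<bullet> (C (u s t), 1) * (nA \<bullet> (B t, 1)) = 0"
      "covec (B t) (Y t) \<bullet> (A s, 1) * (nB \<bullet> (C (u s t), 1))
        + covec (B t) (Y t) \<bullet> (C (u s t), 1) * (nB \<bullet> (A s, 1)) = 0"
      "covec (C (u s t)) (Z (u s t)) \<bullet> (A s, 1) * (nC \<bullet> (B t, 1))
        + covec (C (u s t)) (Z (u s t)) \<bullet> (B t, 1) * (nC \<bullet> (A s, 1)) = 0"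
      using reflA[OF st] reflB[OF st] reflC[OF st] kA(1) kB(1) kC(1)
      unfolding reflects_def kA(2) kB(2) kC(2) inner_covec_affine by (auto intro: cancel)
    have "nA \<bullet> (B t, 1) \<noteq> 0" "nA \<bullet> (C (u s t), 1) \<noteq> 0" "nB \<bullet> (A s, 1) \<noteq> 0"
      "nB \<bullet> (C (u s t), 1) \<noteq> 0" "nC \<bullet> (A s, 1) \<noteq> 0" "nC \<bullet> (B t, 1) \<noteq> 0"
      using n unfolding kA kB kC by auto
    from concurrency_at_orbit[OF on men this _ covec_base refl(1) covec_base refl(2) covec_base refl(3)]
    show ?thesis using nd by (simp add: cprod_affine)
  qed
  show "cprod nA nB \<bullet> nC \<noteq> 0" using ex_nondegenerate_t[OF z] orbit[OF z] by blast
  show "covec (A s) (X s) \<bullet> cprod nB nC = 0" if "s \<in> {-\<epsilon><..<\<epsilon>}"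
    using ex_nondegenerate_t[OF that] orbit[OF that] by blast
  show "covec (B t) (Y t) \<bullet> cprod nC nA = 0" if "t \<in> {-\<epsilon><..<\<epsilon>}"
    using ex_nondegenerate_s[OF that] orbit[OF _ that] by blast
  show "\<exists>\<rho>>0. \<rho> \<le> r \<and> (\<forall>v\<in>{-\<rho><..<\<rho>}. covec (C v) (Z v) \<bullet> cprod nA nB = 0)"
  proof (rule zero_near_third_vertex[OF _ u0])
    show "isCont (\<lambda>v. covec (C v) (Z v) \<bullet> cprod nA nB) v" if "v \<in> {-r<..<r}" for v
      unfolding inner_covec
      by (intro continuous_intros has_vector_derivative_continuous[OF fc.frame_deriv[OF that]]
          has_vector_derivative_continuous[OF fc.arc_deriv[OF that]])
    show "covec (C (u 0 t)) (Z (u 0 t)) \<bullet> cprod nA nB = 0"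
      if "t \<in> {-\<epsilon><..<\<epsilon>}" "cross2 (B t - A 0) (C (u 0 t) - A 0) \<noteq> 0" for t
      using orbit[OF z that] by blast
  qed
qed

end

section \<open>Uniform bounds, construction of the family, and the resulting triangle\<close>

lemma nontangent_exists:
  assumes fa: "framed_arc \<alpha> a0 r A A1 A2 X X1" and fb: "framed_arc \<beta> b0 r B B1 B2 Y Y1"
    and nz: "cross2 (A1 0) (B 0 - A 0) \<noteq> 0"
  shows "\<exists>\<rho>>0. \<exists>m>0. \<exists>M. \<forall>r'. r' \<le> \<rho> \<longrightarrow> (\<forall>m' M'. m' \<le> m \<longrightarrow> M \<le> M' \<longrightarrow> nontangent r' m' M' A A1 B)"
proof -
  interpret fa: framed_arc \<alpha> a0 r A A1 A2 X X1 by fact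
  interpret fb: framed_arc \<beta> b0 r B B1 B2 Y Y1 by fact
  have z: "0 \<in> {-r<..<r}" using fa.radius_pos by simp
  let ?f = "\<lambda>p. cross2 (A1 (fst p)) (B (snd p) - A (fst p))"
  have c: "isCont (\<lambda>p. f (fst p)) (0, 0)" "isCont (\<lambda>p. f (snd p)) (0, 0)"
    if "isCont f 0" for f :: "real \<Rightarrow> real^2"
    using isCont_o2[where f = fst and g = f and a = "(0, 0)"] isCont_o2[where f = snd and g = f and a = "(0, 0)"]
      that by auto
  have "isCont ?f (0, 0)"
    by (intro continuous_intros c has_vector_derivative_continuous[OF fa.arc_deriv[OF z]]
        has_vector_derivative_continuous[OF fa.arc_deriv2[OF z]] has_vector_derivative_continuous[OF fb.arc_deriv[OF z]])
  then have "(?f \<longlongrightarrow> ?f (0, 0)) (nhds (0, 0))"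
    using tendsto_at_iff_tendsto_nhds[of ?f "(0, 0)"] by (simp add: isCont_def)
  then have lim: "((\<lambda>p. \<bar>?f p\<bar>) \<longlongrightarrow> \<bar>?f (0, 0)\<bar>) (nhds (0, 0))"
    by (rule tendsto_rabs)
  define F where "F = \<bar>?f (0, 0)\<bar>"
  have F: "F > 0" using nz by (simp add: F_def)
  have "\<forall>\<^sub>F p in nhds (0, 0). F / 2 < \<bar>?f p\<bar>" "\<forall>\<^sub>F p in nhds (0, 0). \<bar>?f p\<bar> < 2 * F"
    using order_tendstoD(1)[OF lim[folded F_def], of "F / 2"] order_tendstoD(2)[OF lim[folded F_def], of "2 * F"] F
    by simp_all
  then have "\<forall>\<^sub>F p in nhds 0 \<times>\<^sub>F nhds 0. \<bar>?f p\<bar> > F / 2 \<and> \<bar>?f p\<bar> < 2 * F"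
    unfolding nhds_prod by eventually_elim simp
  then obtain P Q where PQ: "\<forall>\<^sub>F s in nhds 0. P s" "\<forall>\<^sub>F t in nhds 0. Q t"
      "\<And>s t. P s \<Longrightarrow> Q t \<Longrightarrow> \<bar>?f (s, t)\<bar> > F / 2 \<and> \<bar>?f (s, t)\<bar> < 2 * F"
    unfolding eventually_prod_filter by blast
  obtain d where d: "d > 0" "\<And>s. dist s 0 < d \<Longrightarrow> P s" using PQ(1) unfolding eventually_nhds_metric by blast
  obtain e where e: "e > 0" "\<And>s. dist s 0 < e \<Longrightarrow> Q s" using PQ(2) unfolding eventually_nhds_metric by blast
  \<comment> \<open>Stated for all smaller radii and weaker bounds, so that six such instances can
    be merged by minima and maxima.\<close>
  have "nontangent r' m' M' A A1 B" if "r' \<le> min d e" "m' \<le> F / 2" "2 * F \<le> M'" for r' m' M'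
    unfolding nontangent_def
  proof (intro ballI)
    fix s t assume "s \<in> {-r'<..<r'}" "t \<in> {-r'<..<r'}"
    then have "P s" "Q t" using that(1) by (auto intro!: d e simp: dist_real_def)
    from PQ(3)[OF this] show "m' \<le> \<bar>cross2 (A1 s) (B t - A s)\<bar> \<and> \<bar>cross2 (A1 s) (B t - A s)\<bar> \<le> M'"
      using that by simp
  qed
  then show ?thesis using d(1) e(1) F
    by (intro exI[of _ "min d e"] exI[of _ "F / 2"] exI[of _ "2 * F"] conjI) auto
qed

lemma cprod_zero [simp]: "cprod 0 v = 0" "cprod u 0 = 0"
  by (simp_all add: hvec_simps)

context framed_triangle
begin

lemma restrict: "0 < \<rho> \<Longrightarrow> \<rho> \<le> r \<Longrightarrow>
    framed_triangle \<alpha> a0 \<rho> A A1 A2 X X1 \<beta> b0 B B1 B2 Y Y1 \<gamma> c0 C C1 C2 Z Z1 m M"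
  using fa.restrict fb.restrict fc.restrict nt m_pos nontangent_mono
  unfolding framed_triangle_def framed_triangle_axioms_def by blast

lemma orbit_iff:
  assumes "s \<in> {-r<..<r}" "t \<in> {-r<..<r}" "v \<in> {-r<..<r}"
  shows "periodic_orbit [\<alpha>, \<beta>, \<gamma>] [(A s, span {X s}), (B t, span {Y t}), (C v, span {Z v})] \<longleftrightarrow>
    reflects (X s) (A1 s) (A s) (B t) (C v) \<and> reflects (Y t) (B1 t) (B t) (A s) (C v) \<and>
    reflects (Z v) (C1 v) (C v) (A s) (B t)"
  unfolding periodic_orbit_triangle_iff[OF fa.framed_arc_axioms fb.framed_arc_axioms fc.framed_arc_axioms assms]
  using nonzero[OF assms] by (auto simp: reflects_def add.commute mult.commute)

lemma orbit_family_exists: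
  assumes refl: "reflective [\<alpha>, \<beta>, \<gamma>] [a0, b0, c0]"
  shows "\<exists>\<epsilon> u. orbit_family \<alpha> a0 r A A1 A2 X X1 \<beta> b0 B B1 B2 Y Y1 \<gamma> c0 C C1 C2 Z Z1 m M \<epsilon> u \<and> u 0 0 = 0"
proof -
  have r: "0 < r" by (rule fa.radius_pos)
  have z: "0 \<in> {-r<..<r}" using r by simp
  obtain W where W: "open W" "C 0 \<in> W" "\<And>x. x \<in> \<gamma> \<Longrightarrow> fst x \<in> W \<Longrightarrow> \<exists>s\<in>{-r<..<r}. x = (C s, span {Z s})"
    using fc.nbhd[OF r order_refl] by blast
  \<comment> \<open>Only the third vertex is confined: inside \<open>W\<close> every element of
    \<open>\<gamma>\<close> has a parameter.\<close>
  define V where "V j = {x \<in> PT. fst x \<in> (if j = (2::nat) then W else UNIV)}" for j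
  have bases: "a0 \<in> PT" "b0 \<in> PT" "c0 \<in> PT"
    using fa.arc_in[OF z] fb.arc_in[OF z] fc.arc_in[OF z] fa.subset_PT fb.subset_PT fc.subset_PT
    by (auto simp: fa.base fb.base fc.base)
  have "\<forall>j<length [\<alpha>, \<beta>, \<gamma>]. openin PT_topology (V j) \<and> [a0, b0, c0] ! j \<in> V j"
  proof (intro allI impI conjI)
    fix j assume "j < length [\<alpha>, \<beta>, \<gamma>]"
    then have "j = 0 \<or> j = 1 \<or> j = 2" by auto
    then show "[a0, b0, c0] ! j \<in> V j" using bases W(2) by (auto simp: V_def fc.base)
    show "openin PT_topology (V j)" unfolding V_def by (rule openin_PT_fst) (simp add: W(1))
  qed
  then obtain U1 U2 where U: "openin PT_topology U1" "a0 \<in> U1" "openin PT_topology U2" "b0 \<in> U2"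
    and ext: "\<And>x1 x2. x1 \<in> \<alpha> \<inter> U1 \<Longrightarrow> x2 \<in> \<beta> \<inter> U2 \<Longrightarrow>
      \<exists>xs. periodic_orbit [\<alpha>, \<beta>, \<gamma>] xs \<and> xs ! 0 = x1 \<and> xs ! 1 = x2 \<and> (\<forall>j<length [\<alpha>, \<beta>, \<gamma>]. xs ! j \<in> V j)"
    using refl unfolding reflective_def by (metis nth_Cons_0 nth_Cons_Suc One_nat_def)
  have "\<forall>\<^sub>F s in nhds 0. (A s, span {X s}) \<in> U1" "\<forall>\<^sub>F t in nhds 0. (B t, span {Y t}) \<in> U2"
    using U fa.base fb.base fa.frame_nonzero[OF z] fb.frame_nonzero[OF z]
    by (auto intro!: PT_neighbourhood has_vector_derivative_continuous[OF fa.arc_deriv[OF z]]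
        has_vector_derivative_continuous[OF fa.frame_deriv[OF z]] has_vector_derivative_continuous[OF fb.arc_deriv[OF z]]
        has_vector_derivative_continuous[OF fb.frame_deriv[OF z]])
  then obtain d where d: "d > 0" "\<And>s. dist s 0 < d \<Longrightarrow> (A s, span {X s}) \<in> U1 \<and> (B s, span {Y s}) \<in> U2"
    using eventually_conj unfolding eventually_nhds_metric[symmetric] by (metis (mono_tags, lifting) eventually_nhds_metric)
  define \<epsilon> where "\<epsilon> = min d r"
  have \<epsilon>: "0 < \<epsilon>" "\<epsilon> \<le> r" using d(1) r by (auto simp: \<epsilon>_def)
  define orb where "orb s t v \<longleftrightarrow> v \<in> {-r<..<r} \<and>
    periodic_orbit [\<alpha>, \<beta>, \<gamma>] [(A s, span {X s}), (B t, span {Y t}), (C v, span {Z v})]" for s t v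
  have ex: "\<exists>v. orb s t v" if st: "s \<in> {-\<epsilon><..<\<epsilon>}" "t \<in> {-\<epsilon><..<\<epsilon>}" for s t
  proof -
    have "s \<in> {-r<..<r}" "t \<in> {-r<..<r}" "dist s 0 < d" "dist t 0 < d"
      using st by (auto simp: \<epsilon>_def dist_real_def)
    then have "(A s, span {X s}) \<in> \<alpha> \<inter> U1" "(B t, span {Y t}) \<in> \<beta> \<inter> U2"
      using d(2) fa.arc_in fb.arc_in by blast+
    from ext[OF this] obtain xs where xs: "periodic_orbit [\<alpha>, \<beta>, \<gamma>] xs" "xs ! 0 = (A s, span {X s})"
        "xs ! 1 = (B t, span {Y t})" "\<forall>j<length [\<alpha>, \<beta>, \<gamma>]. xs ! j \<in> V j" by blast
    have "\<forall>j<length [\<alpha>, \<beta>, \<gamma>]. xs ! j \<in> [\<alpha>, \<beta>, \<gamma>] ! j"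
      using xs(1) unfolding periodic_orbit_def Let_def by blast
    from this[rule_format, of 2] have len: "length xs = 3" "xs ! 2 \<in> \<gamma>"
      using xs(1) by (simp_all add: periodic_orbit_def)
    moreover have "fst (xs ! 2) \<in> W" using xs(4)[rule_format, of 2] by (simp add: V_def)
    ultimately obtain v where v: "v \<in> {-r<..<r}" "xs ! 2 = (C v, span {Z v})" using W(3) by blast
    have "xs = [xs ! 0, xs ! 1, xs ! 2]"
      using len(1) by (intro nth_equalityI) (auto simp: less_Suc_eq numeral_3_eq_3 numeral_2_eq_2)
    then show ?thesis unfolding orb_def using xs v by metis
  qed
  have base_orb: "orb 0 0 0"
    using refl z by (simp add: orb_def reflective_def fa.base fb.base fc.base)
  \<comment> \<open>At the origin the base orbit is an admissible choice; prescribing it there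
    secures \<open>u 0 0 = 0\<close>.\<close>
  define u where "u s t = (if s = 0 \<and> t = 0 then 0 else SOME v. orb s t v)" for s t :: real
  have u: "orb s t (u s t)" if "s \<in> {-\<epsilon><..<\<epsilon>}" "t \<in> {-\<epsilon><..<\<epsilon>}" for s t
    using base_orb someI_ex[OF ex[OF that]] by (auto simp: u_def)
  have in_r: "s \<in> {-r<..<r}" if "s \<in> {-\<epsilon><..<\<epsilon>}" for s using that \<epsilon> by auto
  have "orbit_family \<alpha> a0 r A A1 A2 X X1 \<beta> b0 B B1 B2 Y Y1 \<gamma> c0 C C1 C2 Z Z1 m M \<epsilon> u"
  proof
    fix s t assume st: "s \<in> {-\<epsilon><..<\<epsilon>}" "t \<in> {-\<epsilon><..<\<epsilon>}"
    have 1: "u s t \<in> {-r<..<r}" using u[OF st] by (simp add: orb_def)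
    have "periodic_orbit [\<alpha>, \<beta>, \<gamma>] [(A s, span {X s}), (B t, span {Y t}), (C (u s t), span {Z (u s t)})]"
      using u[OF st] by (simp add: orb_def)
    note o = this[unfolded orbit_iff[OF in_r[OF st(1)] in_r[OF st(2)] 1]]
    show "u s t \<in> {-r<..<r}" by (rule 1)
    show "reflects (X s) (A1 s) (A s) (B t) (C (u s t))" "reflects (Y t) (B1 t) (B t) (A s) (C (u s t))"
      "reflects (Z (u s t)) (C1 (u s t)) (C (u s t)) (A s) (B t)" using o by blast+
  qed (use \<epsilon> in auto)
  moreover have "u 0 0 = 0" by (simp add: u_def)
  ultimately show ?thesis by blast
qed

text \<open>The family is built twice. The first one gives straightness up to a radius
  \<open>\<rho>\<close>, but its third vertex may leave that range. The second lives inside radius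
  \<open>\<rho>\<close>, so straightness is available at all vertices of its orbits.\<close>

lemma right_spherical_of_reflective:
  assumes refl: "reflective [\<alpha>, \<beta>, \<gamma>] [a0, b0, c0]"
  shows "\<exists>P Q R. proj_point P \<and> proj_point Q \<and> proj_point R \<and> noncollinear P Q R \<and>
       same_germ a0 \<alpha> (omega (join P Q) R) \<and> same_germ b0 \<beta> (omega (join Q R) P) \<and>
       same_germ c0 \<gamma> (omega (join R P) Q)"
proof -
  obtain \<epsilon> u where "orbit_family \<alpha> a0 r A A1 A2 X X1 \<beta> b0 B B1 B2 Y Y1 \<gamma> c0 C C1 C2 Z Z1 m M \<epsilon> u" "u 0 0 = 0"
    using orbit_family_exists[OF refl] by blast
  from orbit_family.all_straight[OF this] obtain \<rho> where \<rho>: "0 < \<rho>" "\<rho> \<le> r"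
    and straight: "\<And>s. s \<in> {-\<rho><..<\<rho>} \<Longrightarrow>
      cross2 (A1 0) (A s - A 0) = 0 \<and> cross2 (A1 0) (A1 s) = 0 \<and>
      cross2 (B1 0) (B s - B 0) = 0 \<and> cross2 (B1 0) (B1 s) = 0 \<and>
      cross2 (C1 0) (C s - C 0) = 0 \<and> cross2 (C1 0) (C1 s) = 0" by blast
  interpret R: framed_triangle \<alpha> a0 \<rho> A A1 A2 X X1 \<beta> b0 B B1 B2 Y Y1 \<gamma> c0 C C1 C2 Z Z1 m M
    by (rule restrict[OF \<rho>])
  obtain \<epsilon> u where of: "orbit_family \<alpha> a0 \<rho> A A1 A2 X X1 \<beta> b0 B B1 B2 Y Y1 \<gamma> c0 C C1 C2 Z Z1 m M \<epsilon> u"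
    and u0: "u 0 0 = 0"
    using R.orbit_family_exists[OF refl] by blast
  interpret O: orbit_family \<alpha> a0 \<rho> A A1 A2 X X1 \<beta> b0 B B1 B2 Y Y1 \<gamma> c0 C C1 C2 Z Z1 m M \<epsilon> u
    by (rule of)
  define nA nB nC where "nA = covec (A 0) (A1 0)" and "nB = covec (B 0) (B1 0)" and "nC = covec (C 0) (C1 0)"
  note conc = O.frames_concurrent[OF straight u0, folded nA_def nB_def nC_def]
  \<comment> \<open>The meets of consecutive boundary lines, so that \<open>p q\<close>,
    \<open>q w\<close>, \<open>w p\<close> carry the first, second and third boundary.\<close>
  define p q w where "p = cprod nC nA" and "q = cprod nA nB" and "w = cprod nB nC"
  define D where "D = cprod nA nB \<bullet> nC"
  have D: "D \<noteq> 0" using conc(1) by (simp add: D_def)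
  have rot: "cprod nB nC \<bullet> nA = D" "cprod nC nA \<bullet> nB = D"
    using cprod_rotate[of nA nB nC] cprod_rotate[of nB nC nA] by (simp_all add: D_def)
  have pq: "cprod p q = D *\<^sub>R nA" "cprod q w = D *\<^sub>R nB" "cprod w p = D *\<^sub>R nC"
    unfolding p_def q_def w_def cprod_cprod using rot D_def by simp_all
  have nz: "nA \<noteq> 0" "nB \<noteq> 0" "nC \<noteq> 0" using D rot by auto
  have pqnz: "p \<noteq> 0" "q \<noteq> 0" "w \<noteq> 0" using D rot D_def by (auto simp: p_def q_def w_def)
  have j: "join (span {p}) (span {q}) = {v. nA \<bullet> v = 0}" "join (span {q}) (span {w}) = {v. nB \<bullet> v = 0}"
    "join (span {w}) (span {p}) = {v. nC \<bullet> v = 0}"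
    unfolding join_span using D nz by (simp_all add: span2_eq_hyperplane pq)
  have off: "nA \<bullet> w \<noteq> 0" "nB \<bullet> p \<noteq> 0" "nC \<bullet> q \<noteq> 0"
    using rot D D_def by (simp_all add: p_def q_def w_def inner_commute)
  have "same_germ a0 \<alpha> (omega {v. nA \<bullet> v = 0} (span {w}))"
  proof (rule R.fa.same_germ_omega[OF O.eps nA_def _ _ off(1)])
    show "nA \<bullet> (A s, 1) = 0" if "s \<in> {-\<epsilon><..<\<epsilon>}" for s
      using straight[OF O.in_r[OF that]] by (simp add: nA_def inner_covec_affine)
    show "covec (A s) (X s) \<bullet> w = 0" if "s \<in> {-\<epsilon><..<\<epsilon>}" for s
      using conc(2)[OF _ that] by (simp add: w_def)
  qed
  moreover have "same_germ b0 \<beta> (omega {v. nB \<bullet> v = 0} (span {p}))"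
  proof (rule R.fb.same_germ_omega[OF O.eps nB_def _ _ off(2)])
    show "nB \<bullet> (B s, 1) = 0" if "s \<in> {-\<epsilon><..<\<epsilon>}" for s
      using straight[OF O.in_r[OF that]] by (simp add: nB_def inner_covec_affine)
    show "covec (B s) (Y s) \<bullet> p = 0" if "s \<in> {-\<epsilon><..<\<epsilon>}" for s
      using conc(3)[OF _ that] by (simp add: p_def)
  qed
  moreover have "same_germ c0 \<gamma> (omega {v. nC \<bullet> v = 0} (span {q}))"
  proof -
    obtain \<eta> where \<eta>: "0 < \<eta>" "\<eta> \<le> \<rho>" "\<forall>v\<in>{-\<eta><..<\<eta>}. covec (C v) (Z v) \<bullet> cprod nA nB = 0"
      using conc(4) by blast
    show ?thesis
    proof (rule R.fc.same_germ_omega[OF \<eta>(1,2) nC_def _ _ off(3)])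
      show "nC \<bullet> (C s, 1) = 0" if "s \<in> {-\<eta><..<\<eta>}" for s
        using straight[of s] that \<eta>(2) by (auto simp: nC_def inner_covec_affine)
      show "covec (C s) (Z s) \<bullet> q = 0" if "s \<in> {-\<eta><..<\<eta>}" for s
        using \<eta>(3) that by (simp add: q_def)
    qed
  qed
  moreover have "noncollinear (span {p}) (span {q}) (span {w})"
    unfolding noncollinear_span_iff[OF pqnz] pq using D off(1) by simp
  ultimately show ?thesis
    using pqnz proj_point_span unfolding j[symmetric] by blast
qed

end

section \<open>Orbits of right-spherical billiards\<close>

lemma cramer:
  "(cprod p q \<bullet> r) *\<^sub>R v = (cprod q r \<bullet> v) *\<^sub>R p + (cprod r p \<bullet> v) *\<^sub>R q + (cprod p q \<bullet> v) *\<^sub>R r"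
  by (simp add: hvec_simps algebra_simps)

text \<open>In the coordinates dual to \<open>p, q, r\<close> the reflection law at a vertex \<open>A\<close> on the side \<open>pq\<close>
  becomes a condition that is invariant under cyclic rotation.\<close>

lemma reflection_in_coordinates:
  fixes p q r A B C l :: hvec
  defines "nA \<equiv> cprod p q" and "nB \<equiv> cprod q r" and "nC \<equiv> cprod r p"
  assumes D: "cprod p q \<bullet> r \<noteq> 0" and on: "nA \<bullet> A = 0" "nB \<bullet> B = 0" "nC \<bullet> C = 0" and nz: "nC \<bullet> A \<noteq> 0"
    and l: "l \<noteq> 0" "l \<bullet> A = 0" "l \<bullet> r = 0"
  shows "l \<bullet> B * (nA \<bullet> C) + l \<bullet> C * (nA \<bullet> B) = 0 \<longleftrightarrow>
    nB \<bullet> A * (nC \<bullet> B) * (nA \<bullet> C) = nC \<bullet> A * (nA \<bullet> B) * (nB \<bullet> C)"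
proof -
  define d x y where "d = cprod p q \<bullet> r" and "x = l \<bullet> p" and "y = l \<bullet> q"
  have d: "d \<noteq> 0" using D by (simp add: d_def)
  \<comment> \<open>As \<open>l\<close> kills \<open>r\<close>, it is determined by its values at
    \<open>p\<close> and \<open>q\<close>.\<close>
  have lv: "d * (l \<bullet> v) = (nB \<bullet> v) * x + (nC \<bullet> v) * y" for v
    using arg_cong[OF cramer[of p q r v], of "inner l"] l(3)
    by (simp add: d_def x_def y_def nA_def nB_def nC_def inner_add_right)
  have A: "(nB \<bullet> A) * x + (nC \<bullet> A) * y = 0" using lv[of A] l(2) by simp
  have B: "d * (l \<bullet> B) = (nC \<bullet> B) * y" and C: "d * (l \<bullet> C) = (nB \<bullet> C) * x"
    using lv[of B] lv[of C] on by simp_all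
  have "x \<noteq> 0"
  proof
    assume "x = 0"
    then have "y = 0" using A nz by simp
    then have "d * (l \<bullet> l) = 0" unfolding lv using \<open>x = 0\<close> by simp
    then show False using d l(1) by simp
  qed
  have "(d * (nC \<bullet> A)) * (l \<bullet> B * (nA \<bullet> C) + l \<bullet> C * (nA \<bullet> B))
      = x * (nC \<bullet> A * (nA \<bullet> B) * (nB \<bullet> C) - nB \<bullet> A * (nC \<bullet> B) * (nA \<bullet> C))"
    using A B C by algebra
  moreover have "d * (nC \<bullet> A) \<noteq> 0" using d nz by simp
  ultimately show ?thesis using \<open>x \<noteq> 0\<close>
    by (metis eq_iff_diff_eq_0 mult_eq_0_iff)
qed

lemma covec_eq_multiple:
  fixes n :: hvec
  assumes "n \<noteq> 0" "n \<bullet> (A, 1) = 0" "n \<bullet> (w, 0) = 0" "w \<noteq> 0"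
  shows "\<exists>k. k \<noteq> 0 \<and> covec A w = k *\<^sub>R n"
proof -
  have ort: "fst n \<bullet> w = 0" using assms(3) by (simp add: inner_prod_def)
  have s: "snd n = - (fst n \<bullet> A)" using assms(2) by (simp add: inner_prod_def)
  have f0: "fst n \<noteq> 0" using s assms(1) by (auto simp: prod_eq_iff)
  define w' :: "real^2" where "w' = vector [- w $ 2, w $ 1]"
  have "cross2 (fst n) w' = 0"
    using ort by (simp add: w'_def cross2_def inner_vec_def sum_2)
  then obtain k where k: "w' = k *\<^sub>R fst n" using cross2_eq_0_iff[OF f0] by blast
  have "w' \<bullet> A = cross2 w A" by (simp add: w'_def cross2_def inner_vec_def sum_2)
  then have "covec A w = k *\<^sub>R n"
    using k s by (simp add: covec_def w'_def[symmetric] prod_eq_iff)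
  moreover have "k \<noteq> 0" using \<open>covec A w = k *\<^sub>R n\<close> covec_nonzero[OF assms(4)] by auto
  ultimately show ?thesis by blast
qed

context framed_arc
begin

lemma eventually_in_nbhd:
  assumes "openin PT_topology V" "b \<in> V"
  shows "\<forall>\<^sub>F s in nhds 0. (A s, span {X s}) \<in> V"
proof -
  have z: "0 \<in> {-r<..<r}" using radius_pos by simp
  show ?thesis
    using assms frame_nonzero[OF z]
    by (intro PT_neighbourhood has_vector_derivative_continuous[OF arc_deriv[OF z]]
        has_vector_derivative_continuous[OF frame_deriv[OF z]]) (auto simp: base)
qed

lemma eventually_in_omega:
  assumes "same_germ b \<alpha> \<Omega>"
  shows "\<exists>\<rho>>0. \<rho> \<le> r \<and> (\<forall>s\<in>{-\<rho><..<\<rho>}. (A s, span {X s}) \<in> \<Omega>)"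
proof -
  obtain U where U: "openin PT_topology U" "b \<in> U" "\<alpha> \<inter> U = \<Omega> \<inter> U"
    using assms unfolding same_germ_def by blast
  then obtain d where d: "d > 0" "\<And>s. dist s 0 < d \<Longrightarrow> (A s, span {X s}) \<in> U"
    using eventually_in_nbhd[OF U(1,2)] unfolding eventually_nhds_metric by blast
  have "(A s, span {X s}) \<in> \<Omega>" if "s \<in> {-(min d r)<..<min d r}" for s
  proof -
    have "s \<in> {-r<..<r}" "dist s 0 < d" using that by (auto simp: dist_real_def)
    then show ?thesis using arc_in d(2) U(3) by blast
  qed
  then show ?thesis using d(1) radius_pos by (intro exI[of _ "min d r"]) auto
qed

text \<open>Differentiating the equation of the line shows that the velocity lies on it. An equation
  of a line is unique up to a scalar, which yields the same normal form as
  \<open>straight_form\<close>.\<close>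

lemma tangent_form_of_line:
  fixes n :: hvec
  assumes n: "n \<noteq> 0" and on: "\<And>s. s \<in> {-r<..<r} \<Longrightarrow> n \<bullet> (A s, 1) = 0" and s: "s \<in> {-r<..<r}"
  shows "\<exists>k. k \<noteq> 0 \<and> (\<forall>P. cross2 (A1 s) (P - A s) = k * (n \<bullet> (P, 1)))"
proof -
  have "((\<lambda>s. n \<bullet> (A s, 1)) has_vector_derivative n \<bullet> (A1 s, 0)) (at s)"
    by (rule bounded_linear.has_vector_derivative[OF bounded_linear_inner_right])
      (intro has_vector_derivative_Pair arc_deriv[OF s] has_vector_derivative_const)
  moreover have "((\<lambda>s. n \<bullet> (A s, 1)) has_vector_derivative 0) (at s)"
    by (rule has_vector_derivative_transform_within_open[OF has_vector_derivative_const _ s])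
      (use on in auto)
  ultimately have "n \<bullet> (A1 s, 0) = 0" by (rule vector_derivative_unique_at)
  from covec_eq_multiple[OF n on[OF s] this velocity_nonzero[OF s]]
  obtain k where "k \<noteq> 0" "covec (A s) (A1 s) = k *\<^sub>R n" by blast
  moreover have "cross2 (A1 s) (P - A s) = covec (A s) (A1 s) \<bullet> (P, 1)" for P
    by (simp add: inner_covec_affine)
  ultimately show ?thesis by auto
qed

end

text \<open>The third vertex is given by an explicit formula rather than by an implicit function
  theorem. Continuity of that formula at the base orbit then suffices to keep the vertex in the germ
  and in the prescribed neighbourhood.\<close>

lemma (in framed_triangle) reflective_of_right_spherical:
  assumes orbit: "periodic_orbit [\<alpha>, \<beta>, \<gamma>] [a0, b0, c0]"
    and pts: "proj_point P" "proj_point Q" "proj_point R" "noncollinear P Q R"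
    and germs: "same_germ a0 \<alpha> (omega (join P Q) R)" "same_germ b0 \<beta> (omega (join Q R) P)"
      "same_germ c0 \<gamma> (omega (join R P) Q)"
  shows "reflective [\<alpha>, \<beta>, \<gamma>] [a0, b0, c0]"
proof -
  obtain p where p: "p \<noteq> 0" "P = span {p}" using proj_pointE[OF pts(1)] .
  obtain q where q: "q \<noteq> 0" "Q = span {q}" using proj_pointE[OF pts(2)] .
  obtain w where w: "w \<noteq> 0" "R = span {w}" using proj_pointE[OF pts(3)] .
  define nA nB nC where "nA = cprod p q" and "nB = cprod q w" and "nC = cprod w p"
  define D where "D = cprod p q \<bullet> w"
  have D: "D \<noteq> 0" using pts(4) noncollinear_span_iff[OF p(1) q(1) w(1)] by (simp add: D_def p q w)
  have rot: "cprod q w \<bullet> p = D" "cprod w p \<bullet> q = D"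
    using cprod_rotate[of p q w] cprod_rotate[of q w p] by (simp_all add: D_def)
  have off: "nA \<bullet> w = D" "nB \<bullet> p = D" "nC \<bullet> q = D" using rot by (simp_all add: nA_def nB_def nC_def D_def)
  then have nz: "nA \<noteq> 0" "nB \<noteq> 0" "nC \<noteq> 0" using D by auto
  have j: "join P Q = {v. nA \<bullet> v = 0}" "join Q R = {v. nB \<bullet> v = 0}" "join R P = {v. nC \<bullet> v = 0}"
    using nz by (simp_all add: p q w join_span span2_eq_hyperplane nA_def nB_def nC_def)
  note om = in_omega_iff[of nA w, unfolded off, OF D] in_omega_iff[of nB p, unfolded off, OF D]
    in_omega_iff[of nC q, unfolded off, OF D]
  obtain \<rho>1 where \<rho>1: "\<rho>1 > 0" "\<rho>1 \<le> r" "\<And>s. s \<in> {-\<rho>1<..<\<rho>1} \<Longrightarrow> (A s, span {X s}) \<in> omega (join P Q) R"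
    using fa.eventually_in_omega[OF germs(1)] by blast
  obtain \<rho>2 where \<rho>2: "\<rho>2 > 0" "\<rho>2 \<le> r" "\<And>s. s \<in> {-\<rho>2<..<\<rho>2} \<Longrightarrow> (B s, span {Y s}) \<in> omega (join Q R) P"
    using fb.eventually_in_omega[OF germs(2)] by blast
  obtain \<rho>3 where \<rho>3: "\<rho>3 > 0" "\<rho>3 \<le> r" "\<And>s. s \<in> {-\<rho>3<..<\<rho>3} \<Longrightarrow> (C s, span {Z s}) \<in> omega (join R P) Q"
    using fc.eventually_in_omega[OF germs(3)] by blast
  define \<rho> where "\<rho> = min \<rho>1 (min \<rho>2 \<rho>3)"
  have \<rho>: "0 < \<rho>" "\<rho> \<le> r" using \<rho>1 \<rho>2 \<rho>3 by (auto simp: \<rho>_def)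
  interpret R: framed_triangle \<alpha> a0 \<rho> A A1 A2 X X1 \<beta> b0 B B1 B2 Y Y1 \<gamma> c0 C C1 C2 Z Z1 m M
    by (rule restrict[OF \<rho>])
  have inA: "nA \<bullet> (A s, 1) = 0" "covec (A s) (X s) \<bullet> w = 0" if "s \<in> {-\<rho><..<\<rho>}" for s
    using \<rho>1(3)[of s] that unfolding j w(2) om by (auto simp: \<rho>_def)
  have inB: "nB \<bullet> (B s, 1) = 0" "covec (B s) (Y s) \<bullet> p = 0" if "s \<in> {-\<rho><..<\<rho>}" for s
    using \<rho>2(3)[of s] that unfolding j p(2) om by (auto simp: \<rho>_def)
  have inC: "nC \<bullet> (C s, 1) = 0" "covec (C s) (Z s) \<bullet> q = 0" if "s \<in> {-\<rho><..<\<rho>}" for s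
    using \<rho>3(3)[of s] that unfolding j q(2) om by (auto simp: \<rho>_def)
  define rel where "rel s t v \<longleftrightarrow> nB \<bullet> (A s, 1) * (nC \<bullet> (B t, 1)) * (nA \<bullet> (C v, 1))
      = nC \<bullet> (A s, 1) * (nA \<bullet> (B t, 1)) * (nB \<bullet> (C v, 1))" for s t v
  have nonzero_forms: "nA \<bullet> (B t, 1) \<noteq> 0" "nA \<bullet> (C v, 1) \<noteq> 0" "nB \<bullet> (A s, 1) \<noteq> 0"
      "nB \<bullet> (C v, 1) \<noteq> 0" "nC \<bullet> (A s, 1) \<noteq> 0" "nC \<bullet> (B t, 1) \<noteq> 0"
    and orbit_rel: "periodic_orbit [\<alpha>, \<beta>, \<gamma>] [(A s, span {X s}), (B t, span {Y t}), (C v, span {Z v})] \<longleftrightarrow> rel s t v"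
    if st: "s \<in> {-\<rho><..<\<rho>}" "t \<in> {-\<rho><..<\<rho>}" "v \<in> {-\<rho><..<\<rho>}" for s t v
  proof -
    obtain kA where kA: "kA \<noteq> 0" "\<And>P. cross2 (A1 s) (P - A s) = kA * (nA \<bullet> (P, 1))"
      using R.fa.tangent_form_of_line[OF nz(1) inA(1) st(1)] by blast
    obtain kB where kB: "kB \<noteq> 0" "\<And>P. cross2 (B1 t) (P - B t) = kB * (nB \<bullet> (P, 1))"
      using R.fb.tangent_form_of_line[OF nz(2) inB(1) st(2)] by blast
    obtain kC where kC: "kC \<noteq> 0" "\<And>P. cross2 (C1 v) (P - C v) = kC * (nC \<bullet> (P, 1))"
      using R.fc.tangent_form_of_line[OF nz(3) inC(1) st(3)] by blast
    show n: "nA \<bullet> (B t, 1) \<noteq> 0" "nA \<bullet> (C v, 1) \<noteq> 0" "nB \<bullet> (A s, 1) \<noteq> 0"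
      "nB \<bullet> (C v, 1) \<noteq> 0" "nC \<bullet> (A s, 1) \<noteq> 0" "nC \<bullet> (B t, 1) \<noteq> 0"
      using R.nonzero[OF st] unfolding kA kB kC by auto
    have cancel: "x * (k * a) + y * (k * b) = 0 \<longleftrightarrow> x * a + y * b = 0" if "k \<noteq> 0" for x y a b k :: real
    proof -
      have "x * (k * a) + y * (k * b) = k * (x * a + y * b)" by algebra
      then show ?thesis using that by simp
    qed
    note on = inA(1)[OF st(1)] inB(1)[OF st(2)] inC(1)[OF st(3)]
    note D' = D[unfolded D_def]
    have "reflects (X s) (A1 s) (A s) (B t) (C v) \<longleftrightarrow> rel s t v"
      unfolding reflects_def kA(2) cancel[OF kA(1)] rel_def unfolding inner_covec_affine[symmetric]
      using reflection_in_coordinates[OF D', folded nA_def nB_def nC_def, OF on n(5)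
          covec_nonzero[OF R.fa.frame_nonzero[OF st(1)]] covec_base inA(2)[OF st(1)]] .
    moreover have "reflects (Y t) (B1 t) (B t) (A s) (C v) \<longleftrightarrow> rel s t v"
      unfolding reflects_def kB(2) cancel[OF kB(1)] rel_def unfolding inner_covec_affine[symmetric]
      using reflection_in_coordinates[of q w p, folded nA_def nB_def nC_def, OF _ on(2,3,1) n(1)
          covec_nonzero[OF R.fb.frame_nonzero[OF st(2)]] covec_base inB(2)[OF st(2)]] off D
      by (auto simp: ac_simps)
    moreover have "reflects (Z v) (C1 v) (C v) (A s) (B t) \<longleftrightarrow> rel s t v"
      unfolding reflects_def kC(2) cancel[OF kC(1)] rel_def unfolding inner_covec_affine[symmetric]
      using reflection_in_coordinates[of w p q, folded nA_def nB_def nC_def, OF _ on(3,1,2) n(4)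
          covec_nonzero[OF R.fc.frame_nonzero[OF st(3)]] covec_base inC(2)[OF st(3)]] off D
      by (auto simp: ac_simps)
    ultimately show "periodic_orbit [\<alpha>, \<beta>, \<gamma>] [(A s, span {X s}), (B t, span {Y t}), (C v, span {Z v})] \<longleftrightarrow> rel s t v"
      unfolding R.orbit_iff[OF st] by blast
  qed
  have z: "0 \<in> {-\<rho><..<\<rho>}" using \<rho> by simp
  \<comment> \<open>Solves \<open>rel\<close> on the third side. A point there is a combination of
    \<open>p\<close> and \<open>w\<close>; \<open>nB\<close> and \<open>nA\<close> read off its two
    coefficients times \<open>D\<close>, and \<open>rel\<close> prescribes only their ratio.\<close>
  define K where "K x = (nB \<bullet> (A (fst x), 1) * (nC \<bullet> (B (snd x), 1))) *\<^sub>R p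
      + (nC \<bullet> (A (fst x), 1) * (nA \<bullet> (B (snd x), 1))) *\<^sub>R w" for x :: "real \<times> real"
  define G where "G x = fst (K x) /\<^sub>R snd (K x)" for x
  \<comment> \<open>The direction from \<open>G x\<close> towards \<open>q\<close>, valid also when
    \<open>q\<close> is at infinity, where \<open>snd q = 0\<close>.\<close>
  define W where "W x = fst q - snd q *\<^sub>R G x" for x
  have nC_K: "nC \<bullet> K x = 0" for x by (simp add: K_def nC_def inner_add_right)
  have nA_K: "nA \<bullet> K x = nC \<bullet> (A (fst x), 1) * (nA \<bullet> (B (snd x), 1)) * D"
    and nB_K: "nB \<bullet> K x = nB \<bullet> (A (fst x), 1) * (nC \<bullet> (B (snd x), 1)) * D" for x
    using off by (simp_all add: K_def inner_add_right) (simp_all add: nA_def nB_def)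
  \<comment> \<open>The relation \<open>rel 0 0 0\<close> turns \<open>K (0, 0)\<close> into a
    multiple of the Cramer expansion of \<open>(C 0, 1)\<close>, so the formula returns the base
    vertex.\<close>
  have K0: "\<exists>k. k \<noteq> 0 \<and> K (0, 0) = k *\<^sub>R (C 0, 1)"
  proof -
    note n0 = nonzero_forms[OF z z z]
    have "rel 0 0 0" using orbit_rel[OF z z z] orbit by (simp add: fa.base fb.base fc.base)
    then have "(nA \<bullet> (C 0, 1)) *\<^sub>R K (0, 0) = (nC \<bullet> (A 0, 1) * (nA \<bullet> (B 0, 1)))
        *\<^sub>R ((nB \<bullet> (C 0, 1)) *\<^sub>R p + (nC \<bullet> (C 0, 1)) *\<^sub>R q + (nA \<bullet> (C 0, 1)) *\<^sub>R w)"
      using inC(1)[OF z] by (simp add: K_def rel_def scaleR_add_right mult.commute mult.left_commute)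
    also have "\<dots> = (nC \<bullet> (A 0, 1) * (nA \<bullet> (B 0, 1)) * D) *\<^sub>R (C 0, 1)"
      unfolding nA_def nB_def nC_def cramer[symmetric] D_def by simp
    finally have e: "(nA \<bullet> (C 0, 1)) *\<^sub>R K (0, 0) = (nC \<bullet> (A 0, 1) * (nA \<bullet> (B 0, 1)) * D) *\<^sub>R (C 0, 1)" .
    have "K (0, 0) = (1 / (nA \<bullet> (C 0, 1))) *\<^sub>R ((nA \<bullet> (C 0, 1)) *\<^sub>R K (0, 0))" using n0 by simp
    also have "\<dots> = ((nC \<bullet> (A 0, 1) * (nA \<bullet> (B 0, 1)) * D) / (nA \<bullet> (C 0, 1))) *\<^sub>R (C 0, 1)"
      unfolding e by simp
    finally have "K (0, 0) = ((nC \<bullet> (A 0, 1) * (nA \<bullet> (B 0, 1)) * D) / (nA \<bullet> (C 0, 1))) *\<^sub>R (C 0, 1)" .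
    moreover have "(nC \<bullet> (A 0, 1) * (nA \<bullet> (B 0, 1)) * D) / (nA \<bullet> (C 0, 1)) \<noteq> 0" using n0 D by simp
    ultimately show ?thesis by blast
  qed
  have sK0: "snd (K (0, 0)) \<noteq> 0" and G0: "G (0, 0) = C 0" using K0 by (auto simp: G_def)
  have W0: "W (0, 0) \<noteq> 0"
  proof
    assume "W (0, 0) = 0"
    then have "q = snd q *\<^sub>R (C 0, 1)" by (simp add: W_def G0 prod_eq_iff)
    then have "nC \<bullet> q = snd q * (nC \<bullet> (C 0, 1))" by (metis inner_scaleR_right)
    then show False using off inC(1)[OF z] D by simp
  qed
  have base_eq: "(G (0, 0), span {W (0, 0)}) = c0"
  proof -
    have "cross2 (Z 0) (W (0, 0)) = 0"
      using inC(2)[OF z] by (simp add: inner_covec W_def G0)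
    then show ?thesis
      using span_singleton_eq_iff[OF R.fc.frame_nonzero[OF z] W0] by (simp add: fc.base G0)
  qed
  have cont: "isCont K (0, 0)"
  proof -
    have "isCont A 0" "isCont B 0"
      using has_vector_derivative_continuous[OF R.fa.arc_deriv[OF z]]
        has_vector_derivative_continuous[OF R.fb.arc_deriv[OF z]] by auto
    then have "isCont (\<lambda>x. A (fst x)) (0, 0)" "isCont (\<lambda>x. B (snd x)) (0, 0)"
      using isCont_o2[where f = fst and g = A and a = "(0, 0)"] isCont_o2[where f = snd and g = B and a = "(0, 0)"]
      by auto
    then show ?thesis unfolding K_def[abs_def] by (intro continuous_intros)
  qed
  have contG: "isCont G (0, 0)" unfolding G_def[abs_def]
    using sK0 by (intro continuous_intros cont)
  have contW: "isCont W (0, 0)" unfolding W_def[abs_def] by (intro continuous_intros contG)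
  show ?thesis
    unfolding reflective_def
  proof (intro conjI allI impI)
    show "periodic_orbit [\<alpha>, \<beta>, \<gamma>] [a0, b0, c0]" by (rule orbit)
    fix V assume V: "\<forall>j<length [\<alpha>, \<beta>, \<gamma>]. openin PT_topology (V j) \<and> [a0, b0, c0] ! j \<in> V j"
    have V0: "openin PT_topology (V 0)" "a0 \<in> V 0" and V1: "openin PT_topology (V 1)" "b0 \<in> V 1"
      and V2: "openin PT_topology (V 2)" "c0 \<in> V 2"
      using V[rule_format, of 0] V[rule_format, of 1] V[rule_format, of 2] by simp_all
    obtain U where U: "openin PT_topology U" "c0 \<in> U" "\<gamma> \<inter> U = omega (join R P) Q \<inter> U"
      using germs(3) unfolding same_germ_def by blast
    obtain N where N: "open N" "C 0 \<in> N" "\<And>x. x \<in> \<gamma> \<Longrightarrow> fst x \<in> N \<Longrightarrow> \<exists>v\<in>{-\<rho><..<\<rho>}. x = (C v, span {Z v})"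
      using R.fc.nbhd[OF \<rho>(1) order_refl] by blast
    \<comment> \<open>The three sets express closeness to the base point, agreement of
      \<open>\<gamma>\<close> with \<open>omega\<close>, and possession of a parameter within
      \<open>\<rho>\<close>.\<close>
    have "openin PT_topology (V 2 \<inter> U \<inter> {x \<in> PT. fst x \<in> N})"
      by (intro openin_Int V2 U openin_PT_fst N)
    moreover have "c0 \<in> V 2 \<inter> U \<inter> {x \<in> PT. fst x \<in> N}"
      using V2 U N fc.subset_PT R.fc.arc_in[OF z] by (auto simp: fc.base)
    ultimately have "\<forall>\<^sub>F x in nhds (0, 0). (G x, span {W x}) \<in> V 2 \<inter> U \<inter> {x \<in> PT. fst x \<in> N}"
      by (intro PT_neighbourhood contG contW W0) (simp_all add: base_eq)
    moreover have "\<forall>\<^sub>F x in nhds (0, 0). snd (K x) \<noteq> 0"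
    proof -
      have "isCont (\<lambda>x. snd (K x)) (0, 0)" by (intro continuous_intros cont)
      then have "((\<lambda>x. snd (K x)) \<longlongrightarrow> snd (K (0, 0))) (nhds (0, 0))"
        using tendsto_at_iff_tendsto_nhds[of "\<lambda>x. snd (K x)" "(0, 0)"] by (simp add: isCont_def)
      then show ?thesis using sK0 by (rule tendsto_imp_eventually_ne)
    qed
    ultimately have "\<forall>\<^sub>F x in nhds 0 \<times>\<^sub>F nhds 0.
        (G x, span {W x}) \<in> V 2 \<inter> U \<inter> {x \<in> PT. fst x \<in> N} \<and> snd (K x) \<noteq> 0"
      unfolding nhds_prod by eventually_elim blast
    then obtain S T where ST: "\<forall>\<^sub>F s in nhds 0. S s" "\<forall>\<^sub>F t in nhds 0. T t"
      "\<And>s t. S s \<Longrightarrow> T t \<Longrightarrow> (G (s, t), span {W (s, t)}) \<in> V 2 \<inter> U \<inter> {x \<in> PT. fst x \<in> N} \<and> snd (K (s, t)) \<noteq> 0"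
      unfolding eventually_prod_filter by blast
    have "\<forall>\<^sub>F s in nhds 0. S s \<and> T s \<and> (A s, span {X s}) \<in> V 0 \<and> (B s, span {Y s}) \<in> V 1"
      using ST(1,2) fa.eventually_in_nbhd[OF V0] fb.eventually_in_nbhd[OF V1] by eventually_elim blast
    then obtain d where d: "d > 0"
      "\<And>s. dist s 0 < d \<Longrightarrow> S s \<and> T s \<and> (A s, span {X s}) \<in> V 0 \<and> (B s, span {Y s}) \<in> V 1"
      unfolding eventually_nhds_metric by blast
    define \<epsilon> where "\<epsilon> = min d \<rho>"
    have \<epsilon>: "0 < \<epsilon>" "\<epsilon> \<le> \<rho>" using d(1) \<rho> by (auto simp: \<epsilon>_def)
    have near: "s \<in> {-\<rho><..<\<rho>}" "dist s 0 < d" if "s \<in> {-\<epsilon><..<\<epsilon>}" for s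
      using that by (auto simp: \<epsilon>_def dist_real_def)
    obtain W1 where W1: "open W1" "A 0 \<in> W1" "\<forall>x\<in>\<alpha>. fst x \<in> W1 \<longrightarrow> (\<exists>s\<in>{-\<epsilon><..<\<epsilon>}. x = (A s, span {X s}))"
      using R.fa.nbhd[OF \<epsilon>] by blast
    obtain W2 where W2: "open W2" "B 0 \<in> W2" "\<forall>x\<in>\<beta>. fst x \<in> W2 \<longrightarrow> (\<exists>s\<in>{-\<epsilon><..<\<epsilon>}. x = (B s, span {Y s}))"
      using R.fb.nbhd[OF \<epsilon>] by blast
    show "\<exists>U1 U2. openin PT_topology U1 \<and> [a0, b0, c0] ! 0 \<in> U1 \<and> openin PT_topology U2 \<and> [a0, b0, c0] ! 1 \<in> U2 \<and>
      (\<forall>x1 \<in> [\<alpha>, \<beta>, \<gamma>] ! 0 \<inter> U1. \<forall>x2 \<in> [\<alpha>, \<beta>, \<gamma>] ! 1 \<inter> U2.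
        \<exists>xs. periodic_orbit [\<alpha>, \<beta>, \<gamma>] xs \<and> xs ! 0 = x1 \<and> xs ! 1 = x2 \<and> (\<forall>j<length [\<alpha>, \<beta>, \<gamma>]. xs ! j \<in> V j))"
    proof (rule exI[of _ "{x \<in> PT. fst x \<in> W1}"], rule exI[of _ "{x \<in> PT. fst x \<in> W2}"], intro conjI ballI)
      show "openin PT_topology {x \<in> PT. fst x \<in> W1}" "openin PT_topology {x \<in> PT. fst x \<in> W2}"
        by (intro openin_PT_fst W1 W2)+
      show "[a0, b0, c0] ! 0 \<in> {x \<in> PT. fst x \<in> W1}" "[a0, b0, c0] ! 1 \<in> {x \<in> PT. fst x \<in> W2}"
        using W1(2) W2(2) R.fa.arc_in[OF z] R.fb.arc_in[OF z] fa.subset_PT fb.subset_PT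
        by (auto simp: fa.base fb.base)
      fix x1 x2 assume x: "x1 \<in> [\<alpha>, \<beta>, \<gamma>] ! 0 \<inter> {x \<in> PT. fst x \<in> W1}" "x2 \<in> [\<alpha>, \<beta>, \<gamma>] ! 1 \<inter> {x \<in> PT. fst x \<in> W2}"
      obtain s where s: "s \<in> {-\<epsilon><..<\<epsilon>}" "x1 = (A s, span {X s})" using x(1) W1(3) by auto
      obtain t where t: "t \<in> {-\<epsilon><..<\<epsilon>}" "x2 = (B t, span {Y t})" using x(2) W2(3) by auto
      note ds = d(2)[OF near(2)[OF s(1)]] and dt = d(2)[OF near(2)[OF t(1)]]
      have g: "(G (s, t), span {W (s, t)}) \<in> V 2" "(G (s, t), span {W (s, t)}) \<in> U"
        "(G (s, t), span {W (s, t)}) \<in> PT" "G (s, t) \<in> N" and sK: "snd (K (s, t)) \<noteq> 0"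
        using ST(3)[of s t] ds dt by auto
      have GK: "K (s, t) = snd (K (s, t)) *\<^sub>R (G (s, t), 1)"
        using sK by (simp add: G_def prod_eq_iff)
      have form: "n \<bullet> (G (s, t), 1) * snd (K (s, t)) = n \<bullet> K (s, t)" for n :: hvec
        using arg_cong[OF GK, of "inner n"] unfolding inner_scaleR_right by (simp only: mult.commute)
      have "W (s, t) \<noteq> 0" using g(3) by (auto simp: PT_def)
      moreover have "nC \<bullet> (G (s, t), 1) = 0" using form[of nC] nC_K sK by simp
      moreover have "covec (G (s, t)) (W (s, t)) \<bullet> q = 0"
        by (simp add: inner_covec W_def)
      ultimately have "(G (s, t), span {W (s, t)}) \<in> omega (join R P) Q"
        unfolding j q(2) om by blast
      then have "(G (s, t), span {W (s, t)}) \<in> \<gamma>" using U(3) g(2) by blast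
      then obtain v where v: "v \<in> {-\<rho><..<\<rho>}" "(G (s, t), span {W (s, t)}) = (C v, span {Z v})"
        using N(3)[of "(G (s, t), span {W (s, t)})"] g(4) by auto
      have "rel s t v"
      proof -
        have GA: "nA \<bullet> (C v, 1) * snd (K (s, t)) = nC \<bullet> (A s, 1) * (nA \<bullet> (B t, 1)) * D"
          and GB: "nB \<bullet> (C v, 1) * snd (K (s, t)) = nB \<bullet> (A s, 1) * (nC \<bullet> (B t, 1)) * D"
          using v(2) form[of nA] form[of nB] nA_K[of "(s, t)"] nB_K[of "(s, t)"] by simp_all
        have "(nB \<bullet> (A s, 1) * (nC \<bullet> (B t, 1)) * (nA \<bullet> (C v, 1))) * snd (K (s, t))
            = (nC \<bullet> (A s, 1) * (nA \<bullet> (B t, 1)) * (nB \<bullet> (C v, 1))) * snd (K (s, t))"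
          using GA GB by algebra
        then show ?thesis using sK by (simp add: rel_def)
      qed
      then have "periodic_orbit [\<alpha>, \<beta>, \<gamma>] [x1, x2, (C v, span {Z v})]"
        unfolding s(2) t(2) using orbit_rel[OF near(1)[OF s(1)] near(1)[OF t(1)] v(1)] by blast
      moreover have "\<forall>j<length [\<alpha>, \<beta>, \<gamma>]. [x1, x2, (C v, span {Z v})] ! j \<in> V j"
      proof (intro allI impI)
        fix j assume "j < length [\<alpha>, \<beta>, \<gamma>]"
        then have "j = 0 \<or> j = 1 \<or> j = 2" by auto
        then show "[x1, x2, (C v, span {Z v})] ! j \<in> V j"
          using ds dt g(1) v(2) by (auto simp: s t)
      qed
      ultimately show "\<exists>xs. periodic_orbit [\<alpha>, \<beta>, \<gamma>] xs \<and> xs ! 0 = x1 \<and> xs ! 1 = x2 \<and>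
          (\<forall>j<length [\<alpha>, \<beta>, \<gamma>]. xs ! j \<in> V j)"
        by (intro exI[of _ "[x1, x2, (C v, span {Z v})]"]) simp
    qed
  qed
qed

text \<open>Nontangency of the base orbit gives six nonzero values, each bounded above and away from
  zero on its own square; extremes over the six give common constants.\<close>

lemma framed_triangle_exists:
  assumes lf: "line_framed_curve \<alpha>" "line_framed_curve \<beta>" "line_framed_curve \<gamma>"
    and mem: "a0 \<in> \<alpha>" "b0 \<in> \<beta>" "c0 \<in> \<gamma>"
    and orbit: "periodic_orbit [\<alpha>, \<beta>, \<gamma>] [a0, b0, c0]"
  shows "\<exists>r A A1 A2 X X1 B B1 B2 Y Y1 C C1 C2 Z Z1 m M.
    framed_triangle \<alpha> a0 r A A1 A2 X X1 \<beta> b0 B B1 B2 Y Y1 \<gamma> c0 C C1 C2 Z Z1 m M"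
proof -
  obtain r1 A A1 A2 X X1 where a: "framed_arc \<alpha> a0 r1 A A1 A2 X X1"
    using framed_arc_exists[OF lf(1) mem(1)] by blast
  obtain r2 B B1 B2 Y Y1 where b: "framed_arc \<beta> b0 r2 B B1 B2 Y Y1"
    using framed_arc_exists[OF lf(2) mem(2)] by blast
  obtain r3 C C1 C2 Z Z1 where c: "framed_arc \<gamma> c0 r3 C C1 C2 Z Z1"
    using framed_arc_exists[OF lf(3) mem(3)] by blast
  define r where "r = min r1 (min r2 r3)"
  have r: "0 < r" "r \<le> r1" "r \<le> r2" "r \<le> r3"
    using framed_arc.radius_pos[OF a] framed_arc.radius_pos[OF b] framed_arc.radius_pos[OF c] by (auto simp: r_def)
  note a = framed_arc.restrict[OF a r(1,2)] and b = framed_arc.restrict[OF b r(1,3)]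
    and c = framed_arc.restrict[OF c r(1,4)]
  have z: "0 \<in> {-r<..<r}" using r by simp
  note tri = orbit[unfolded framed_arc.base[OF a] framed_arc.base[OF b] framed_arc.base[OF c]
      periodic_orbit_triangle_iff[OF a b c z z z]]
  obtain d1 m1 M1 where 1: "d1 > 0" "m1 > 0" "\<And>r' m' M'. r' \<le> d1 \<Longrightarrow> m' \<le> m1 \<Longrightarrow> M1 \<le> M' \<Longrightarrow> nontangent r' m' M' A A1 B"
    using nontangent_exists[OF a b] tri by blast
  obtain d2 m2 M2 where 2: "d2 > 0" "m2 > 0" "\<And>r' m' M'. r' \<le> d2 \<Longrightarrow> m' \<le> m2 \<Longrightarrow> M2 \<le> M' \<Longrightarrow> nontangent r' m' M' A A1 C"
    using nontangent_exists[OF a c] tri by blast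
  obtain d3 m3 M3 where 3: "d3 > 0" "m3 > 0" "\<And>r' m' M'. r' \<le> d3 \<Longrightarrow> m' \<le> m3 \<Longrightarrow> M3 \<le> M' \<Longrightarrow> nontangent r' m' M' B B1 A"
    using nontangent_exists[OF b a] tri by blast
  obtain d4 m4 M4 where 4: "d4 > 0" "m4 > 0" "\<And>r' m' M'. r' \<le> d4 \<Longrightarrow> m' \<le> m4 \<Longrightarrow> M4 \<le> M' \<Longrightarrow> nontangent r' m' M' B B1 C"
    using nontangent_exists[OF b c] tri by blast
  obtain d5 m5 M5 where 5: "d5 > 0" "m5 > 0" "\<And>r' m' M'. r' \<le> d5 \<Longrightarrow> m' \<le> m5 \<Longrightarrow> M5 \<le> M' \<Longrightarrow> nontangent r' m' M' C C1 A"
    using nontangent_exists[OF c a] tri by blast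
  obtain d6 m6 M6 where 6: "d6 > 0" "m6 > 0" "\<And>r' m' M'. r' \<le> d6 \<Longrightarrow> m' \<le> m6 \<Longrightarrow> M6 \<le> M' \<Longrightarrow> nontangent r' m' M' C C1 B"
    using nontangent_exists[OF c b] tri by blast
  define \<rho> where "\<rho> = Min {r, d1, d2, d3, d4, d5, d6}"
  define m where "m = Min {m1, m2, m3, m4, m5, m6}"
  define M where "M = Max {M1, M2, M3, M4, M5, M6}"
  have \<rho>: "0 < \<rho>" "\<rho> \<le> r" using r(1) 1 2 3 4 5 6 by (simp_all add: \<rho>_def)
  have \<rho>_le: "\<rho> \<le> d1" "\<rho> \<le> d2" "\<rho> \<le> d3" "\<rho> \<le> d4" "\<rho> \<le> d5" "\<rho> \<le> d6"
    unfolding \<rho>_def by (simp_all only: Min_le finite.intros insert_iff simp_thms)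
  have m_le: "m \<le> m1" "m \<le> m2" "m \<le> m3" "m \<le> m4" "m \<le> m5" "m \<le> m6"
    unfolding m_def by (simp_all only: Min_le finite.intros insert_iff simp_thms)
  have M_ge: "M1 \<le> M" "M2 \<le> M" "M3 \<le> M" "M4 \<le> M" "M5 \<le> M" "M6 \<le> M"
    unfolding M_def by (simp_all only: Max_ge finite.intros insert_iff simp_thms)
  have "framed_triangle \<alpha> a0 \<rho> A A1 A2 X X1 \<beta> b0 B B1 B2 Y Y1 \<gamma> c0 C C1 C2 Z Z1 m M"
    unfolding framed_triangle_def framed_triangle_axioms_def
  proof (intro conjI)
    show "framed_arc \<alpha> a0 \<rho> A A1 A2 X X1" by (rule framed_arc.restrict[OF a \<rho>])
    show "framed_arc \<beta> b0 \<rho> B B1 B2 Y Y1" by (rule framed_arc.restrict[OF b \<rho>])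
    show "framed_arc \<gamma> c0 \<rho> C C1 C2 Z Z1" by (rule framed_arc.restrict[OF c \<rho>])
    show "0 < m" using 1 2 3 4 5 6 by (simp add: m_def)
    show "nontangent \<rho> m M A A1 B" by (rule 1(3)[OF \<rho>_le(1) m_le(1) M_ge(1)])
    show "nontangent \<rho> m M A A1 C" by (rule 2(3)[OF \<rho>_le(2) m_le(2) M_ge(2)])
    show "nontangent \<rho> m M B B1 A" by (rule 3(3)[OF \<rho>_le(3) m_le(3) M_ge(3)])
    show "nontangent \<rho> m M B B1 C" by (rule 4(3)[OF \<rho>_le(4) m_le(4) M_ge(4)])
    show "nontangent \<rho> m M C C1 A" by (rule 5(3)[OF \<rho>_le(5) m_le(5) M_ge(5)])
    show "nontangent \<rho> m M C C1 B" by (rule 6(3)[OF \<rho>_le(6) m_le(6) M_ge(6)])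
  qed
  then show ?thesis by blast
qed

theorem theorem1p13:
  fixes \<alpha> \<beta> \<gamma> :: "line_element set" and a0 b0 c0 :: line_element
  assumes "local_projective_billiard [\<alpha>, \<beta>, \<gamma>] [a0, b0, c0]"
    and "periodic_orbit [\<alpha>, \<beta>, \<gamma>] [a0, b0, c0]"
  shows "reflective [\<alpha>, \<beta>, \<gamma>] [a0, b0, c0] \<longleftrightarrow>
    (\<exists>P Q R. proj_point P \<and> proj_point Q \<and> proj_point R \<and> noncollinear P Q R \<and>
       same_germ a0 \<alpha> (omega (join P Q) R) \<and>
       same_germ b0 \<beta> (omega (join Q R) P) \<and>
       same_germ c0 \<gamma> (omega (join R P) Q))"
proof -
  have "\<forall>j<length [\<alpha>, \<beta>, \<gamma>]. line_framed_curve ([\<alpha>, \<beta>, \<gamma>] ! j) \<and> [a0, b0, c0] ! j \<in> [\<alpha>, \<beta>, \<gamma>] ! j"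
    using assms(1) unfolding local_projective_billiard_def by blast
  from this[rule_format, of 0] this[rule_format, of 1] this[rule_format, of 2]
  have "line_framed_curve \<alpha>" "line_framed_curve \<beta>" "line_framed_curve \<gamma>" "a0 \<in> \<alpha>" "b0 \<in> \<beta>" "c0 \<in> \<gamma>"
    by simp_all
  from framed_triangle_exists[OF this assms(2)]
  obtain r A A1 A2 X X1 B B1 B2 Y Y1 C C1 C2 Z Z1 m M where
    "framed_triangle \<alpha> a0 r A A1 A2 X X1 \<beta> b0 B B1 B2 Y Y1 \<gamma> c0 C C1 C2 Z Z1 m M" by blast
  then interpret framed_triangle \<alpha> a0 r A A1 A2 X X1 \<beta> b0 B B1 B2 Y Y1 \<gamma> c0 C C1 C2 Z Z1 m M .
  show ?thesis
    using right_spherical_of_reflective reflective_of_right_spherical[OF assms(2)] by blast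
qed

end
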